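(* Let $\Bbbk$ be a perfect field of characteristic $p>0$, let $L\subseteq X$ be a (two-sided) ladder with $v$ lower-outside corners in a $k\times\ell$ generic matrix $X$, let $\mathbf{t}=(t_1,\ldots,t_v)\in\mathbb{Z}_{>0}^v$, and let $I=I_{\mathbf t}(L)\subseteq R=\Bbbk[L]$ be the corresponding mixed ladder determinantal ideal. Let $\prec$ be an antidiagonal term order, and assume that $\mathrm{in}_\prec(\mathcal{R}^s(I)):=\bigoplus_{n\ge0}\mathrm{in}_\prec(I^{(n)})$ is Noetherian. If $p\gg0$, namely if $p>\mathrm{lcm}(b_1,\ldots,b_m)$ where $\bigoplus_{n\ge0}\mathrm{in}_\prec(I^{(n)})$ is generated as an $R$-algebra by homogeneous elements of degrees $b_1,\ldots,b_m$ in the grading by $n$, then $$\mathrm{in}_\prec\left(I^{(n)}\right)=\left(\mathrm{in}_\prec(I)\right)^{(n)}\quad\text{for every } n\in\mathbb{N}.$$ In particular, if $I=I_t(L)$ for some $t\in\mathbb{Z}_{>0}$, then the equality $\mathrm{in}_\prec\left(I^{(n)}\right)=\left(\mathrm{in}_\prec(I)\right)^{(n)}$ for every $n\in\mathbb{N}$ holds for all $p>(\min\{k,\ell\}-t+1)!$.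
   Context: Ladders. Let $X=(x_{i,j})$ be a $k\times\ell$ matrix of distinct indeterminates. A subset $L\subseteq X$ is a (two-sided) ladder if whenever $x_{i,j},x_{i',j'}\in L$ with $i\le i'$ and $j\ge j'$, then $x_{u,w}\in L$ for all $i\le u\le i'$, $j'\le w\le j$. (An entry with indices out of range is regarded as not in $L$.) The upper-outside corners of $L$ are the elements $x_{b_1,a_1},\ldots,x_{b_u,a_u}\in L$, with $1=b_1<\cdots<b_u$ and $a_1<\cdots<a_u=\ell$, defined by $x_{b_h-1,a_h}\notin L$ and $x_{b_h,a_h+1}\notin L$ (these $b_h$ are unrelated to the degrees $b_i$ in the claim). The lower-outside corners $x_{d_1,c_1},\ldots,x_{d_v,c_v}\in L$, with $d_1\le\cdots\le d_v=k$ and $1=c_1\le\cdots\le c_v$, are part of the data of the ladder: they include all $x_{i,j}\in L$ with $x_{i+1,j}\notin L$ and $x_{i,j-1}\notin L$, and each of them satisfies $x_{d_h+1,c_h}\notin L$ or $x_{d_h,c_h-1}\notin L$. All corners are assumed distinct. For $j=1,\ldots,v$ set $L_j=\{x_{b,a}\in L\mid 1\le b\le d_j,\ c_j\le a\le \ell\}$. Ideals. $R=\Bbbk[L]$ is the polynomial ring over $\Bbbk$ in the entries of $L$. For a positive integer $t$ and a subladder $L'\subseteq L$, $I_t(L')$ is the ideal of $R$ generated by the $t$-minors of $X$ all of whose entries lie in $L'$. The mixed ladder determinantal ideal is $I_{\mathbf t}(L)=I_{t_1}(L_1)+\cdots+I_{t_v}(L_v)$; it is prime, and equals $I_t(L)$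 when $t_1=\cdots=t_v=t$. Standing assumptions: (1) every entry of $L$ is involved in some of the generating minors of $I_{\mathbf t}(L)$; (2) no two consecutive corners coincide, and no two upper-outside corners belong to the same row or the same column; (3) $I_{t_i}(L_i)\not\subseteq I_{t_j}(L_j)$ for all $i\ne j$; (4) no proper submatrix of $X$ contains $L$. $I^{(n)}$ denotes the $n$-th symbolic power of $I$, with $I^{(0)}=R$. The ring structure on $\bigoplus_n\mathrm{in}_\prec(I^{(n)})$ is that of the subring $\bigoplus_n\mathrm{in}_\prec(I^{(n)})T^n\subseteq R[T]$. A term order is antidiagonal if the initial term of every minor (contained in $L$) with rows $i_1<\cdots<i_r$ and columns $j_1<\cdots<j_r$ is $x_{i_1,j_r}x_{i_2,j_{r-1}}\cdots x_{i_r,j_1}$. *)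

theory Defs
  imports
    "HOL-Library.Poly_Mapping"
    "HOL-Computational_Algebra.Polynomial"
    "HOL-Algebra.Ring_Divisibility"
    "HOL-Algebra.Ideal_Product"
    "HOL-Algebra.Generated_Rings"
    "Jordan_Normal_Form.Determinant"
begin

section \<open>Polynomials in matrix entries\<close>

text \<open>The indeterminate \<open>x\<^sub>i\<^sub>,\<^sub>j\<close> is the index pair \<open>(i, j)\<close>, with rows and columns counted from 1.\<close>

type_synonym monomial = "(nat \<times> nat) \<Rightarrow>\<^sub>0 nat"
type_synonym 'k mpol = "monomial \<Rightarrow>\<^sub>0 'k"

definition subset_ring :: "'a::comm_ring_1 set \<Rightarrow> 'a ring" where
  "subset_ring A = \<lparr>carrier = A, monoid.mult = (*), one = 1, ring.zero = 0, add = (+)\<rparr>"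

definition monomials :: "(nat \<times> nat) set \<Rightarrow> monomial set" where
  "monomials L = {m. Poly_Mapping.keys m \<subseteq> L}"

definition poly_ring_on :: "(nat \<times> nat) set \<Rightarrow> 'k::comm_ring_1 mpol ring" where
  "poly_ring_on L = subset_ring {f. Poly_Mapping.keys f \<subseteq> monomials L}"

abbreviation mpol_monom :: "monomial \<Rightarrow> 'k::comm_ring_1 mpol" where
  "mpol_monom m \<equiv> Poly_Mapping.single m 1"

definition var :: "nat \<times> nat \<Rightarrow> 'k::comm_ring_1 mpol" where
  "var e = mpol_monom (Poly_Mapping.single e 1)"

definition perfect_field :: "'k::field itself \<Rightarrow> bool" where
  "perfect_field _ \<longleftrightarrow> CHAR('k) = 0 \<or> surj (\<lambda>x::'k. x ^ CHAR('k))"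


section \<open>Ladders\<close>

definition ladder :: "nat \<Rightarrow> nat \<Rightarrow> (nat \<times> nat) set \<Rightarrow> bool" where
  "ladder k l L \<longleftrightarrow> L \<subseteq> {1..k} \<times> {1..l} \<and>
     (\<forall>i j i' j'. (i, j) \<in> L \<and> (i', j') \<in> L \<and> i \<le> i' \<and> j' \<le> j \<longrightarrow>
        {i..i'} \<times> {j'..j} \<subseteq> L)"

text \<open>Corners are listed as pairs (row, column). As \<open>L\<close> contains no entry with index 0,
  truncated subtraction gives the intended meaning of \<open>b - 1\<close> and \<open>c - 1\<close> at the border.\<close>

definition upper_outside_corners ::
    "nat \<Rightarrow> (nat \<times> nat) set \<Rightarrow> (nat \<times> nat) list \<Rightarrow> bool" where
  "upper_outside_corners l L us \<longleftrightarrow> us \<noteq> [] \<and>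
     set us = {(b, a) \<in> L. (b - 1, a) \<notin> L \<and> (b, a + 1) \<notin> L} \<and>
     sorted_wrt (\<lambda>(b, a) (b', a'). b < b' \<and> a < a') us \<and>
     fst (hd us) = 1 \<and> snd (last us) = l"

definition lower_outside_corners ::
    "nat \<Rightarrow> (nat \<times> nat) set \<Rightarrow> (nat \<times> nat) list \<Rightarrow> bool" where
  "lower_outside_corners k L ds \<longleftrightarrow> ds \<noteq> [] \<and> set ds \<subseteq> L \<and>
     {(d, c) \<in> L. (d + 1, c) \<notin> L \<and> (d, c - 1) \<notin> L} \<subseteq> set ds \<and>
     (\<forall>(d, c) \<in> set ds. (d + 1, c) \<notin> L \<or> (d, c - 1) \<notin> L) \<and>
     sorted_wrt (\<lambda>(d, c) (d', c'). d \<le> d' \<and> c \<le> c') ds \<and>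
     fst (last ds) = k \<and> snd (hd ds) = 1"

definition subladder :: "(nat \<times> nat) set \<Rightarrow> nat \<times> nat \<Rightarrow> (nat \<times> nat) set" where
  "subladder L corner = {(b, a) \<in> L. b \<le> fst corner \<and> snd corner \<le> a}"


section \<open>Mixed ladder determinantal ideals\<close>

text \<open>\<open>minor_in L' t rs cs\<close>: the rows \<open>rs\<close> and columns \<open>cs\<close> specify a \<open>t\<close>-minor all of whose
  entries lie in \<open>L'\<close>.\<close>

definition minor_in :: "(nat \<times> nat) set \<Rightarrow> nat \<Rightarrow> nat list \<Rightarrow> nat list \<Rightarrow> bool" where
  "minor_in L' t rs cs \<longleftrightarrow> length rs = t \<and> length cs = t \<and>
     sorted_wrt (<) rs \<and> sorted_wrt (<) cs \<and> set rs \<times> set cs \<subseteq> L'"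

definition minor :: "nat list \<Rightarrow> nat list \<Rightarrow> 'k::comm_ring_1 mpol" where
  "minor rs cs = det (mat (length rs) (length rs) (\<lambda>(a, b). var (rs ! a, cs ! b)))"

definition minor_ideal ::
    "(nat \<times> nat) set \<Rightarrow> nat \<Rightarrow> (nat \<times> nat) set \<Rightarrow> 'k::comm_ring_1 mpol set" where
  "minor_ideal L t L' = Idl\<^bsub>poly_ring_on L\<^esub> {minor rs cs | rs cs. minor_in L' t rs cs}"

text \<open>The sum of the ideals \<open>I\<^bsub>t\<^sub>h\<^esub>(L\<^sub>h)\<close>.\<close>

definition mixed_ideal ::
    "(nat \<times> nat) set \<Rightarrow> (nat \<times> nat) list \<Rightarrow> nat list \<Rightarrow> 'k::comm_ring_1 mpol set" where
  "mixed_ideal L ds ts =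
     {\<Sum>h<length ds. f h | f. \<forall>h<length ds. f h \<in> minor_ideal L (ts ! h) (subladder L (ds ! h))}"


section \<open>Symbolic powers\<close>

definition associated_primes :: "('a, 'm) ring_scheme \<Rightarrow> 'a set \<Rightarrow> 'a set set" where
  "associated_primes R I =
     {P. primeideal P R \<and> (\<exists>x \<in> carrier R. P = {a \<in> carrier R. a \<otimes>\<^bsub>R\<^esub> x \<in> I})}"

text \<open>The intersection of the contractions \<open>I\<^sup>n R\<^sub>P \<inter> R\<close> over the associated primes \<open>P\<close> of
  \<open>R/I\<close>, with the localizations written out. Powers of ideals are taken in the monoid of ideals,
  whose unit is \<open>R\<close>.\<close>

definition symbolic_power :: "('a, 'm) ring_scheme \<Rightarrow> 'a set \<Rightarrow> nat \<Rightarrow> 'a set" where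
  "symbolic_power R I n =
     {f \<in> carrier R. \<forall>P \<in> associated_primes R I.
        \<exists>s \<in> carrier R - P. s \<otimes>\<^bsub>R\<^esub> f \<in> I [^]\<^bsub>ideals_set R\<^esub> n}"


section \<open>Initial ideals\<close>

text \<open>An order on the monomials in \<open>L\<close> is a set of pairs \<open>(m, n)\<close> meaning \<open>m \<preceq> n\<close>.\<close>

definition term_order :: "(nat \<times> nat) set \<Rightarrow> monomial rel \<Rightarrow> bool" where
  "term_order L ord \<longleftrightarrow> linear_order_on (monomials L) ord \<and>
     (\<forall>m \<in> monomials L. (0, m) \<in> ord) \<and>
     (\<forall>m n. \<forall>s \<in> monomials L. (m, n) \<in> ord \<longrightarrow> (m + s, n + s) \<in> ord)"

definition lead_monomial :: "monomial rel \<Rightarrow> 'k::zero mpol \<Rightarrow> monomial" where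
  "lead_monomial ord f =
     (THE m. m \<in> Poly_Mapping.keys f \<and> (\<forall>n \<in> Poly_Mapping.keys f. (n, m) \<in> ord))"

definition initial_ideal ::
    "(nat \<times> nat) set \<Rightarrow> monomial rel \<Rightarrow> 'k::comm_ring_1 mpol set \<Rightarrow> 'k mpol set" where
  "initial_ideal L ord I = Idl\<^bsub>poly_ring_on L\<^esub> {mpol_monom (lead_monomial ord f) | f. f \<in> I \<and> f \<noteq> 0}"

text \<open>Since the leading coefficient of a minor is a unit, only the leading monomial is constrained.\<close>

definition antidiagonal_order ::
    "'k::comm_ring_1 itself \<Rightarrow> (nat \<times> nat) set \<Rightarrow> monomial rel \<Rightarrow> bool" where
  "antidiagonal_order _ L ord \<longleftrightarrow> term_order L ord \<and>
     (\<forall>r rs cs. minor_in L r rs cs \<longrightarrow>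
        lead_monomial ord (minor rs cs :: 'k mpol) =
          (\<Sum>a<r. Poly_Mapping.single (rs ! a, cs ! (r - 1 - a)) 1))"

text \<open>The direct sum of the initial ideals of the symbolic powers, as a subring of \<open>R[T]\<close>.\<close>

definition initial_symbolic_rees ::
    "(nat \<times> nat) set \<Rightarrow> monomial rel \<Rightarrow> 'k::comm_ring_1 mpol set \<Rightarrow> 'k mpol poly ring" where
  "initial_symbolic_rees L ord I = subset_ring
     {F. \<forall>n. Polynomial.coeff F n \<in> initial_ideal L ord (symbolic_power (poly_ring_on L) I n)}"

text \<open>The homogeneous elements \<open>g\<^sub>i T\<^bsup>b\<^sub>i\<^esup>\<close> (\<open>i < m\<close>) generate that subring as an \<open>R\<close>-algebra.
  Degrees are required to be positive: generators of degree 0 are redundant, as \<open>R\<close> is the degree 0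
  part, and one would turn the least common multiple of the degrees into 0.\<close>

definition homogeneous_generators ::
    "(nat \<times> nat) set \<Rightarrow> monomial rel \<Rightarrow> 'k::comm_ring_1 mpol set \<Rightarrow>
      nat \<Rightarrow> (nat \<Rightarrow> 'k mpol) \<Rightarrow> (nat \<Rightarrow> nat) \<Rightarrow> bool" where
  "homogeneous_generators L ord I m g b \<longleftrightarrow>
     (\<forall>i<m. 0 < b i \<and>
        g i \<in> initial_ideal L ord (symbolic_power (poly_ring_on L) I (b i))) \<and>
     generate_ring (initial_symbolic_rees L ord I)
         ({[:r:] | r. r \<in> carrier (poly_ring_on L)} \<union> {Polynomial.monom (g i) (b i) | i. i < m})
       = carrier (initial_symbolic_rees L ord I)"

end

theory Submission
  imports Defs "HOL-Library.Product_Lexorder" "HOL-Combinatorics.Cycles"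
begin

text \<open>
  Order the entries of the ladder by declaring an entry smaller if it lies strictly north-east, so
  that antidiagonals of minors are chains, and call a set of entries a face if it contains no
  antidiagonal of a generating minor.

  The generators form a Groebner basis and generate a prime ideal \<open>I\<close>. This is shown by induction,
  removing a south-west corner \<open>y\<close>: a generator involving \<open>y\<close> is \<open>y q + r\<close>, and all the quotients
  \<open>- r / q\<close> agree modulo the ideal \<open>N\<close> of generators without \<open>y\<close>. Hence substituting \<open>- r / q\<close> for
  \<open>y\<close> has a prime kernel, which contains no nonzero combination of monomials supported on faces,
  because the top coefficient in \<open>y\<close> of such a combination lies in the ideal generated by \<open>N\<close> and
  the minors \<open>q\<close>. So the initial ideal of \<open>I\<close> is the squarefree ideal of nonfaces, and its \<open>n\<close>-th
  symbolic power consists of the monomials of degree at least \<open>n\<close> outside every face.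

  If \<open>m\<close> is the leading monomial of an element of the symbolic power of \<open>I\<close> and \<open>F\<close> is a face, the
  Taylor coefficient at the part of \<open>m\<close> outside \<open>F\<close> has leading monomial supported on \<open>F\<close>; as it
  would lie in \<open>I\<close> if that part had degree less than \<open>n\<close>, one inclusion follows. For the other one,
  duality for the assignment problem (a Greene-Kleitman theorem) partitions a monomial \<open>m\<close> into
  chains whose minors have orders of vanishing along \<open>I\<close> that add up to the least degree of \<open>m\<close>
  outside a face.
\<close>

section \<open>Polynomials, substitutions and ideals\<close>

text \<open>The corner induction leaves the class of the given ideals: deleting a corner replaces
  its size condition by conditions of the same size at two neighbouring entries, and the link adds a
  condition of size one less. It therefore runs over arbitrary sets of conditions
  \<open>(u, t)\<close> whose corners \<open>u\<close> do not lie strictly north-east of each other.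
  Primality and the Groebner property go through it together: division by leading monomials writes
  every polynomial, modulo the ideal, as a combination of face monomials, and since the kernel of
  the substitution contains the ideal but no nonzero such combination, the two coincide. The facts
  about \<open>q\<close> and \<open>r\<close> that this needs, \<open>q\<close> not in
  \<open>N\<close> and \<open>r\<close> not in the link ideal, are seen at zero-one matrices. For
  the converse inclusion, \<open>kappa e\<close> bounds the length of a chain in a face that ends in
  \<open>e\<close>. A chain \<open>c\<close> contributes its excess
  \<open>length c - kappa (last c)\<close>; the weights of the assignment problem are chosen so that
  a permutation collects exactly such excesses, and its dual solution marks the face that is missed
  least.\<close>

abbreviation keys :: "('a \<Rightarrow>\<^sub>0 'b::zero) \<Rightarrow> 'a set" where "keys \<equiv> Poly_Mapping.keys"
abbreviation lookup :: "('a \<Rightarrow>\<^sub>0 'b::zero) \<Rightarrow> 'a \<Rightarrow> 'b" where "lookup \<equiv> Poly_Mapping.lookup"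
abbreviation single :: "'a \<Rightarrow> 'b \<Rightarrow> 'a \<Rightarrow>\<^sub>0 'b::zero" where "single \<equiv> Poly_Mapping.single"

lemma keys_add_nat: "keys (m + n) = keys m \<union> keys n" for m n :: "'v \<Rightarrow>\<^sub>0 nat"
  by (auto simp: in_keys_iff lookup_add)

lemma keys_sum_nat: "finite A \<Longrightarrow> keys (\<Sum>a\<in>A. f a) = (\<Union>a\<in>A. keys (f a))"
  for f :: "'b \<Rightarrow> 'v \<Rightarrow>\<^sub>0 nat"
  by (induction A rule: finite_induct) (auto simp: keys_add_nat)

lemma sum_single_lookup: "(\<Sum>m\<in>keys f. single m (lookup f m)) = f"
  for f :: "'a \<Rightarrow>\<^sub>0 'b::comm_monoid_add"
proof (rule poly_mapping_eqI)
  fix k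
  have "lookup (\<Sum>m\<in>keys f. single m (lookup f m)) k = (\<Sum>m\<in>keys f. if m = k then lookup f m else 0)"
    by (simp add: lookup_sum lookup_single when_def)
  also have "\<dots> = lookup f k" by (simp add: in_keys_iff)
  finally show "lookup (\<Sum>m\<in>keys f. single m (lookup f m)) k = lookup f k" .
qed

lemma mpol_induct [case_names single add]:
  fixes f :: "'k::comm_ring_1 mpol"
  assumes "\<And>m c. P (single m c)" and "\<And>f g. P f \<Longrightarrow> P g \<Longrightarrow> P (f + g)"
  shows "P f"
proof -
  have "P (\<Sum>m\<in>A. single m (lookup f m))" if "finite A" for A
    using that
  proof (induction A rule: finite_induct)
    case empty
    then show ?case using assms(1)[of 0 0] by simp
  qed (simp add: assms)
  then show ?thesis using sum_single_lookup[of f] by (metis finite_keys)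
qed

lemma lookup_mult_single:
  "lookup (single n c * f) (m + n) = c * lookup f m" for f :: "'k::comm_ring_1 mpol"
proof (induction f rule: mpol_induct)
  case (single a d)
  show ?case by (auto simp: mult_single lookup_single when_def add.commute)
qed (simp add: lookup_add distrib_left)

lemma keys_mult_single: "keys (single n c * f) \<subseteq> (\<lambda>m. m + n) ` keys f"
  for f :: "'k::comm_ring_1 mpol"
  using keys_mult[of "single n c" f] by (force simp: add.commute split: if_splits)

definition mono_val :: "('v \<Rightarrow> 'a::comm_monoid_mult) \<Rightarrow> ('v \<Rightarrow>\<^sub>0 nat) \<Rightarrow> 'a" where
  "mono_val s m = (\<Prod>e\<in>keys m. s e ^ lookup m e)"

lemma mono_val_superset: "finite A \<Longrightarrow> keys m \<subseteq> A \<Longrightarrow> mono_val s m = (\<Prod>e\<in>A. s e ^ lookup m e)"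
  unfolding mono_val_def by (rule prod.mono_neutral_left) (auto simp: in_keys_iff)

lemma mono_val_0 [simp]: "mono_val s 0 = 1"
  by (simp add: mono_val_def)

lemma mono_val_add: "mono_val s (m + n) = mono_val s m * mono_val s n"
  using mono_val_superset[of "keys m \<union> keys n" "m + n" s]
    mono_val_superset[of "keys m \<union> keys n" m s] mono_val_superset[of "keys m \<union> keys n" n s]
  by (simp add: keys_add_nat lookup_add power_add prod.distrib)

lemma mono_val_single [simp]: "mono_val s (single e k) = s e ^ k"
  by (simp add: mono_val_def)

text \<open>The general ring homomorphism out of the polynomial ring, given by a map
  \<open>h\<close> on coefficients and the images \<open>s\<close> of the entries. All evaluations,
  expansions and gradings below are instances.\<close>

definition insertion :: "('k::comm_ring_1 \<Rightarrow> 'a::comm_ring_1) \<Rightarrow> (nat \<times> nat \<Rightarrow> 'a) \<Rightarrow> 'k mpol \<Rightarrow> 'a" where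
  "insertion h s f = (\<Sum>m\<in>keys f. h (lookup f m) * mono_val s m)"

context
  fixes h :: "'k::comm_ring_1 \<Rightarrow> 'a::comm_ring_1" and s :: "nat \<times> nat \<Rightarrow> 'a"
  assumes h: "comm_ring_hom h"
begin

interpretation h: comm_ring_hom h by (rule h)

lemma insertion_superset:
  "finite A \<Longrightarrow> keys f \<subseteq> A \<Longrightarrow> insertion h s f = (\<Sum>m\<in>A. h (lookup f m) * mono_val s m)"
  unfolding insertion_def by (rule sum.mono_neutral_left) (auto simp: in_keys_iff)

lemma insertion_single: "insertion h s (single m c) = h c * mono_val s m"
  using insertion_superset[of "{m}" "single m c"] by simp

lemma insertion_add: "insertion h s (f + g) = insertion h s f + insertion h s g"
  using insertion_superset[of "keys f \<union> keys g" "f + g"] insertion_superset[of "keys f \<union> keys g" f]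
    insertion_superset[of "keys f \<union> keys g" g] keys_add[of f g]
  by (simp add: lookup_add h.hom_add distrib_right sum.distrib)

lemma insertion_hom: "comm_ring_hom (insertion h s)"
proof
  show "insertion h s 0 = 0" by (simp add: insertion_def)
  show "insertion h s 1 = 1" using insertion_single[of 0 1] by simp
  show "insertion h s (f + g) = insertion h s f + insertion h s g" for f g by (rule insertion_add)
  show "insertion h s (f * g) = insertion h s f * insertion h s g" for f g
  proof (induction f rule: mpol_induct)
    case (single m c)
    show ?case
    proof (induction g rule: mpol_induct)
      case (single n d)
      show ?case by (simp add: mult_single insertion_single mono_val_add h.hom_mult mult_ac)
    qed (simp add: distrib_left insertion_add)
  qed (simp add: distrib_right insertion_add)
qed

lemma insertion_var: "insertion h s (var e) = s e"
  by (simp add: var_def insertion_single)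

end

lemma mono_val_var: "mono_val var m = (single m 1 :: 'k::comm_ring_1 mpol)"
proof -
  have "mono_val var (\<Sum>e\<in>A. single e (lookup m e)) = (single (\<Sum>e\<in>A. single e (lookup m e)) 1 :: 'k mpol)"
    if "finite A" for A
    using that
  proof (induction A rule: finite_induct)
    case (insert e A)
    have "var e ^ k = (single (single e k) 1 :: 'k mpol)" for k
    proof (induction k)
      case (Suc k)
      then show ?case
        by (simp add: var_def mult_single single_add[symmetric])
    qed simp
    with insert show ?case by (simp add: mono_val_add mult_single)
  qed simp
  then show ?thesis using sum_single_lookup[of m] by (metis finite_keys)
qed

lemma single_hom: "comm_ring_hom (single 0 :: 'a::comm_ring_1 \<Rightarrow> 'b::comm_monoid_add \<Rightarrow>\<^sub>0 'a)"
  by unfold_locales (auto simp: single_add mult_single)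

text \<open>The comparison is restricted to entries that occur in \<open>f\<close>, so that a
  substitution fixing these entries is seen to fix \<open>f\<close>; compare
  \<open>var_poly_free\<close>, \<open>taylor_face\<close> and
  \<open>restrict_vars_id\<close>.\<close>

lemma mpol_hom_eqI:
  fixes f :: "'k::comm_ring_1 mpol"
  assumes F: "comm_ring_hom F" and G: "comm_ring_hom G"
    and C: "\<And>c. F (single 0 c) = G (single 0 c)" and V: "\<And>e. e \<in> \<Union>(keys ` keys f) \<Longrightarrow> F (var e) = G (var e)"
  shows "F f = G f"
proof -
  interpret F: comm_ring_hom F by fact
  interpret G: comm_ring_hom G by fact
  have eq: "single m c = single 0 c * (\<Prod>e\<in>keys m. var e ^ lookup m e)" for m and c :: 'k
    using mono_val_var[of m, where 'k = 'k] by (simp add: mono_val_def mult_single)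
  have "F (single m (lookup f m)) = G (single m (lookup f m))" if "m \<in> keys f" for m
  proof -
    have "(\<Prod>e\<in>keys m. F (var e) ^ lookup m e) = (\<Prod>e\<in>keys m. G (var e) ^ lookup m e)"
      using V[OF UN_I[OF that]] by (intro prod.cong) simp_all
    then show ?thesis
      by (subst (1 2) eq) (simp add: F.hom_mult G.hom_mult F.hom_prod G.hom_prod F.hom_power G.hom_power C)
  qed
  then have "F (\<Sum>m\<in>keys f. single m (lookup f m)) = G (\<Sum>m\<in>keys f. single m (lookup f m))"
    by (simp add: F.hom_sum G.hom_sum)
  then show ?thesis by (simp add: sum_single_lookup)
qed

lemma id_hom: "comm_ring_hom (\<lambda>x::'a::comm_ring_1. x)" by unfold_locales auto

lemma comp_hom:
  assumes "comm_ring_hom f" "comm_ring_hom g"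
  shows "comm_ring_hom (\<lambda>x. f (g x))"
proof -
  interpret f: comm_ring_hom f by fact
  interpret g: comm_ring_hom g by fact
  show ?thesis by unfold_locales (simp_all add: f.hom_add g.hom_add f.hom_mult g.hom_mult)
qed

text \<open>An ideal is a submodule of the ring over itself. As a span it lives in the polynomial
  ring in all index pairs, without a carrier set; the passage to ideals of
  \<open>poly_ring_on L\<close> is made by \<open>IR\<close> and
  \<open>mixed_ideal_eq_IR\<close>.\<close>

definition gen_ideal :: "'a::comm_ring_1 set \<Rightarrow> 'a set" where
  "gen_ideal G = Modules.module.span (*) G"

interpretation ring_mod: Modules.module "(*) :: 'a::comm_ring_1 \<Rightarrow> 'a \<Rightarrow> 'a"
  by unfold_locales (auto simp: algebra_simps)

lemma gen_ideal_base: "g \<in> G \<Longrightarrow> g \<in> gen_ideal G"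
  unfolding gen_ideal_def by (rule ring_mod.span_base)

lemma gen_ideal_0: "0 \<in> gen_ideal G"
  unfolding gen_ideal_def by (rule ring_mod.span_zero)

lemma gen_ideal_add: "x \<in> gen_ideal G \<Longrightarrow> y \<in> gen_ideal G \<Longrightarrow> x + y \<in> gen_ideal G"
  unfolding gen_ideal_def by (rule ring_mod.span_add)

lemma gen_ideal_mult: "x \<in> gen_ideal G \<Longrightarrow> r * x \<in> gen_ideal G"
  unfolding gen_ideal_def by (rule ring_mod.span_scale)

lemma gen_ideal_mult': "x \<in> gen_ideal G \<Longrightarrow> x * r \<in> gen_ideal G"
  using gen_ideal_mult[of x G r] by (simp add: mult.commute)

lemma gen_ideal_minus: "x \<in> gen_ideal G \<Longrightarrow> - x \<in> gen_ideal G"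
  using gen_ideal_mult[of x G "-1"] by simp

lemma gen_ideal_minus_iff [simp]: "- x \<in> gen_ideal G \<longleftrightarrow> x \<in> gen_ideal G"
  using gen_ideal_minus[of x G] gen_ideal_minus[of "-x" G] by auto

lemma gen_ideal_diff: "x \<in> gen_ideal G \<Longrightarrow> y \<in> gen_ideal G \<Longrightarrow> x - y \<in> gen_ideal G"
  using gen_ideal_add[OF _ gen_ideal_minus, of x G y] by simp

lemma gen_ideal_sum: "(\<And>a. a \<in> A \<Longrightarrow> f a \<in> gen_ideal G) \<Longrightarrow> (\<Sum>a\<in>A. f a) \<in> gen_ideal G"
  by (induction A rule: infinite_finite_induct) (auto intro: gen_ideal_0 gen_ideal_add)

lemma gen_ideal_induct [consumes 1, case_names zero step]:
  assumes "x \<in> gen_ideal G" "P 0" "\<And>r g x. g \<in> G \<Longrightarrow> x \<in> gen_ideal G \<Longrightarrow> P x \<Longrightarrow> P (r * g + x)"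
  shows "P x"
proof -
  have "x \<in> gen_ideal G \<and> P x"
    using assms(1)[unfolded gen_ideal_def]
  proof (induction rule: ring_mod.span_induct_alt)
    case base
    then show ?case using assms(2) gen_ideal_0 by blast
  next
    case (step c a y)
    then show ?case using assms(3) by (blast intro: gen_ideal_add gen_ideal_mult gen_ideal_base)
  qed
  then show ?thesis ..
qed

lemma gen_ideal_least: "G \<subseteq> gen_ideal H \<Longrightarrow> gen_ideal G \<subseteq> gen_ideal H"
proof
  fix x assume "G \<subseteq> gen_ideal H" "x \<in> gen_ideal G"
  from this(2,1) show "x \<in> gen_ideal H"
    by (induction rule: gen_ideal_induct) (auto intro: gen_ideal_0 gen_ideal_add gen_ideal_mult)
qed

lemma gen_ideal_mono: "G \<subseteq> H \<Longrightarrow> gen_ideal G \<subseteq> gen_ideal H"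
  by (rule gen_ideal_least) (auto intro: gen_ideal_base)

definition prime_set :: "'a::comm_ring_1 set \<Rightarrow> bool" where
  "prime_set P \<longleftrightarrow> 1 \<notin> P \<and> (\<forall>a b. a * b \<in> P \<longrightarrow> a \<in> P \<or> b \<in> P)"

lemma prime_set_power: "prime_set P \<Longrightarrow> a ^ n \<in> P \<Longrightarrow> a \<in> P"
  by (induction n) (auto simp: prime_set_def)

section \<open>Minors with arbitrary rows and columns\<close>

text \<open>With an arbitrary matrix and arbitrary index lists, transposition, ring homomorphisms
  and bordering by a row or column do not leave the notion. Reordering costs a sign, and repetition
  gives 0.\<close>

definition gminor :: "('i \<Rightarrow> 'j \<Rightarrow> 'a::comm_ring_1) \<Rightarrow> 'i list \<Rightarrow> 'j list \<Rightarrow> 'a" where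
  "gminor X rs cs = det (mat (length rs) (length rs) (\<lambda>(a, b). X (rs ! a) (cs ! b)))"

lemma minor_eq_gminor: "minor rs cs = gminor (\<lambda>i j. var (i, j)) rs cs"
  by (simp add: minor_def gminor_def)

lemma gminor_Nil [simp]: "gminor X [] cs = 1"
  by (simp add: gminor_def)

lemma gminor_transpose:
  assumes "length rs = length cs"
  shows "gminor X rs cs = gminor (\<lambda>j i. X i j) cs rs"
proof -
  let ?n = "length rs"
  let ?M = "mat ?n ?n (\<lambda>(a, b). X (rs ! a) (cs ! b))"
  have "transpose_mat ?M = mat ?n ?n (\<lambda>(a, b). X (rs ! b) (cs ! a))"
    by (rule eq_matI) auto
  moreover have "det (transpose_mat ?M) = det ?M" by (rule det_transpose[of _ ?n]) simp
  ultimately show ?thesis using assms by (simp add: gminor_def)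
qed

lemma gminor_cong:
  assumes "length rs = length cs" "\<And>i j. i \<in> set rs \<Longrightarrow> j \<in> set cs \<Longrightarrow> X i j = Y i j"
  shows "gminor X rs cs = gminor Y rs cs"
  unfolding gminor_def by (rule arg_cong[of _ _ det], rule eq_matI) (use assms in auto)

lemma hom_gminor:
  assumes "comm_ring_hom h"
  shows "h (gminor X rs cs) = gminor (\<lambda>i j. h (X i j)) rs cs"
proof -
  interpret h: comm_ring_hom h by fact
  show ?thesis unfolding gminor_def
    by (subst h.hom_det[symmetric], rule arg_cong[of _ _ det], rule eq_matI) auto
qed

lemma gminor_not_distinct_rows:
  assumes "\<not> distinct rs"
  shows "gminor X rs cs = 0"
proof -
  obtain i j where ij: "i < length rs" "j < length rs" "i \<noteq> j" "rs ! i = rs ! j"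
    using assms by (auto simp: distinct_conv_nth)
  show ?thesis unfolding gminor_def
    by (rule det_identical_rows[OF _ ij(3,1,2)]) (use ij in \<open>auto intro!: eq_vecI\<close>)
qed

lemma gminor_permute_rows:
  assumes "mset rs = mset rs'"
  shows "gminor X rs cs = gminor X rs' cs \<or> gminor X rs cs = - gminor X rs' cs"
proof -
  obtain p where p: "p permutes {..<length rs'}" "permute_list p rs' = rs"
    using mset_eq_permutation[OF assms] by blast
  let ?n = "length rs'"
  let ?M = "mat ?n ?n (\<lambda>(a, b). X (rs' ! a) (cs ! b))"
  have len: "length rs = ?n" using assms by (rule mset_eq_length)
  have p': "p permutes {0..<?n}" using p(1) by (simp add: atLeast0LessThan)
  have "rs ! a = rs' ! (p a)" if "a < ?n" for a
    using permute_list_nth[of p rs' a] p that by simp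
  moreover have "p a < ?n" if "a < ?n" for a using permutes_in_image[OF p(1), of a] that by simp
  ultimately have "mat ?n ?n (\<lambda>(a, b). X (rs ! a) (cs ! b)) = mat ?n ?n (\<lambda>(i, j). ?M $$ (p i, j))"
    by (intro eq_matI) auto
  then have "gminor X rs cs = signof p * gminor X rs' cs"
    using det_permute_rows[of ?M ?n p] p' len by (simp add: gminor_def)
  then show ?thesis by (cases "sign p = 1") (auto simp: sign_def)
qed

lemma gminor_permute:
  assumes "mset rs = mset rs'" "mset cs = mset cs'" "length rs = length cs"
  shows "gminor X rs cs = gminor X rs' cs' \<or> gminor X rs cs = - gminor X rs' cs'"
proof -
  have len: "length rs' = length cs" "length rs' = length cs'"
    using assms(3) mset_eq_length[OF assms(1)] mset_eq_length[OF assms(2)] by simp_all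
  have "gminor X rs' cs = gminor (\<lambda>j i. X i j) cs rs'"
    by (rule gminor_transpose) (rule len)
  moreover have "gminor X rs' cs' = gminor (\<lambda>j i. X i j) cs' rs'"
    by (rule gminor_transpose) (rule len)
  moreover note gminor_permute_rows[OF assms(1), of X cs]
    gminor_permute_rows[OF assms(2), of "\<lambda>j i. X i j" rs']
  ultimately show ?thesis by (elim disjE) simp_all
qed

lemma gminor_not_distinct_cols:
  "\<not> distinct cs \<Longrightarrow> length rs = length cs \<Longrightarrow> gminor X rs cs = 0"
  by (subst gminor_transpose) (simp_all add: gminor_not_distinct_rows)

definition del_nth :: "nat \<Rightarrow> 'b list \<Rightarrow> 'b list" where
  "del_nth j cs = take j cs @ drop (Suc j) cs"

lemma length_del_nth [simp]: "j < length cs \<Longrightarrow> length (del_nth j cs) = length cs - 1"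
  by (simp add: del_nth_def)

lemma nth_del_nth: "j < length cs \<Longrightarrow> b < length cs - 1 \<Longrightarrow>
    del_nth j cs ! b = cs ! (if b < j then b else Suc b)"
  by (auto simp: del_nth_def nth_append)

lemma set_del_nth: "set (del_nth j cs) \<subseteq> set cs"
  by (auto simp: del_nth_def dest: in_set_takeD in_set_dropD)

lemma del_nth_last [simp]: "del_nth (length cs) (cs @ [c]) = cs"
  by (simp add: del_nth_def)

lemma gminor_expand_last_row:
  assumes "length cs = Suc (length rs)"
  shows "gminor X (rs @ [i]) cs =
    (\<Sum>j<length cs. X i (cs ! j) * ((-1) ^ (length rs + j) * gminor X rs (del_nth j cs)))"
proof -
  let ?n = "length rs"
  let ?M = "mat (Suc ?n) (Suc ?n) (\<lambda>(a, b). X ((rs @ [i]) ! a) (cs ! b))"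
  have "det ?M = (\<Sum>j<Suc ?n. ?M $$ (?n, j) * cofactor ?M ?n j)"
    by (rule laplace_expansion_row) auto
  also have "\<dots> = (\<Sum>j<length cs. X i (cs ! j) * ((-1) ^ (length rs + j) * gminor X rs (del_nth j cs)))"
  proof (rule sum.cong)
    fix j assume j: "j \<in> {..<length cs}"
    have "mat_delete ?M ?n j = mat ?n ?n (\<lambda>(a, b). X (rs ! a) (del_nth j cs ! b))"
      by (rule eq_matI) (use j assms in \<open>auto simp: mat_delete_def nth_append nth_del_nth\<close>)
    then show "?M $$ (?n, j) * cofactor ?M ?n j
        = X i (cs ! j) * ((-1) ^ (length rs + j) * gminor X rs (del_nth j cs))"
      using j assms by (simp add: cofactor_def gminor_def)
  qed (use assms in auto)
  finally show ?thesis by (simp add: gminor_def)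
qed

lemma gminor_expand_last_col:
  assumes "length rs = Suc (length cs)"
  shows "gminor X rs (cs @ [c]) =
    (\<Sum>i<length rs. X (rs ! i) c * ((-1) ^ (length cs + i) * gminor X (del_nth i rs) cs))"
proof -
  have "gminor X rs (cs @ [c]) = gminor (\<lambda>j i. X i j) (cs @ [c]) rs"
    using assms by (intro gminor_transpose) simp
  also have "\<dots> = (\<Sum>i<length rs. X (rs ! i) c *
      ((-1) ^ (length cs + i) * gminor (\<lambda>j i. X i j) cs (del_nth i rs)))"
    using assms by (rule gminor_expand_last_row)
  also have "\<dots> = (\<Sum>i<length rs. X (rs ! i) c * ((-1) ^ (length cs + i) * gminor X (del_nth i rs) cs))"
    by (intro sum.cong arg_cong2[of _ _ _ _ "(*)"] refl gminor_transpose[symmetric]) (use assms in auto)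
  finally show ?thesis .
qed

text \<open>Laplace expansion along the rows \<open>rs'\<close>, one at a time from the last, ends
  in minors of the rows \<open>rs\<close> alone.\<close>

lemma gminor_append_rows_in_ideal:
  assumes "\<And>cs. length cs = length rs \<Longrightarrow> set cs \<subseteq> Q \<Longrightarrow> gminor X rs cs \<in> gen_ideal G"
    and "length cs = length (rs @ rs')" "set cs \<subseteq> Q"
  shows "gminor X (rs @ rs') cs \<in> gen_ideal G"
  using assms(2,3)
proof (induction rs' arbitrary: cs rule: rev_induct)
  case Nil
  then show ?case using assms(1) by simp
next
  case (snoc i rs')
  have "gminor X (rs @ rs') (del_nth j cs) \<in> gen_ideal G" if "j < length cs" for j
    using snoc.prems that set_del_nth[of j cs] by (intro snoc.IH) auto
  moreover have "gminor X ((rs @ rs') @ [i]) cs = (\<Sum>j<length cs. X i (cs ! j) *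
      ((-1) ^ (length (rs @ rs') + j) * gminor X (rs @ rs') (del_nth j cs)))"
    by (rule gminor_expand_last_row) (use snoc.prems in simp)
  ultimately show ?case
    by (auto intro!: gen_ideal_sum gen_ideal_mult simp del: append_assoc simp: append_assoc[symmetric])
qed

lemma gminor_append_cols_in_ideal:
  assumes "\<And>rs. length rs = length cs \<Longrightarrow> set rs \<subseteq> P \<Longrightarrow> gminor X rs cs \<in> gen_ideal G"
    and "length rs = length (cs @ cs')" "set rs \<subseteq> P"
  shows "gminor X rs (cs @ cs') \<in> gen_ideal G"
proof -
  have "gminor (\<lambda>j i. X i j) (cs @ cs') rs \<in> gen_ideal G"
  proof (rule gminor_append_rows_in_ideal[where Q = P])
    fix rs assume rs: "length rs = length cs" "set rs \<subseteq> P"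
    then have "gminor X rs cs = gminor (\<lambda>j i. X i j) cs rs" by (intro gminor_transpose)
    then show "gminor (\<lambda>j i. X i j) cs rs \<in> gen_ideal G" using assms(1)[OF rs] by simp
  qed (use assms in auto)
  moreover have "gminor X rs (cs @ cs') = gminor (\<lambda>j i. X i j) (cs @ cs') rs"
    by (rule gminor_transpose) (rule assms(2))
  ultimately show ?thesis by simp
qed

text \<open>Expand \<open>gminor X (A @ [d]) (B @ [c])\<close> along column \<open>c\<close> and
  multiply by \<open>gminor X A' B'\<close>. Each product \<open>gminor X A' B' * X i c\<close> is a
  minor bordering \<open>A'\<close>, \<open>B'\<close> by \<open>i\<close> and \<open>c\<close>,
  minus terms in the columns \<open>B'\<close>. For \<open>i\<close> in \<open>A\<close> the
  bordered minor is in the ideal by the first assumption, and the remaining terms add up to minors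
  covered by the second one.\<close>

lemma gminor_bordered_exchange:
  assumes len: "length B = length A" "length B' = length A'"
    and H1: "\<And>i. i \<in> set A \<Longrightarrow> gminor X (A' @ [i]) (B' @ [c]) \<in> gen_ideal G"
    and H2: "\<And>j. j \<in> set B' \<Longrightarrow> gminor X (A @ [d]) (B @ [j]) \<in> gen_ideal G"
  shows "gminor X A' B' * gminor X (A @ [d]) (B @ [c]) - gminor X A B * gminor X (A' @ [d]) (B' @ [c])
    \<in> gen_ideal G"
proof -
  define cof where "cof a = (-1) ^ (length B + a) * gminor X (del_nth a (A @ [d])) B" for a
  define kap where "kap j = (-1) ^ (length A' + j) * gminor X A' (del_nth j (B' @ [c]))" for j
  define bd where "bd i = gminor X (A' @ [i]) (B' @ [c])" for i
  define R where "R = A @ [d]"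
  obtain n n' where n: "length A = n" "length B = n" "length A' = n'" "length B' = n'"
    using len by blast
  have g: "gminor X (A @ [d]) (B @ [c']) = (\<Sum>a<Suc n. X (R ! a) c' * cof a)" for c'
    using gminor_expand_last_col[of "A @ [d]" B X c'] n
    by (simp add: cof_def R_def del: sum.lessThan_Suc)
  have cofn: "cof n = gminor X A B"
    using del_nth_last[of A d] n by (simp add: cof_def power_add[symmetric] mult_2[symmetric])
  have kapn: "kap n' = gminor X A' B'"
    using del_nth_last[of B' c] n by (simp add: kap_def power_add[symmetric] mult_2[symmetric])
  have "bd i = (\<Sum>j<Suc n'. X i ((B' @ [c]) ! j) * kap j)" for i
    using gminor_expand_last_row[of "B' @ [c]" A' X i] n
    by (simp add: kap_def bd_def del: sum.lessThan_Suc)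
  then have "bd i = (\<Sum>j<n'. X i (B' ! j) * kap j) + X i c * gminor X A' B'" for i
    using n by (simp add: kapn nth_append)
  then have q: "gminor X A' B' * X i c = bd i - (\<Sum>j<n'. X i (B' ! j) * kap j)" for i
    by (simp add: mult.commute)
  have "gminor X A' B' * gminor X (A @ [d]) (B @ [c])
      = (\<Sum>a<Suc n. (gminor X A' B' * X (R ! a) c) * cof a)"
    unfolding g sum_distrib_left by (simp only: mult.assoc)
  also have "\<dots> = (\<Sum>a<Suc n. bd (R ! a) * cof a) - (\<Sum>a<Suc n. \<Sum>j<n'. X (R ! a) (B' ! j) * kap j * cof a)"
    unfolding q left_diff_distrib sum_subtractf sum_distrib_right ..
  \<comment> \<open>Exchanging the sums reassembles, for each \<open>j\<close>, the expansion of the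
    minor whose last column \<open>c\<close> is replaced by \<open>B' ! j\<close>.\<close>
  also have "(\<Sum>a<Suc n. \<Sum>j<n'. X (R ! a) (B' ! j) * kap j * cof a)
      = (\<Sum>j<n'. \<Sum>a<Suc n. X (R ! a) (B' ! j) * kap j * cof a)"
    by (rule sum.swap)
  also have "\<dots> = (\<Sum>j<n'. kap j * gminor X (A @ [d]) (B @ [B' ! j]))"
    unfolding g sum_distrib_left by (intro sum.cong refl) (simp only: mult_ac)
  \<comment> \<open>The summand of the added row \<open>d\<close> has cofactor
    \<open>gminor X A B\<close> and is the term to be subtracted.\<close>
  also have "(\<Sum>a<Suc n. bd (R ! a) * cof a)
      = (\<Sum>a<n. bd (A ! a) * cof a) + gminor X A B * gminor X (A' @ [d]) (B' @ [c])"
    using n by (simp add: R_def nth_append cofn) (simp add: bd_def mult.commute)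
  finally have "gminor X A' B' * gminor X (A @ [d]) (B @ [c]) - gminor X A B * gminor X (A' @ [d]) (B' @ [c])
      = (\<Sum>a<n. bd (A ! a) * cof a) - (\<Sum>j<n'. kap j * gminor X (A @ [d]) (B @ [B' ! j]))"
    by simp
  also have "\<dots> \<in> gen_ideal G"
  proof (intro gen_ideal_diff gen_ideal_sum)
    show "bd (A ! a) * cof a \<in> gen_ideal G" if "a \<in> {..<n}" for a
      unfolding bd_def by (rule gen_ideal_mult', rule H1) (use that n in auto)
    show "kap j * gminor X (A @ [d]) (B @ [B' ! j]) \<in> gen_ideal G" if "j \<in> {..<n'}" for j
      by (rule gen_ideal_mult, rule H2) (use that n in auto)
  qed
  finally show ?thesis .
qed

section \<open>Chains, faces and ideals of minors\<close>

definition ne :: "nat \<times> nat \<Rightarrow> nat \<times> nat \<Rightarrow> bool" where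
  "ne e e' \<longleftrightarrow> fst e < fst e' \<and> snd e' < snd e"

text \<open>A chain is the antidiagonal of the minor with rows \<open>map fst c\<close> and columns
  \<open>map snd c\<close>, read from the top right entry downwards.\<close>

abbreviation chain :: "(nat \<times> nat) list \<Rightarrow> bool" where
  "chain \<equiv> sorted_wrt ne"

lemma ne_trans: "ne a b \<Longrightarrow> ne b c \<Longrightarrow> ne a c"
  by (auto simp: ne_def)

lemma chain_rows: "chain c \<Longrightarrow> sorted_wrt (<) (map fst c)"
  by (induction c) (auto simp: ne_def)

lemma chain_cols: "chain c \<Longrightarrow> sorted_wrt (>) (map snd c)"
  by (induction c) (auto simp: ne_def)

lemma sorted_wrt_gr_distinct: "sorted_wrt (>) xs \<Longrightarrow> distinct xs" for xs :: "nat list"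
  by (induction xs) auto

lemma chain_distinct: "chain c \<Longrightarrow> distinct (map fst c) \<and> distinct (map snd c) \<and> distinct c"
  using chain_rows[of c] chain_cols[of c] sorted_wrt_gr_distinct[of "map snd c"]
    strict_sorted_iff[of "map fst c"] distinct_map[of fst c] by auto

lemma chain_nth: "chain c \<longleftrightarrow> (\<forall>i j. i < j \<longrightarrow> j < length c \<longrightarrow> ne (c ! i) (c ! j))"
  by (simp add: sorted_wrt_iff_nth_less)

lemma chain_zip:
  "sorted_wrt (<) rs \<Longrightarrow> sorted_wrt (>) cs \<Longrightarrow> length rs = length cs \<Longrightarrow> chain (zip rs cs)"
  unfolding chain_nth by (auto simp: ne_def dest: sorted_wrt_nth_less)

definition ladder_convex :: "(nat \<times> nat) set \<Rightarrow> bool" where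
  "ladder_convex L \<longleftrightarrow> (\<forall>i j i' j'. (i, j) \<in> L \<and> (i', j') \<in> L \<and> i \<le> i' \<and> j' \<le> j \<longrightarrow>
        {i..i'} \<times> {j'..j} \<subseteq> L)"

lemma ladder_convexD:
  assumes "ladder_convex L" "(i, j) \<in> L" "(i', j') \<in> L" "i \<le> a" "a \<le> i'" "j' \<le> b" "b \<le> j"
  shows "(a, b) \<in> L"
proof -
  have "i \<le> i'" "j' \<le> j" using assms by simp_all
  then have "{i..i'} \<times> {j'..j} \<subseteq> L" using assms(1-3) unfolding ladder_convex_def by blast
  then show ?thesis using assms by auto
qed

lemma mem_subladder: "e \<in> subladder L u \<longleftrightarrow> e \<in> L \<and> fst e \<le> fst u \<and> snd u \<le> snd e"
  by (cases e) (auto simp: subladder_def)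

lemma subladder_subset: "subladder L u \<subseteq> L"
  by (auto simp: subladder_def)

text \<open>Hence the entries of a chain in \<open>L\<close> that lie in a given subladder form an
  initial segment of the chain.\<close>

lemma subladder_ne_closed:
  "e \<in> L \<Longrightarrow> e' \<in> subladder L u \<Longrightarrow> fst e \<le> fst e' \<Longrightarrow> snd e' \<le> snd e \<Longrightarrow> e \<in> subladder L u"
  by (auto simp: subladder_def)

text \<open>The row of one entry of the chain and the column of another meet in a corner of the
  rectangle spanned by the two entries, so convexity applies; the bounds given by \<open>u\<close>
  are inherited.\<close>

lemma chain_block:
  assumes "ladder_convex L" "chain c" "set c \<subseteq> subladder L u"
  shows "set (map fst c) \<times> set (map snd c) \<subseteq> subladder L u"
proof clarify
  fix i j' assume "i \<in> set (map fst c)" "j' \<in> set (map snd c)"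
  then obtain a b where ab: "a < length c" "b < length c" "i = fst (c ! a)" "j' = snd (c ! b)"
    by (auto simp: in_set_conv_nth)
  have mem: "(fst (c ! a), snd (c ! a)) \<in> subladder L u" "(fst (c ! b), snd (c ! b)) \<in> subladder L u"
    using ab assms(3) nth_mem[of a c] nth_mem[of b c] by (auto simp del: nth_mem)
  consider "a = b" | "a < b" | "b < a" by linarith
  then show "(i, j') \<in> subladder L u"
  proof cases
    case 1
    then show ?thesis using mem ab by simp
  next
    case 2
    then have "ne (c ! a) (c ! b)" using assms(2) ab by (simp add: chain_nth)
    then show ?thesis using mem ladder_convexD[OF assms(1), of i "snd (c ! a)" "fst (c ! b)" j' i j'] ab
      by (auto simp: mem_subladder ne_def simp del: nth_mem)
  next
    case 3
    then have "ne (c ! b) (c ! a)" using assms(2) ab by (simp add: chain_nth)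
    then show ?thesis using mem ladder_convexD[OF assms(1), of "fst (c ! b)" j' i "snd (c ! a)" i j'] ab
      by (auto simp: mem_subladder ne_def simp del: nth_mem)
  qed
qed

text \<open>The class of data that is stable under removing corners: one corner may carry several
  sizes, and corners may share rows or columns. Excluding row 0 makes \<open>d - 1\<close> a true
  predecessor.\<close>

definition good_conditions :: "(nat \<times> nat) set \<Rightarrow> ((nat \<times> nat) \<times> nat) set \<Rightarrow> bool" where
  "good_conditions L U \<longleftrightarrow> finite L \<and> 0 \<notin> fst ` L \<and> ladder_convex L \<and> (\<forall>(u, t)\<in>U. u \<in> L \<and> 0 < t) \<and>
     (\<forall>(u, t)\<in>U. \<forall>(u', t')\<in>U. \<not> ne u u')"

text \<open>Index lists may be unordered or have repetitions. This adds only 0 and negatives of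
  minors, and frees the exchange arguments from sorting.\<close>

definition minor_gens :: "(nat \<times> nat) set \<Rightarrow> ((nat \<times> nat) \<times> nat) set \<Rightarrow> 'k::comm_ring_1 mpol set" where
  "minor_gens L U = {minor rs cs | rs cs u. (u, length rs) \<in> U \<and> length cs = length rs \<and>
     set rs \<times> set cs \<subseteq> subladder L u}"

abbreviation block_ideal :: "(nat \<times> nat) set \<Rightarrow> ((nat \<times> nat) \<times> nat) set \<Rightarrow> 'k::comm_ring_1 mpol set" where
  "block_ideal L U \<equiv> gen_ideal (minor_gens L U)"

definition face :: "(nat \<times> nat) set \<Rightarrow> ((nat \<times> nat) \<times> nat) set \<Rightarrow> (nat \<times> nat) set \<Rightarrow> bool" where
  "face L U F \<longleftrightarrow> (\<forall>(u, t)\<in>U. \<forall>c. chain c \<and> set c \<subseteq> F \<inter> subladder L u \<longrightarrow> length c \<noteq> t)"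

text \<open>The first \<open>t\<close> entries of a longer chain would already be forbidden.\<close>

lemma faceD: "face L U F \<Longrightarrow> (u, t) \<in> U \<Longrightarrow> chain c \<Longrightarrow> set c \<subseteq> F \<Longrightarrow> set c \<subseteq> subladder L u \<Longrightarrow> length c < t"
proof (rule ccontr)
  assume *: "face L U F" "(u, t) \<in> U" "chain c" "set c \<subseteq> F" "set c \<subseteq> subladder L u" "\<not> length c < t"
  then have "chain (take t c)" "set (take t c) \<subseteq> F \<inter> subladder L u" "length (take t c) = t"
    using set_take_subset[of t c] by (auto simp: sorted_wrt_take)
  then show False using *(1,2) unfolding face_def by blast
qed

lemma faceI: "(\<And>u t c. (u, t) \<in> U \<Longrightarrow> chain c \<Longrightarrow> set c \<subseteq> F \<Longrightarrow> set c \<subseteq> subladder L u \<Longrightarrow> length c = t \<Longrightarrow> False)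
    \<Longrightarrow> face L U F"
  unfolding face_def by auto

lemma not_faceE:
  assumes "\<not> face L U F"
  obtains u c where "(u, length c) \<in> U" "chain c" "set c \<subseteq> F" "set c \<subseteq> subladder L u"
  using assms unfolding face_def by auto

lemma face_mono: "face L U F \<Longrightarrow> F' \<subseteq> F \<Longrightarrow> face L U F'"
  unfolding face_def by blast

lemma minor_in_block_ideal:
  "(u, t) \<in> U \<Longrightarrow> length rs = t \<Longrightarrow> length cs = t \<Longrightarrow> set rs \<times> set cs \<subseteq> subladder L u \<Longrightarrow> minor rs cs \<in> block_ideal L U"
  unfolding minor_gens_def by (rule gen_ideal_base) blast

text \<open>Laplace expansion along the rows beyond the first \<open>t\<close>.\<close>

lemma larger_minor_in_block_ideal:
  assumes "(u, t) \<in> U" "t \<le> length rs" "length cs = length rs" "set rs \<times> set cs \<subseteq> subladder L u"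
  shows "minor rs cs \<in> block_ideal L U"
proof -
  have "gminor (\<lambda>i j. var (i, j)) (take t rs @ drop t rs) cs \<in> block_ideal L U"
  proof (rule gminor_append_rows_in_ideal[where Q = "set cs"])
    fix cs' assume cs': "length cs' = length (take t rs)" "set cs' \<subseteq> set cs"
    have "set (take t rs) \<times> set cs' \<subseteq> subladder L u"
      using assms(4) cs' set_take_subset[of t rs] by blast
    then show "gminor (\<lambda>i j. var (i, j)) (take t rs) cs' \<in> block_ideal L U"
      using minor_in_block_ideal[OF assms(1), of "take t rs" cs' L] cs' assms(2)
      by (simp add: minor_eq_gminor)
  qed (use assms in auto)
  then show ?thesis by (simp add: minor_eq_gminor)
qed

section \<open>Evaluation at zero-one matrices\<close>

definition ev :: "(nat \<times> nat) set \<Rightarrow> 'k::comm_ring_1 mpol \<Rightarrow> 'k" where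
  "ev W = insertion (\<lambda>x. x) (\<lambda>e. if e \<in> W then 1 else 0)"

lemma ev_hom: "comm_ring_hom (ev W)"
  unfolding ev_def by (rule insertion_hom[OF id_hom])

lemma ev_var: "ev W (var e) = (if e \<in> W then 1 else 0)"
  unfolding ev_def by (rule insertion_var[OF id_hom])

lemma ev_minor: "ev W (minor rs cs) = gminor (\<lambda>i j. if (i, j) \<in> W then 1 else 0) rs cs"
  by (simp add: minor_eq_gminor hom_gminor[OF ev_hom] ev_var)

text \<open>With fewer ones in the block than rows, some row is zero: otherwise choosing a one in
  each row would inject the rows into the set of ones.\<close>

lemma ev_minor_eq_0:
  assumes fin: "finite (W \<inter> B)" and sub: "set rs \<times> set cs \<subseteq> B" and len: "length rs = length cs"
    and card: "card (W \<inter> B) < length rs"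
  shows "ev W (minor rs cs) = 0"
proof (cases "distinct rs")
  case False
  then show ?thesis by (simp add: ev_minor gminor_not_distinct_rows)
next
  case True
  have "\<exists>i\<in>set rs. \<forall>j\<in>set cs. (i, j) \<notin> W"
  proof (rule ccontr)
    assume "\<not> ?thesis"
    then obtain f where f: "\<And>i. i \<in> set rs \<Longrightarrow> f i \<in> set cs \<and> (i, f i) \<in> W" by metis
    then have "(\<lambda>i. (i, f i)) ` set rs \<subseteq> W \<inter> B" using sub by blast
    then have "card ((\<lambda>i. (i, f i)) ` set rs) \<le> card (W \<inter> B)" by (rule card_mono[OF fin])
    also have "card ((\<lambda>i. (i, f i)) ` set rs) = length rs"
      using distinct_card[OF True] by (subst card_image) (auto simp: inj_on_def)
    finally show False using card by simp
  qed
  then obtain a where a: "a < length rs" "\<And>j. j \<in> set cs \<Longrightarrow> (rs ! a, j) \<notin> W"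
    by (metis in_set_conv_nth)
  let ?n = "length rs"
  let ?M = "mat ?n ?n (\<lambda>(x, y). if (rs ! x, cs ! y) \<in> W then 1 else 0) :: 'a mat"
  have "det ?M = (\<Sum>j<?n. ?M $$ (a, j) * cofactor ?M a j)"
    by (rule laplace_expansion_row) (use a in auto)
  also have "\<dots> = 0" by (rule sum.neutral) (use a len in auto)
  finally show ?thesis by (simp add: ev_minor gminor_def)
qed

text \<open>Rows and columns are listed along \<open>c\<close>, so the evaluated matrix is the
  identity and not merely a permutation matrix, which fixes the sign.\<close>

lemma ev_minor_eq_1:
  assumes "distinct (map fst c)" "distinct (map snd c)"
  shows "ev (set c) (minor (map fst c) (map snd c)) = 1"
proof -
  let ?n = "length c"
  have "(fst (c ! a), snd (c ! b)) \<in> set c \<longleftrightarrow> a = b" if ab: "a < ?n" "b < ?n" for a b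
  proof
    assume "(fst (c ! a), snd (c ! b)) \<in> set c"
    then obtain i where i: "i < ?n" "c ! i = (fst (c ! a), snd (c ! b))" by (auto simp: in_set_conv_nth)
    then have "map fst c ! i = map fst c ! a" "map snd c ! i = map snd c ! b" using ab by simp_all
    then have "i = a" "i = b"
      using nth_eq_iff_index_eq[OF assms(1), of i a] nth_eq_iff_index_eq[OF assms(2), of i b] i(1) ab
      by (simp_all del: nth_map)
    then show "a = b" by simp
  qed (use ab in simp)
  then have "mat ?n ?n (\<lambda>(a, b). if (map fst c ! a, map snd c ! b) \<in> set c then 1 else 0) = (1\<^sub>m ?n :: 'a mat)"
    by (intro eq_matI) auto
  then have "det (mat ?n ?n (\<lambda>(a, b). if (map fst c ! a, map snd c ! b) \<in> set c then 1 else 0)) = (1 :: 'a)"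
    by (simp only: det_one)
  then show ?thesis by (simp add: ev_minor gminor_def)
qed

text \<open>Reads a polynomial as one in the single entry \<open>y\<close>, with coefficients in the
  other entries.\<close>

definition var_poly :: "nat \<times> nat \<Rightarrow> 'k::comm_ring_1 mpol \<Rightarrow> 'k mpol poly" where
  "var_poly y = insertion (\<lambda>c. [:single 0 c:]) (\<lambda>e. if e = y then [:0, 1:] else [:var e:])"

lemma const_poly_hom: "comm_ring_hom (\<lambda>x::'a::comm_ring_1. [:x:])"
  by unfold_locales (auto simp: one_pCons)

lemma const_single_hom: "comm_ring_hom (\<lambda>c::'k::comm_ring_1. [:single 0 c :: 'k mpol:])"
  by (rule comp_hom[OF const_poly_hom single_hom])

lemma var_poly_hom: "comm_ring_hom (var_poly y)"
  unfolding var_poly_def by (rule insertion_hom[OF const_single_hom])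

lemma var_poly_var: "var_poly y (var e) = (if e = y then [:0, 1:] else [:var e:])"
  unfolding var_poly_def by (rule insertion_var[OF const_single_hom])

lemma var_poly_const: "var_poly y (single 0 c) = [:single 0 c:]"
  unfolding var_poly_def by (simp add: insertion_single[OF const_single_hom])

lemma var_poly_free:
  assumes "\<And>m. m \<in> keys f \<Longrightarrow> y \<notin> keys m"
  shows "var_poly y f = [:f:]"
  by (rule mpol_hom_eqI[OF var_poly_hom const_poly_hom])
    (use assms in \<open>auto simp: var_poly_const var_poly_var\<close>)

lemma var_poly_minor:
  assumes "y \<notin> set rs \<times> set cs" "length rs = length cs"
  shows "var_poly y (minor rs cs) = [:minor rs cs:]"
  unfolding minor_eq_gminor hom_gminor[OF var_poly_hom] hom_gminor[OF const_poly_hom]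
  by (rule gminor_cong) (use assms in \<open>auto simp: var_poly_var\<close>)

lemma lookup_coeff_var_poly:
  "lookup (coeff (var_poly y f) k) m = (if y \<in> keys m then 0 else lookup f (m + single y k))"
proof (induction f rule: mpol_induct)
  case (single n c)
  define n' where "n' = (\<Sum>e\<in>keys n - {y}. single e (lookup n e))"
  have free: "y \<notin> keys n'" by (auto simp: n'_def keys_sum_nat)
  have "n = (\<Sum>e\<in>insert y (keys n). single e (lookup n e))"
    using sum_single_lookup[of n] by (cases "y \<in> keys n") (auto simp: insert_absorb in_keys_iff)
  also have "\<dots> = n' + single y (lookup n y)"
    by (simp add: n'_def sum.insert_remove add.commute)
  finally have n: "n = n' + single y (lookup n y)" .
  interpret comm_ring_hom "var_poly y :: 'a mpol \<Rightarrow> _" by (rule var_poly_hom)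
  have pow: "single (single y j) (1::'a) = var y ^ j" for j
    using mono_val_var[of "single y j", where 'k = 'a] by simp
  have "single n c = single n' c * var y ^ lookup n y"
    using n pow[of "lookup n y"] by (metis mult.right_neutral mult_single)
  moreover have "var_poly y (single n' c) = [:single n' c:]"
    by (rule var_poly_free) (use free in \<open>auto split: if_splits\<close>)
  ultimately have "var_poly y (single n c) = [:single n' c:] * [:0, 1:] ^ lookup n y"
    by (simp add: hom_mult hom_power var_poly_var)
  also have "\<dots> = monom (single n' c) (lookup n y)"
    by (simp add: monom_altdef)
  finally have *: "coeff (var_poly y (single n c)) k = (if k = lookup n y then single n' c else 0)"
    by auto
  have "n = m + single y k \<longleftrightarrow> n' = m \<and> k = lookup n y" if "y \<notin> keys m"
  proof
    assume a: "n = m + single y k"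
    have "lookup n y = k" using that by (simp add: a lookup_add in_keys_iff)
    then show "n' = m \<and> k = lookup n y" using a n by (metis add_right_cancel)
  qed (use n in auto)
  then show ?case using free by (auto simp: * lookup_single when_def)
next
  case (add f g)
  interpret comm_ring_hom "var_poly y :: 'a mpol \<Rightarrow> _" by (rule var_poly_hom)
  show ?case using add by (simp add: hom_add lookup_add)
qed

lemma keys_coeff_var_poly: "m \<in> keys (coeff (var_poly y f) k) \<Longrightarrow> y \<notin> keys m \<and> m + single y k \<in> keys f"
  by (auto simp: in_keys_iff[of m] in_keys_iff[of "m + single y k"] lookup_coeff_var_poly split: if_splits)

lemma poly_var_poly: "poly (var_poly y f) (var y) = f"
proof (rule mpol_hom_eqI[OF comp_hom[OF _ var_poly_hom] id_hom])
  show "comm_ring_hom (\<lambda>p. poly p (var y))" by unfold_locales auto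
qed (auto simp: var_poly_const var_poly_var)

text \<open>The generators are constants with respect to \<open>y\<close>, so they can be pulled out
  of every coefficient.\<close>

lemma coeff_var_poly_in_ideal:
  assumes "\<And>g. g \<in> G \<Longrightarrow> var_poly y g = [:g:]" "f \<in> gen_ideal G"
  shows "coeff (var_poly y f) k \<in> gen_ideal G"
proof -
  interpret comm_ring_hom "var_poly y :: 'a mpol \<Rightarrow> _" by (rule var_poly_hom)
  show ?thesis using assms(2)
  proof (induction rule: gen_ideal_induct)
    case (step r g x)
    have "coeff (var_poly y (r * g + x)) k = coeff (var_poly y r) k * g + coeff (var_poly y x) k"
      using step.hyps(1) by (simp add: hom_add hom_mult assms(1) mult.commute)
    then show ?case using step gen_ideal_base[of g G] by (auto intro: gen_ideal_add gen_ideal_mult)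
  qed (simp add: gen_ideal_0)
qed

text \<open>\<open>q\<^sup>M P(r / q)\<close>, without denominators.\<close>

definition homogenized :: "'a::comm_ring_1 \<Rightarrow> 'a \<Rightarrow> nat \<Rightarrow> 'a poly \<Rightarrow> 'a" where
  "homogenized q r M P = (\<Sum>k\<le>M. coeff P k * r ^ k * q ^ (M - k))"

lemma homogenized_add: "homogenized q r M (P + Q) = homogenized q r M P + homogenized q r M Q"
  by (simp add: homogenized_def distrib_right sum.distrib)

lemma homogenized_smult: "homogenized q r M (smult a P) = a * homogenized q r M P"
  unfolding homogenized_def sum_distrib_left coeff_smult by (simp only: mult.assoc)

lemma homogenized_pCons:
  "homogenized q r (Suc M) (pCons a P) = a * q ^ Suc M + r * homogenized q r M P"
proof -
  have "homogenized q r (Suc M) (pCons a P)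
      = a * q ^ Suc M + (\<Sum>k\<le>M. coeff P k * r ^ Suc k * q ^ (M - k))"
    unfolding homogenized_def sum.atMost_Suc_shift
    by (simp only: coeff_pCons_0 coeff_pCons_Suc diff_Suc_Suc power_0 mult_1_right diff_zero)
  also have "(\<Sum>k\<le>M. coeff P k * r ^ Suc k * q ^ (M - k)) = r * homogenized q r M P"
    unfolding homogenized_def sum_distrib_left by (intro sum.cong refl) (simp only: power_Suc mult_ac)
  finally show ?thesis .
qed

lemma homogenized_0 [simp]: "homogenized q r M 0 = 0"
  by (simp add: homogenized_def)

lemma homogenized_const: "homogenized q r M [:a:] = a * q ^ M"
proof (cases M)
  case 0
  show ?thesis unfolding 0 homogenized_def
    by (simp only: atMost_0 sum.insert finite.emptyI empty_iff not_False_eq_True sum.empty add_0_right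
        coeff_pCons_0 power_0 diff_self_eq_0 mult_1_right)
next
  case (Suc N)
  show ?thesis unfolding Suc homogenized_pCons homogenized_0 by (simp only: mult_zero_right add_0_right)
qed

lemma homogenized_raise: "degree P \<le> M \<Longrightarrow> homogenized q r (M + j) P = q ^ j * homogenized q r M P"
proof (induction P arbitrary: M)
  case 0
  show ?case by (simp only: homogenized_0 mult_zero_right)
next
  case (pCons a P)
  show ?case
  proof (cases "P = 0")
    case True
    show ?thesis unfolding True homogenized_const by (simp only: power_add mult_ac)
  next
    case False
    then obtain M' where M: "M = Suc M'" "degree P \<le> M'"
      using pCons.prems by (cases M) auto
    show ?thesis
      unfolding M(1) add_Suc homogenized_pCons pCons.IH[OF M(2)]
      by (simp only: add_Suc[symmetric] power_add distrib_left mult_ac)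
  qed
qed

text \<open>The degree bounds matter because \<open>homogenized\<close> cuts off all coefficients
  beyond its exponent.\<close>

lemma homogenized_mult:
  "degree P \<le> M \<Longrightarrow> degree Q \<le> M' \<Longrightarrow>
    homogenized q r (M + M') (P * Q) = homogenized q r M P * homogenized q r M' Q"
proof (induction P arbitrary: M)
  case 0
  show ?case by (simp only: homogenized_0 mult_zero_left)
next
  case (pCons a P)
  show ?case
  proof (cases "P = 0")
    case True
    have "[:a:] * Q = smult a Q" by simp
    then show ?thesis
      unfolding True homogenized_const
      using homogenized_raise[OF pCons.prems(2), of q r M]
      by (simp only: homogenized_smult add.commute[of M] mult_ac)
  next
    case False
    then obtain N where N: "M = Suc N" "degree P \<le> N"
      using pCons.prems by (cases M) auto
    have "homogenized q r (M + M') (pCons a P * Q)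
        = a * homogenized q r (M' + Suc N) Q + homogenized q r (Suc (N + M')) (pCons 0 (P * Q))"
      unfolding N(1) mult_pCons_left homogenized_add homogenized_smult
      by (simp only: add_Suc add_Suc_right add.commute)
    also have "\<dots> = a * (q ^ Suc N * homogenized q r M' Q) + r * (homogenized q r N P * homogenized q r M' Q)"
      unfolding homogenized_pCons homogenized_raise[OF pCons.prems(2), of q r "Suc N"]
        pCons.IH[OF N(2) pCons.prems(2)] by (simp only: mult_zero_left add_0_left)
    also have "\<dots> = homogenized q r M (pCons a P) * homogenized q r M' Q"
      unfolding N(1) homogenized_pCons by (simp only: distrib_left distrib_right mult_ac)
    finally show ?thesis .
  qed
qed

section \<open>Removing a lower corner of a ladder\<close>

text \<open>No other entry lies weakly south-west of \<open>(d, c)\<close>. Of the sizes attached to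
  this corner only the least one, \<open>t\<close>, counts, since larger minors expand into
  \<open>t\<close>-minors.\<close>

locale corner_removal =
  fixes L :: "(nat \<times> nat) set" and U :: "((nat \<times> nat) \<times> nat) set" and d c t :: nat
  assumes good: "good_conditions L U"
    and yL: "(d, c) \<in> L"
    and corner: "\<And>e. e \<in> L \<Longrightarrow> d \<le> fst e \<Longrightarrow> snd e \<le> c \<Longrightarrow> e = (d, c)"
    and yt: "((d, c), t) \<in> U"
    and t_min: "\<And>s. ((d, c), s) \<in> U \<Longrightarrow> t \<le> s"
begin

definition "L' = L - {(d, c)}"

text \<open>The faces for \<open>Udel\<close> and \<open>Ulink\<close> are the deletion and the link of the corner in the complex of
  faces.\<close>

definition "Udel = {(u, s) \<in> U. u \<noteq> (d, c)} \<union> {(u, t) | u. u \<in> {(d - 1, c), (d, c + 1)} \<and> u \<in> L}"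

definition "Ulink = Udel \<union> {(u, t - 1) | u. u = (d - 1, c + 1) \<and> u \<in> L}"

lemma convex: "ladder_convex L" and d_pos: "0 < d" and t_pos: "0 < t" and finite_L: "finite L"
  using good yL yt by (force simp: good_conditions_def)+

lemma U_in_L: "(u, s) \<in> U \<Longrightarrow> u \<in> L \<and> 0 < s"
  using good by (auto simp: good_conditions_def)

lemma U_not_ne: "(u, s) \<in> U \<Longrightarrow> (u', s') \<in> U \<Longrightarrow> \<not> ne u u'"
  using good unfolding good_conditions_def by fastforce

text \<open>A subladder that contains \<open>(d, c)\<close> has its own corner weakly south-west of
  it.\<close>

lemma corner_in_subladder: "(u, s) \<in> U \<Longrightarrow> (d, c) \<in> subladder L u \<Longrightarrow> u = (d, c)"
  using corner[of u] U_in_L[of u s] by (auto simp: mem_subladder)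

lemma convex': "ladder_convex L'"
  unfolding ladder_convex_def L'_def
proof (intro allI impI subsetI)
  fix i j i' j' e
  assume *: "(i, j) \<in> L - {(d, c)} \<and> (i', j') \<in> L - {(d, c)} \<and> i \<le> i' \<and> j' \<le> j" "e \<in> {i..i'} \<times> {j'..j}"
  then have "e \<in> L" using ladder_convexD[OF convex, of i j i' j' "fst e" "snd e"] by auto
  moreover have "e \<noteq> (d, c)"
  proof
    assume "e = (d, c)"
    then have "(i', j') = (d, c)" using * corner[of "(i', j')"] by auto
    then show False using * by auto
  qed
  ultimately show "e \<in> L - {(d, c)}" by blast
qed

text \<open>Serves \<open>Udel\<close> and \<open>Ulink\<close> at once. Positivity of the sizes is
  a separate assumption because \<open>t - 1\<close> may be 0.\<close>

lemma goodI:
  assumes "V \<subseteq> Ulink" "\<And>u s. (u, s) \<in> V \<Longrightarrow> 0 < s"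
  shows "good_conditions L' V"
proof -
  have mem: "u \<in> L'" if "(u, s) \<in> Ulink" for u s
    using that U_in_L[of u s] d_pos by (auto simp: Ulink_def Udel_def L'_def)
  have cases: "((u, s) \<in> U \<and> u \<noteq> (d, c)) \<or> u = (d - 1, c) \<or> u = (d, c + 1) \<or> u = (d - 1, c + 1)"
    if "(u, s) \<in> Ulink" for u s
    using that by (auto simp: Ulink_def Udel_def)
  \<comment> \<open>An old corner comparable with one of the three new positions would lie strictly
    north-east of \<open>(d, c)\<close> or weakly south-west of it.\<close>
  have old: "\<not> ne v u \<and> \<not> ne u v" if "(u, s) \<in> U" "u \<noteq> (d, c)" "v \<in> {(d - 1, c), (d, c + 1), (d - 1, c + 1)}" for u s v
  proof -
    have "\<not> ne u (d, c)" using that yt U_not_ne by blast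
    moreover have "\<not> (d \<le> fst u \<and> snd u \<le> c)" using that corner[of u] U_in_L by blast
    ultimately show ?thesis using that(3) d_pos by (auto simp: ne_def)
  qed
  have incomp: "\<not> ne u u'" if "(u, s) \<in> Ulink" "(u', s') \<in> Ulink" for u s u' s'
  proof (cases "(u, s) \<in> U \<and> u \<noteq> (d, c)"; cases "(u', s') \<in> U \<and> u' \<noteq> (d, c)")
    let ?N = "{(d - 1, c), (d, c + 1), (d - 1, c + 1)}"
    note u = cases[OF that(1)] and u' = cases[OF that(2)]
    show "\<not> ne u u'" if "(u, s) \<in> U \<and> u \<noteq> (d, c)" "(u', s') \<in> U \<and> u' \<noteq> (d, c)"
      using that U_not_ne by blast
    show "\<not> ne u u'" if "(u, s) \<in> U \<and> u \<noteq> (d, c)" "\<not> ((u', s') \<in> U \<and> u' \<noteq> (d, c))"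
    proof -
      have "u' \<in> ?N" using u' that(2) by simp
      then show ?thesis using old that(1) by blast
    qed
    show "\<not> ne u u'" if "\<not> ((u, s) \<in> U \<and> u \<noteq> (d, c))" "(u', s') \<in> U \<and> u' \<noteq> (d, c)"
    proof -
      have "u \<in> ?N" using u that(1) by simp
      then show ?thesis using old that(2) by blast
    qed
    show "\<not> ne u u'" if "\<not> ((u, s) \<in> U \<and> u \<noteq> (d, c))" "\<not> ((u', s') \<in> U \<and> u' \<noteq> (d, c))"
    proof -
      have "u \<in> ?N" "u' \<in> ?N" using u u' that by simp_all
      then show ?thesis by (elim insertE emptyE) (simp_all add: ne_def)
    qed
  qed
  show ?thesis
    unfolding good_conditions_def
  proof (intro conjI ballI)
    show "finite L'" "0 \<notin> fst ` L'" "ladder_convex L'"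
      using good convex' by (auto simp: good_conditions_def L'_def)
    fix x assume x: "x \<in> V"
    obtain u s where us: "x = (u, s)" by (cases x)
    show "case x of (u, t) \<Rightarrow> u \<in> L' \<and> 0 < t"
      using x assms mem[of u s] unfolding us by auto
    show "case x of (u, t) \<Rightarrow> \<forall>(u', t')\<in>V. \<not> ne u u'"
      using x assms(1) incomp[of u s] unfolding us by fast
  qed
qed

lemma good_Udel: "good_conditions L' Udel"
  by (rule goodI) (use U_in_L t_pos in \<open>auto simp: Ulink_def Udel_def\<close>)

lemma good_Ulink: "2 \<le> t \<Longrightarrow> good_conditions L' Ulink"
  by (rule goodI) (use U_in_L t_pos in \<open>auto simp: Ulink_def Udel_def\<close>)

lemma mem_L': "e \<in> L' \<longleftrightarrow> e \<in> L \<and> e \<noteq> (d, c)"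
  by (auto simp: L'_def)

text \<open>As \<open>t > 0\<close>, the block has an entry; convexity between this entry and the
  corner puts \<open>(d - 1, c)\<close> into \<open>L\<close>, so \<open>Udel\<close> has a
  condition there.\<close>

lemma block_above:
  assumes "length rs = t" "length cs = t" "set rs \<times> set cs \<subseteq> L" "\<And>i. i \<in> set rs \<Longrightarrow> i < d" "\<And>j. j \<in> set cs \<Longrightarrow> c \<le> j"
  shows "minor rs cs \<in> block_ideal L' Udel"
proof -
  have "hd rs \<in> set rs" "hd cs \<in> set cs" using assms(1,2) t_pos by (auto intro!: hd_in_set)
  then have "(hd rs, hd cs) \<in> L" "hd rs < d" "c \<le> hd cs" using assms by auto
  then have "(d - 1, c) \<in> L"
    using ladder_convexD[OF convex _ yL, of "hd rs" "hd cs" "d - 1" c] by auto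
  then have "((d - 1, c), t) \<in> Udel" by (auto simp: Udel_def)
  moreover have "set rs \<times> set cs \<subseteq> subladder L' (d - 1, c)"
    using assms(3-5) by (fastforce simp: mem_subladder mem_L')
  ultimately show ?thesis using assms minor_in_block_ideal by blast
qed

lemma block_right:
  assumes "length rs = t" "length cs = t" "set rs \<times> set cs \<subseteq> L" "\<And>i. i \<in> set rs \<Longrightarrow> i \<le> d" "\<And>j. j \<in> set cs \<Longrightarrow> c < j"
  shows "minor rs cs \<in> block_ideal L' Udel"
proof -
  have "hd rs \<in> set rs" "hd cs \<in> set cs" using assms(1,2) t_pos by (auto intro!: hd_in_set)
  then have "(hd rs, hd cs) \<in> L" "hd rs \<le> d" "c < hd cs" using assms by auto
  then have "(d, c + 1) \<in> L"
    using ladder_convexD[OF convex _ yL, of "hd rs" "hd cs" d "c + 1"] by auto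
  then have "((d, c + 1), t) \<in> Udel" by (auto simp: Udel_def)
  moreover have "set rs \<times> set cs \<subseteq> subladder L' (d, c + 1)"
    using assms(3-5) by (fastforce simp: mem_subladder mem_L')
  ultimately show ?thesis using assms minor_in_block_ideal by blast
qed

text \<open>The data of a \<open>t\<close>-minor through the corner. Row \<open>d\<close> and column
  \<open>c\<close> are put last, so that \<open>var (d, c)\<close> has coefficient
  \<open>minor A B\<close> with sign +1.\<close>

definition corner_block :: "nat list \<Rightarrow> nat list \<Rightarrow> bool" where
  "corner_block A B \<longleftrightarrow> length A = t - 1 \<and> length B = t - 1 \<and> (\<forall>i\<in>set A. i < d) \<and> (\<forall>j\<in>set B. c < j) \<and>
     set (A @ [d]) \<times> set (B @ [c]) \<subseteq> L"

abbreviation cmin :: "nat list \<Rightarrow> nat list \<Rightarrow> 'k::comm_ring_1 mpol" where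
  "cmin A B \<equiv> minor (A @ [d]) (B @ [c])"

text \<open>Either row \<open>d\<close> or column \<open>c\<close> is missing, or an index is
  repeated and the minor vanishes, or sorting \<open>d\<close> and \<open>c\<close> to the end gives
  a minor through the corner up to sign.\<close>

lemma t_minor_cases:
  assumes "length rs = t" "length cs = t" "set rs \<times> set cs \<subseteq> subladder L (d, c)"
  shows "(minor rs cs :: 'k::comm_ring_1 mpol) \<in> block_ideal L' Udel \<or>
    (\<exists>A B. corner_block A B \<and> (minor rs cs = (cmin A B :: 'k mpol) \<or> minor rs cs = - (cmin A B :: 'k mpol)))"
proof -
  have ne: "rs \<noteq> []" "cs \<noteq> []" using assms t_pos by auto
  have bd: "set rs \<times> set cs \<subseteq> L" "\<And>i. i \<in> set rs \<Longrightarrow> i \<le> d" "\<And>j. j \<in> set cs \<Longrightarrow> c \<le> j"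
    using assms(3) ne by (auto simp: mem_subladder subset_iff) (metis hd_in_set)+
  consider "d \<notin> set rs" | "c \<notin> set cs" | "\<not> distinct rs \<or> \<not> distinct cs"
    | "d \<in> set rs" "c \<in> set cs" "distinct rs" "distinct cs" by blast
  then show ?thesis
  proof cases
    case 1
    then have "minor rs cs \<in> block_ideal L' Udel"
      by (intro block_above assms bd) (use bd(2) le_neq_implies_less in blast)+
    then show ?thesis ..
  next
    case 2
    then have "minor rs cs \<in> block_ideal L' Udel"
      by (intro block_right assms bd) (use bd(3) le_neq_implies_less in blast)+
    then show ?thesis ..
  next
    case 3
    then have "minor rs cs = (0 :: 'k mpol)"
      using assms by (auto simp: minor_eq_gminor gminor_not_distinct_rows gminor_not_distinct_cols)
    then show ?thesis by (simp add: gen_ideal_0)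
  next
    case 4
    define A where "A = remove1 d rs"
    define B where "B = remove1 c cs"
    have sets: "set A = set rs - {d}" "set B = set cs - {c}" using 4 by (simp_all add: A_def B_def)
    have "corner_block A B"
      unfolding corner_block_def
    proof (intro conjI ballI)
      show "length A = t - 1" "length B = t - 1" using 4 assms by (simp_all add: A_def B_def length_remove1)
      show "i < d" if "i \<in> set A" for i using that bd(2)[of i] by (auto simp: sets)
      show "c < j" if "j \<in> set B" for j using that bd(3)[of j] by (auto simp: sets)
      show "set (A @ [d]) \<times> set (B @ [c]) \<subseteq> L" using bd(1) 4 by (auto simp: sets)
    qed
    moreover have "mset rs = mset (A @ [d])" "mset cs = mset (B @ [c])"
      using 4 by (simp_all add: A_def B_def)
    ultimately show ?thesis
      using gminor_permute[of rs "A @ [d]" cs "B @ [c]" "\<lambda>i j. var (i, j) :: 'k mpol"] assms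
      by (auto simp: minor_eq_gminor)
  qed
qed

text \<open>The subladder of any other corner avoids \<open>(d, c)\<close>, so its minors stay
  generators for \<open>Udel\<close>. At \<open>(d, c)\<close> all sizes reduce to the least one by
  expansion.\<close>

lemma minor_gens_cases:
  assumes "g \<in> (minor_gens L U :: 'k::comm_ring_1 mpol set)"
  shows "g \<in> gen_ideal (block_ideal L' Udel \<union> {cmin A B | A B. corner_block A B})" (is "_ \<in> gen_ideal ?G")
proof -
  obtain rs cs u where g: "g = minor rs cs" "(u, length rs) \<in> U" "length cs = length rs"
    "set rs \<times> set cs \<subseteq> subladder L u"
    using assms by (auto simp: minor_gens_def)
  show ?thesis
  proof (cases "u = (d, c)")
    case False
    then have "(d, c) \<notin> subladder L u" using g(2) corner_in_subladder by blast
    then have "set rs \<times> set cs \<subseteq> subladder L' u"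
      using g(4) by (fastforce simp: mem_subladder mem_L')
    moreover have "(u, length rs) \<in> Udel" using False g(2) by (auto simp: Udel_def)
    ultimately have "g \<in> block_ideal L' Udel"
      using g(1,3) minor_in_block_ideal by blast
    then show ?thesis by (intro gen_ideal_base) blast
  next
    case True
    have "minor rs cs \<in> block_ideal L {((d, c), t)}"
      by (rule larger_minor_in_block_ideal) (use True g t_min in auto)
    moreover have "block_ideal L {((d, c), t)} \<subseteq> gen_ideal ?G"
    proof (rule gen_ideal_least, rule subsetI)
      fix x :: "'k mpol" assume "x \<in> minor_gens L {((d, c), t)}"
      then obtain rs cs where x: "x = minor rs cs" "length rs = t" "length cs = t"
        "set rs \<times> set cs \<subseteq> subladder L (d, c)" by (auto simp: minor_gens_def)
      have "x \<in> ?G \<or> - x \<in> ?G"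
        using t_minor_cases[OF x(2-4), where 'k = 'k] unfolding x(1) by (elim disjE exE conjE) auto
      then show "x \<in> gen_ideal ?G"
        using gen_ideal_base[of x ?G] gen_ideal_base[of "- x" ?G] by auto
    qed
    ultimately show ?thesis using g(1) by blast
  qed
qed

text \<open>The terms with \<open>var (d, c)\<close> cancel, so this says that all corner minors
  have the same quotient \<open>- r / q\<close> modulo \<open>N\<close>. In the bordered exchange
  the correction minors avoid row \<open>d\<close> or column \<open>c\<close>; they lie in the
  ladder as soon as one of the two mixed blocks does.\<close>

lemma cmin_exchange:
  assumes "corner_block A B" "corner_block A' B'"
  shows "minor A' B' * cmin A B - minor A B * cmin A' B' \<in> (block_ideal L' Udel :: 'k::comm_ring_1 mpol set)"
proof -
  have *: "minor A' B' * cmin A B - minor A B * cmin A' B' \<in> (block_ideal L' Udel :: 'k mpol set)"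
    if AB: "corner_block A B" "corner_block A' B'" and sub: "set A \<times> set B' \<subseteq> L" for A B A' B'
    unfolding minor_eq_gminor
  proof (rule gminor_bordered_exchange)
    have t1: "Suc (t - 1) = t" using t_pos by simp
    show "length B = length A" "length B' = length A'" using AB by (simp_all add: corner_block_def)
    show "gminor (\<lambda>i j. var (i, j)) (A' @ [i]) (B' @ [c]) \<in> (block_ideal L' Udel :: 'k mpol set)" if "i \<in> set A" for i
      unfolding minor_eq_gminor[symmetric]
      by (rule block_above) (use AB sub that t1 in \<open>auto simp: corner_block_def\<close>)
    show "gminor (\<lambda>i j. var (i, j)) (A @ [d]) (B @ [j]) \<in> (block_ideal L' Udel :: 'k mpol set)" if "j \<in> set B'" for j
      unfolding minor_eq_gminor[symmetric]
      by (rule block_right) (use AB sub that t1 in \<open>auto simp: corner_block_def less_imp_le\<close>)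
  qed
  \<comment> \<open>If \<open>A'\<close> reaches at least as high as \<open>A\<close>, the position
    \<open>(i, j)\<close> lies in the rectangle between \<open>(Min (set A'), j)\<close> and the
    corner.\<close>
  have sub: "set A \<times> set B' \<subseteq> L" if AB: "corner_block A B" "corner_block A' B'"
    and le: "A' \<noteq> [] \<longrightarrow> Min (set A') \<le> Min (set A)" for A B A' B'
  proof clarify
    fix i j assume ij: "i \<in> set A" "j \<in> set B'"
    then have "A' \<noteq> []" using AB by (auto simp: corner_block_def)
    then have "Min (set A') \<in> set A'" "Min (set A') \<le> i"
      using le ij(1) Min_le[of "set A" i] by (auto intro: order.trans)
    then have "(Min (set A'), j) \<in> L" "i < d" "c < j" using AB ij by (auto simp: corner_block_def)
    then show "(i, j) \<in> L"
      using ladder_convexD[OF convex _ yL, of "Min (set A')" j i j] \<open>Min (set A') \<le> i\<close> by auto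
  qed
  have "set A \<times> set B' \<subseteq> L \<or> set A' \<times> set B \<subseteq> L"
    using sub[OF assms] sub[OF assms(2,1)] by linarith
  then show ?thesis
  proof
    assume "set A' \<times> set B \<subseteq> L"
    from *[OF assms(2,1) this] show ?thesis
      using gen_ideal_minus by (metis minus_diff_eq)
  qed (rule *[OF assms])
qed

definition strict_block :: "(nat \<times> nat) set" where
  "strict_block = {e \<in> L. fst e < d \<and> c < snd e}"

lemma corner_block_chain:
  assumes Z: "chain Z" "set Z \<subseteq> strict_block" "length Z = t - 1"
  shows "corner_block (map fst Z) (map snd Z)"
proof -
  have "chain (Z @ [(d, c)])"
    using Z by (auto simp: sorted_wrt_append ne_def strict_block_def)
  moreover have "set (Z @ [(d, c)]) \<subseteq> subladder L (d, c)"
    using Z(2) yL by (auto simp: mem_subladder strict_block_def)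
  ultimately have "set (map fst (Z @ [(d, c)])) \<times> set (map snd (Z @ [(d, c)])) \<subseteq> subladder L (d, c)"
    by (rule chain_block[OF convex])
  then have "set (map fst (Z @ [(d, c)])) \<times> set (map snd (Z @ [(d, c)])) \<subseteq> L"
    using subladder_subset[of L "(d, c)"] by blast
  then have "set (map fst Z @ [d]) \<times> set (map snd Z @ [c]) \<subseteq> L"
    by (simp only: map_append list.map fst_conv snd_conv)
  then show ?thesis using Z unfolding corner_block_def strict_block_def by auto
qed

text \<open>A forbidden chain of length \<open>s\<close> inside \<open>Z\<close> puts the first
  \<open>s\<close> entries of \<open>Z\<close> into \<open>subladder L' u\<close>. Moreover
  \<open>u\<close> reaches left to column \<open>c\<close> or down to row \<open>d\<close>.
  Accordingly, expansion along the first \<open>s\<close> rows or the first \<open>s\<close> columns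
  leaves minors that satisfy the condition \<open>(u, s)\<close>.\<close>

lemma cmin_nonface:
  assumes Z: "chain Z" "set Z \<subseteq> strict_block" "length Z = t - 1" and nf: "\<not> face L' Udel (set Z)"
  shows "cmin (map fst Z) (map snd Z) \<in> block_ideal L' Udel"
proof -
  obtain u z where uz: "(u, length z) \<in> Udel" "chain z" "set z \<subseteq> set Z" "set z \<subseteq> subladder L' u"
    using nf by (rule not_faceE)
  define s where "s = length z"
  have dz: "distinct z" "distinct Z" using chain_distinct uz(2) Z(1) by auto
  have s_le: "s \<le> t - 1"
    using card_mono[OF _ uz(3)] distinct_card[OF dz(1)] distinct_card[OF dz(2)] Z(3) by (simp add: s_def)
  \<comment> \<open>Otherwise the entries of \<open>z\<close>, which lie in the subladder, would all
    be among the first \<open>i\<close> entries of \<open>Z\<close>, and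
    \<open>i < s\<close>.\<close>
  have pre: "Z ! i \<in> subladder L' u" if i: "i < s" for i
  proof (rule ccontr)
    assume no: "Z ! i \<notin> subladder L' u"
    have "set z \<subseteq> set (take i Z)"
    proof
      fix e assume e: "e \<in> set z"
      then obtain j where j: "j < length Z" "e = Z ! j" using uz(3) by (metis in_set_conv_nth subsetD)
      have "j < i"
      proof (rule ccontr)
        assume "\<not> j < i"
        then consider "i = j" | "i < j" by linarith
        then have "i = j \<or> ne (Z ! i) (Z ! j)" using Z(1) j(1) unfolding chain_nth by cases blast+
        moreover have "Z ! i \<in> L'"
          using Z(2) i s_le Z(3) nth_mem[of i Z] by (auto simp: strict_block_def mem_L' simp del: nth_mem)
        ultimately have "Z ! i \<in> subladder L' u"
          using e j uz(4) subladder_ne_closed[of "Z ! i" L' "Z ! j" u] by (auto simp: ne_def)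
        then show False using no by simp
      qed
      then show "e \<in> set (take i Z)" using j by (auto simp: in_set_conv_nth)
    qed
    then have "s \<le> card (set (take i Z))"
      using card_mono[of "set (take i Z)" "set z"] distinct_card[OF dz(1)] by (simp add: s_def)
    also have "\<dots> \<le> i" using card_length[of "take i Z"] by simp
    finally show False using i by simp
  qed
  have pre_set: "e \<in> subladder L' u" if "e \<in> set (take s Z)" for e
    using that pre by (auto simp: in_set_conv_nth)
  have cb: "corner_block (map fst Z) (map snd Z)" using corner_block_chain[OF Z] .
  let ?A = "map fst Z" and ?B = "map snd Z"
  \<comment> \<open>No corner in \<open>Udel\<close> lies strictly north-east of
    \<open>(d, c)\<close>: the old ones by goodness, the new ones by their position.\<close>
  have u: "d \<le> fst u \<or> snd u \<le> c"
    using uz(1) U_not_ne[OF _ yt, of u] by (auto simp: Udel_def ne_def not_less)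
  have len: "length (?B @ [c]) = length (?A @ [d])" by simp
  have gen: "minor rs cs \<in> block_ideal L' Udel"
    if "length rs = s" "length cs = s" "set rs \<subseteq> set (?A @ [d])" "set cs \<subseteq> set (?B @ [c])"
      "d \<notin> set rs \<or> c \<notin> set cs" "\<And>i. i \<in> set rs \<Longrightarrow> i \<le> fst u" "\<And>j. j \<in> set cs \<Longrightarrow> snd u \<le> j" for rs cs
  proof (rule minor_in_block_ideal)
    show "(u, s) \<in> Udel" using uz(1) by (simp add: s_def)
    have "set rs \<times> set cs \<subseteq> L" using that(3,4) cb unfolding corner_block_def by blast
    then show "set rs \<times> set cs \<subseteq> subladder L' u" using that(5-7) by (auto simp: mem_subladder mem_L')
  qed (use that in auto)
  have A: "?A @ [d] = take s ?A @ (drop s ?A @ [d])" and B: "?B @ [c] = take s ?B @ (drop s ?B @ [c])"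
    by (simp_all add: append_take_drop_id del: take_map drop_map append_assoc flip: append_assoc)
  have dA: "d \<notin> set (take s ?A)" and cB: "c \<notin> set (take s ?B)"
    using cb set_take_subset[of s ?A] set_take_subset[of s ?B] unfolding corner_block_def by blast+
  have sA: "set (take s ?A) \<subseteq> set (?A @ [d])" and sB: "set (take s ?B) \<subseteq> set (?B @ [c])"
    using set_take_subset[of s ?A] set_take_subset[of s ?B] by auto
  from u show ?thesis
  proof
    assume "snd u \<le> c"
    have "gminor (\<lambda>i j. var (i, j)) (take s ?A @ (drop s ?A @ [d])) (?B @ [c]) \<in> block_ideal L' Udel"
    proof (rule gminor_append_rows_in_ideal[where Q = "set (?B @ [c])"])
      fix cs assume cs: "length cs = length (take s ?A)" "set cs \<subseteq> set (?B @ [c])"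
      have "minor (take s ?A) cs \<in> block_ideal L' Udel"
      proof (rule gen)
        show "i \<le> fst u" if "i \<in> set (take s ?A)" for i
          using that pre_set by (auto simp: take_map mem_subladder)
        show "snd u \<le> j" if "j \<in> set cs" for j
        proof -
          have "c \<le> j" using that cs(2) cb unfolding corner_block_def by (auto intro: less_imp_le)
          then show ?thesis using \<open>snd u \<le> c\<close> by simp
        qed
      qed (use cs s_le Z(3) dA sA in auto)
      then show "gminor (\<lambda>i j. var (i, j)) (take s ?A) cs \<in> block_ideal L' Udel"
        by (simp only: minor_eq_gminor)
    qed (use len in \<open>simp_all only: A[symmetric] order_refl\<close>)
    then show ?thesis by (simp only: minor_eq_gminor A[symmetric])
  next
    assume "d \<le> fst u"
    have "gminor (\<lambda>i j. var (i, j)) (?A @ [d]) (take s ?B @ (drop s ?B @ [c])) \<in> block_ideal L' Udel"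
    proof (rule gminor_append_cols_in_ideal[where P = "set (?A @ [d])"])
      fix rs assume rs: "length rs = length (take s ?B)" "set rs \<subseteq> set (?A @ [d])"
      have "minor rs (take s ?B) \<in> block_ideal L' Udel"
      proof (rule gen)
        show "snd u \<le> j" if "j \<in> set (take s ?B)" for j
          using that pre_set by (auto simp: take_map mem_subladder)
        show "i \<le> fst u" if "i \<in> set rs" for i
        proof -
          have "i \<le> d" using that rs(2) cb unfolding corner_block_def by (auto intro: less_imp_le)
          then show ?thesis using \<open>d \<le> fst u\<close> by simp
        qed
      qed (use rs s_le Z(3) cB sB in auto)
      then show "gminor (\<lambda>i j. var (i, j)) rs (take s ?B) \<in> block_ideal L' Udel"
        by (simp only: minor_eq_gminor)
    qed (use len in \<open>simp_all only: B[symmetric] order_refl\<close>)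
    then show ?thesis by (simp only: minor_eq_gminor B[symmetric])
  qed
qed

end

text \<open>Every generator then has more rows than its block has ones.\<close>

lemma ev_ideal_eq_0:
  assumes "f \<in> block_ideal L U" "finite W" "\<And>u s. (u, s) \<in> U \<Longrightarrow> card (W \<inter> subladder L u) < s"
  shows "ev W f = 0"
proof -
  interpret comm_ring_hom "ev W :: 'a mpol \<Rightarrow> 'a" by (rule ev_hom)
  show ?thesis using assms(1)
  proof (induction rule: gen_ideal_induct)
    case (step r g x)
    then obtain rs cs u where "g = minor rs cs" "(u, length rs) \<in> U" "length cs = length rs"
      "set rs \<times> set cs \<subseteq> subladder L u" by (auto simp: minor_gens_def)
    then have "ev W g = 0" using ev_minor_eq_0[of W "subladder L u" rs cs] assms(2,3) by simp
    then show ?case using step by (simp add: hom_add hom_mult)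
  qed simp
qed

lemma face_card:
  assumes "face L U (set Z)" "chain Z" "(u, s) \<in> U"
  shows "card (set Z \<inter> subladder L u) < s"
proof -
  let ?z = "filter (\<lambda>e. e \<in> subladder L u) Z"
  have "length ?z < s"
    by (rule faceD[OF assms(1,3)]) (use assms(2) in \<open>auto simp: sorted_wrt_filter\<close>)
  moreover have "card (set Z \<inter> subladder L u) = length ?z"
    using distinct_card[of ?z] chain_distinct[OF assms(2)] by (simp add: Int_def)
  ultimately show ?thesis by simp
qed

context corner_removal
begin

text \<open>By \<open>cmin_nonface\<close> all corner minors are then already in the ideal for
  \<open>Udel\<close>, and the corner entry becomes a free variable.\<close>

lemma ideal_eq_if_nonfaces:
  assumes nf: "\<And>Z. chain Z \<Longrightarrow> set Z \<subseteq> strict_block \<Longrightarrow> length Z = t - 1 \<Longrightarrow> \<not> face L' Udel (set Z)"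
  shows "block_ideal L U = (block_ideal L' Udel :: 'k::comm_ring_1 mpol set)"
proof
  have cm: "cmin A B \<in> (block_ideal L' Udel :: 'k mpol set)" if AB: "corner_block A B" for A B
  proof (cases "distinct A \<and> distinct B")
    case False
    then have "cmin A B = (0 :: 'k mpol)"
      using AB by (auto simp: minor_eq_gminor gminor_not_distinct_rows gminor_not_distinct_cols corner_block_def)
    then show ?thesis by (simp add: gen_ideal_0)
  next
    case True
    define A' where "A' = sort A"
    \<comment> \<open>Columns are sorted decreasingly, so that pairing them with the increasing rows
      gives a chain.\<close>
    define B' where "B' = rev (sort B)"
    have len: "length A' = t - 1" "length B' = t - 1" using AB by (simp_all add: A'_def B'_def corner_block_def)
    have "sorted_wrt (<) A'" using True by (simp add: A'_def strict_sorted_iff)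
    moreover have "sorted_wrt (>) B'"
      using True strict_sorted_iff[of "sort B"] by (simp add: B'_def sorted_wrt_rev)
    ultimately have Z: "chain (zip A' B')" using len by (intro chain_zip) simp_all
    have "set (zip A' B') \<subseteq> set A \<times> set B"
      by (auto simp: A'_def B'_def dest: set_zip_leftD set_zip_rightD)
    then have sub: "set (zip A' B') \<subseteq> strict_block"
      using AB unfolding corner_block_def strict_block_def by fastforce
    have "cmin (map fst (zip A' B')) (map snd (zip A' B')) \<in> (block_ideal L' Udel :: 'k mpol set)"
      by (rule cmin_nonface[OF Z sub _ nf[OF Z sub]]) (use len in simp_all)
    then have "cmin A' B' \<in> (block_ideal L' Udel :: 'k mpol set)" using len by simp
    moreover have "cmin A B = (cmin A' B' :: 'k mpol) \<or> cmin A B = - (cmin A' B' :: 'k mpol)"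
      unfolding minor_eq_gminor
      by (rule gminor_permute) (use AB in \<open>simp_all add: A'_def B'_def corner_block_def\<close>)
    ultimately show ?thesis by auto
  qed
  show "block_ideal L U \<subseteq> (block_ideal L' Udel :: 'k mpol set)"
  proof (rule gen_ideal_least, rule subsetI)
    fix g :: "'k mpol" assume "g \<in> minor_gens L U"
    then have "g \<in> gen_ideal (block_ideal L' Udel \<union> {cmin A B | A B. corner_block A B})"
      by (rule minor_gens_cases)
    also have "\<dots> \<subseteq> block_ideal L' Udel" by (rule gen_ideal_least) (use cm in auto)
    finally show "g \<in> block_ideal L' Udel" .
  qed
next
  show "(block_ideal L' Udel :: 'k mpol set) \<subseteq> block_ideal L U"
  proof (rule gen_ideal_least, rule subsetI)
    fix g :: "'k mpol" assume "g \<in> minor_gens L' Udel"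
    then obtain rs cs u where g: "g = minor rs cs" "(u, length rs) \<in> Udel" "length cs = length rs"
      "set rs \<times> set cs \<subseteq> subladder L' u" by (auto simp: minor_gens_def)
    from g(2) consider "(u, length rs) \<in> U" | "length rs = t" "u \<in> {(d - 1, c), (d, c + 1)}"
      by (auto simp: Udel_def)
    then show "g \<in> block_ideal L U"
    proof cases
      case 1
      have "set rs \<times> set cs \<subseteq> subladder L u" using g(4) by (auto simp: mem_subladder mem_L')
      then show ?thesis using minor_in_block_ideal[OF 1] g by blast
    next
      case 2
      have "subladder L' u \<subseteq> subladder L (d, c)" using 2(2) by (auto simp: mem_subladder mem_L')
      then have "set rs \<times> set cs \<subseteq> subladder L (d, c)" using g(4) by blast
      then show ?thesis using minor_in_block_ideal[OF yt] 2(1) g by blast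
    qed
  qed
qed

lemma face_Udel:
  assumes "face L U F"
  shows "face L' Udel F"
proof (rule faceI)
  fix u s z assume z: "(u, s) \<in> Udel" "chain z" "set z \<subseteq> F" "set z \<subseteq> subladder L' u" "length z = s"
  from z(1) consider "(u, s) \<in> U" | "s = t" "u \<in> {(d - 1, c), (d, c + 1)}" by (auto simp: Udel_def)
  then show False
  proof cases
    case 1
    then show False using faceD[OF assms 1 z(2,3)] z(4,5) by (auto simp: mem_subladder mem_L' subset_iff)
  next
    case 2
    have "subladder L' u \<subseteq> subladder L (d, c)" using 2(2) by (auto simp: mem_subladder mem_L')
    then show False using faceD[OF assms yt z(2,3)] z(4,5) 2(1) by auto
  qed
qed

text \<open>A chain violating the extra condition of \<open>Ulink\<close> lies strictly north-east
  of the corner, and appending the corner makes it a forbidden chain of length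
  \<open>t\<close>.\<close>

lemma face_Ulink:
  assumes f: "face L U (insert (d, c) F)"
  shows "face L' Ulink F"
proof (rule faceI)
  fix u s z assume z: "(u, s) \<in> Ulink" "chain z" "set z \<subseteq> F" "set z \<subseteq> subladder L' u" "length z = s"
  show False
  proof (cases "(u, s) \<in> Udel")
    case True
    have "face L' Udel F" by (rule face_Udel[OF face_mono[OF f]]) auto
    from faceD[OF this True z(2-4)] z(5) show False by simp
  next
    case False
    then have u: "u = (d - 1, c + 1)" "s = t - 1" using z(1) by (auto simp: Ulink_def)
    have sub: "fst e < d \<and> c < snd e \<and> e \<in> L" if "e \<in> set z" for e
      using that z(4) u(1) d_pos by (fastforce simp: mem_subladder mem_L')
    then have "chain (z @ [(d, c)])" "set (z @ [(d, c)]) \<subseteq> subladder L (d, c)"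
      using z(2) yL by (auto simp: sorted_wrt_append ne_def mem_subladder less_imp_le)
    from faceD[OF f yt this(1) _ this(2)] z(3,5) u(2) t_pos show False by auto
  qed
qed

end

section \<open>Substituting -r/q for the corner entry, and the kernel\<close>

locale corner_removal_face = corner_removal +
  fixes Z :: "(nat \<times> nat) list" and ty :: "'k::field itself"
  assumes Z: "chain Z" "set Z \<subseteq> strict_block" "length Z = t - 1" "face L' Udel (set Z)"
    and N_prime: "prime_set (block_ideal L' Udel :: 'k mpol set)"
begin

definition q :: "'k mpol" where "q = minor (map fst Z) (map snd Z)"
definition g :: "'k mpol" where "g = cmin (map fst Z) (map snd Z)"
definition r :: "'k mpol" where "r = g - var (d, c) * q"

abbreviation N :: "'k mpol set" where "N \<equiv> block_ideal L' Udel"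
abbreviation th :: "'k mpol \<Rightarrow> 'k mpol poly" where "th \<equiv> var_poly (d, c)"

interpretation th: comm_ring_hom th by (rule var_poly_hom)

lemma Z_block: "corner_block (map fst Z) (map snd Z)"
  by (rule corner_block_chain[OF Z(1-3)])

lemma th_q: "th q = [:q:]"
  unfolding q_def by (rule var_poly_minor) (use Z_block in \<open>auto simp: corner_block_def\<close>)

text \<open>At the matrix with ones exactly at \<open>Z\<close> the ideal vanishes, because
  \<open>Z\<close> is a face, while \<open>q\<close> has the value 1.\<close>

lemma q_notin_N: "q \<notin> N"
proof
  assume "q \<in> N"
  then have "ev (set Z) q = 0"
    by (rule ev_ideal_eq_0) (use face_card[OF Z(4,1)] in auto)
  moreover have "ev (set Z) q = 1"
    unfolding q_def by (rule ev_minor_eq_1) (use chain_distinct[OF Z(1)] in auto)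
  ultimately show False by simp
qed

text \<open>In the expansion of \<open>g\<close> along column \<open>c\<close> the corner entry
  occurs only in the last summand, which is \<open>var (d, c) * q\<close>.\<close>

lemma th_r: "th r = [:r:]"
proof -
  let ?A = "map fst Z" and ?B = "map snd Z"
  let ?X = "\<lambda>i j. var (i, j) :: 'k mpol"
  let ?n = "length Z"
  have "g = (\<Sum>i<Suc ?n. var ((?A @ [d]) ! i, c) * ((-1) ^ (?n + i) * gminor ?X (del_nth i (?A @ [d])) ?B))"
    unfolding g_def minor_eq_gminor by (subst gminor_expand_last_col) simp_all
  also have "\<dots> = (\<Sum>i<?n. var (?A ! i, c) * ((-1) ^ (?n + i) * gminor ?X (del_nth i (?A @ [d])) ?B)) + var (d, c) * q"
    using del_nth_last[of ?A d]
    by (simp add: nth_append q_def minor_eq_gminor power_add[symmetric] mult_2[symmetric] del: nth_map)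
  finally have r: "r = (\<Sum>i<?n. var (?A ! i, c) * ((-1) ^ (?n + i) * minor (del_nth i (?A @ [d])) ?B))"
    by (simp add: r_def minor_eq_gminor)
  have c1: "th (var (?A ! i, c)) = [:var (?A ! i, c):]" if "i < ?n" for i
    using Z_block nth_mem[of i ?A] that by (auto simp: var_poly_var corner_block_def simp del: nth_mem)
  have c2: "th (minor (del_nth i (?A @ [d])) ?B) = [:minor (del_nth i (?A @ [d])) ?B:]" if "i < ?n" for i
    by (rule var_poly_minor) (use Z_block that in \<open>auto simp: corner_block_def\<close>)
  have c3: "th ((-1) ^ k) = [:(-1) ^ k:]" for k
    by (simp add: th.hom_power th.hom_uminus const_poly_hom[THEN comm_ring_hom.axioms(1)] minus_one_power_iff one_pCons)
  interpret cp: comm_ring_hom "\<lambda>x :: 'k mpol. [:x:]" by (rule const_poly_hom)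
  show ?thesis
    unfolding r th.hom_sum cp.hom_sum
    by (rule sum.cong) (use c1 c2 c3 in \<open>simp_all only: th.hom_mult cp.hom_mult lessThan_iff\<close>)
qed

lemma th_g: "th g = [:r, q:]"
proof -
  have "g = r + var (d, c) * q" by (simp add: r_def)
  then have "th g = th r + th (var (d, c)) * th q" by (simp add: th.hom_add th.hom_mult)
  then show ?thesis by (simp add: th_r th_q var_poly_var)
qed

lemma coeff_th_N: "f \<in> N \<Longrightarrow> coeff (th f) k \<in> N"
proof (rule coeff_var_poly_in_ideal)
  fix h :: "'k mpol" assume "h \<in> minor_gens L' Udel"
  then obtain rs cs u where "h = minor rs cs" "length cs = length rs" "set rs \<times> set cs \<subseteq> subladder L' u"
    by (auto simp: minor_gens_def)
  then show "th h = [:h:]" by (auto intro!: var_poly_minor simp: mem_subladder mem_L')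
qed

definition hom :: "nat \<Rightarrow> 'k mpol \<Rightarrow> 'k mpol" where "hom M f = homogenized q (- r) M (th f)"

text \<open>The kernel of the substitution into the fraction field of the quotient by
  \<open>N\<close>, with denominators cleared. By \<open>mem_K\<close> any exponent that bounds the
  degree gives the same set.\<close>

definition K :: "'k mpol set" where "K = {f. hom (degree (th f)) f \<in> N}"

lemma mem_K: "degree (th f) \<le> M \<Longrightarrow> f \<in> K \<longleftrightarrow> hom M f \<in> N"
proof -
  assume M: "degree (th f) \<le> M"
  have "hom M f = q ^ (M - degree (th f)) * hom (degree (th f)) f"
    using homogenized_raise[of "th f" "degree (th f)" q "- r" "M - degree (th f)"] M by (simp add: hom_def)
  moreover have "q ^ n \<notin> N" for n using q_notin_N prime_set_power[OF N_prime] by blast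
  ultimately show ?thesis
    using N_prime gen_ideal_mult unfolding prime_set_def K_def by fastforce
qed

lemma N_subset_K: "f \<in> N \<Longrightarrow> f \<in> K"
  unfolding K_def hom_def homogenized_def
  by (auto intro!: gen_ideal_sum gen_ideal_mult' coeff_th_N)

lemma K_add: "f \<in> K \<Longrightarrow> h \<in> K \<Longrightarrow> f + h \<in> K"
proof -
  assume fh: "f \<in> K" "h \<in> K"
  let ?M = "max (degree (th f)) (degree (th h))"
  have "degree (th (f + h)) \<le> ?M" by (simp add: th.hom_add degree_add_le_max)
  moreover have "hom ?M (f + h) = hom ?M f + hom ?M h" by (simp add: hom_def th.hom_add homogenized_add)
  ultimately show ?thesis using fh mem_K[of f ?M] mem_K[of h ?M] mem_K[of "f + h" ?M]
    by (simp add: gen_ideal_add)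
qed

lemma hom_mult: "hom (degree (th f) + degree (th h)) (f * h) = hom (degree (th f)) f * hom (degree (th h)) h"
  unfolding hom_def th.hom_mult by (rule homogenized_mult) simp_all

lemma K_mult_iff: "f * h \<in> K \<longleftrightarrow> f \<in> K \<or> h \<in> K"
proof -
  have "f * h \<in> K \<longleftrightarrow> hom (degree (th f) + degree (th h)) (f * h) \<in> N"
    by (rule mem_K) (simp add: th.hom_mult degree_mult_le)
  also have "\<dots> \<longleftrightarrow> f \<in> K \<or> h \<in> K"
    using N_prime gen_ideal_mult gen_ideal_mult'
    unfolding hom_mult prime_set_def K_def by blast
  finally show ?thesis .
qed

lemma K_prime: "prime_set K"
proof -
  have "1 \<notin> K" using N_prime by (simp add: K_def hom_def homogenized_def prime_set_def)
  then show ?thesis unfolding prime_set_def using K_mult_iff by blast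
qed

text \<open>The substitution sends \<open>g\<close> to 0, hence \<open>q * f\<close> into
  \<open>N\<close>; and \<open>q\<close> can be cancelled since \<open>N\<close> is prime and omits
  it.\<close>

lemma K_exchange:
  assumes "q * f - h * g \<in> N"
  shows "f \<in> K"
proof -
  \<comment> \<open>The exponent used below is \<open>m + 1\<close>, since \<open>g\<close> has
    degree 1 in the corner entry.\<close>
  define m where "m = max (degree (th f)) (degree (th h))"
  have "hom (m + 1) (h * g) = 0"
  proof -
    have "hom (m + 1) (h * g) = hom m h * hom 1 g"
      unfolding hom_def th.hom_mult by (rule homogenized_mult) (simp_all add: m_def th_g)
    moreover have "hom 1 g = 0"
      unfolding hom_def th_g by (simp add: homogenized_def)
    ultimately show ?thesis by simp
  qed
  moreover have "hom (m + 1) (q * f) = q * hom (m + 1) f"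
    unfolding hom_def th.hom_mult th_q by (simp add: homogenized_smult)
  moreover have "hom (m + 1) (q * f) = hom (m + 1) (q * f - h * g) + hom (m + 1) (h * g)"
    unfolding hom_def homogenized_add[symmetric] th.hom_add[symmetric] by simp
  moreover have "hom (m + 1) (q * f - h * g) \<in> N"
    unfolding hom_def homogenized_def
    by (intro gen_ideal_sum gen_ideal_mult' coeff_th_N assms)
  ultimately have "q * hom (m + 1) f \<in> N" by simp
  then have "hom (m + 1) f \<in> N" using N_prime q_notin_N unfolding prime_set_def by blast
  then show ?thesis using mem_K[of f "m + 1"] by (simp add: m_def)
qed

lemma gen_ideal_K: "G \<subseteq> K \<Longrightarrow> gen_ideal G \<subseteq> K"
proof
  fix x assume G: "G \<subseteq> K" and "x \<in> gen_ideal G"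
  from this(2) show "x \<in> K"
  proof (induction rule: gen_ideal_induct)
    case zero
    show ?case by (rule N_subset_K) (rule gen_ideal_0)
  next
    case (step s h x)
    have "s * h \<in> K" using G step.hyps(1) K_mult_iff by blast
    then show ?case using step.IH K_add by blast
  qed
qed

lemma ideal_subset_K: "block_ideal L U \<subseteq> K"
proof (rule gen_ideal_K, rule subsetI)
  fix x :: "'k mpol" assume "x \<in> minor_gens L U"
  then have "x \<in> gen_ideal (N \<union> {cmin A B | A B. corner_block A B})" by (rule minor_gens_cases)
  moreover have "cmin A B \<in> K" if "corner_block A B" for A B
    using cmin_exchange[OF that Z_block, where 'k = 'k] by (intro K_exchange) (simp add: q_def g_def)
  ultimately show "x \<in> K" using gen_ideal_K[of "N \<union> {cmin A B | A B. corner_block A B}"] N_subset_K by blast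
qed

text \<open>Replacing the last entry \<open>(a, b)\<close> of \<open>Z\<close> by
  \<open>(a, c)\<close> and \<open>(d, b)\<close> gives a permutation matrix on the block of
  \<open>g\<close> that avoids the corner, so \<open>r\<close> takes the value 1 or -1 there. A
  condition of \<open>Udel\<close> sees at most as many of its ones as of the entries of the face
  \<open>Z\<close>, and the extra condition of \<open>Ulink\<close> sees only \<open>Y\<close>, that
  is, at most \<open>t - 2\<close> ones.\<close>

lemma r_notin_link:
  assumes t2: "2 \<le> t"
  shows "r \<notin> block_ideal L' Ulink"
proof
  assume "r \<in> block_ideal L' Ulink"
  have "Z \<noteq> []" using Z(3) t2 by auto
  then obtain Y a b where Zs: "Z = Y @ [(a, b)]" by (metis prod.collapse rev_exhaust)
  define W where "W = Y @ [(a, c), (d, b)]"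
  have ab: "a < d" "c < b" "(a, b) \<in> L'" using Z(2) Zs by (auto simp: strict_block_def mem_L')
  have Y: "fst e < d" "c < snd e" if "e \<in> set Y" for e
    using that Z(2) Zs by (auto simp: strict_block_def)
  have dist: "distinct (map fst W)" "distinct (map snd W)"
    using chain_distinct[OF Z(1)] Y ab by (auto simp: Zs W_def)
  have y: "(d, c) \<notin> set W" using Y(1)[of "(d, c)"] ab by (auto simp: W_def)
  have "ev (set W) r = ev (set W) g"
  proof -
    interpret comm_ring_hom "ev (set W) :: 'k mpol \<Rightarrow> 'k" by (rule ev_hom)
    show ?thesis using y by (simp add: r_def hom_minus hom_mult ev_var)
  qed
  moreover have "g = minor (map fst W) (map snd W) \<or> g = - minor (map fst W) (map snd W)"
    unfolding g_def minor_eq_gminor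
    by (rule gminor_permute) (simp_all add: Zs W_def)
  moreover have "ev (set W) (minor (map fst W) (map snd W)) = (1 :: 'k)" by (rule ev_minor_eq_1[OF dist])
  ultimately have "ev (set W) r \<noteq> 0"
  proof -
    interpret comm_ring_hom "ev (set W) :: 'k mpol \<Rightarrow> 'k" by (rule ev_hom)
    show ?thesis using \<open>ev (set W) r = ev (set W) g\<close> \<open>g = _ \<or> g = _\<close>
      \<open>ev (set W) (minor (map fst W) (map snd W)) = (1 :: 'k)\<close> by (auto simp: hom_uminus)
  qed
  moreover have "ev (set W) r = 0"
  proof (rule ev_ideal_eq_0[OF \<open>r \<in> _\<close>])
    fix u s assume us: "(u, s) \<in> Ulink"
    have uL: "u \<in> L'" using good_Ulink[OF t2] us by (auto simp: good_conditions_def)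
    show "card (set W \<inter> subladder L' u) < s"
    proof (cases "(u, s) \<in> Udel")
      case False
      then have u: "u = (d - 1, c + 1)" "s = t - 1" using us by (auto simp: Ulink_def)
      have "set W \<inter> subladder L' u \<subseteq> set Y" using u(1) ab d_pos by (auto simp: W_def mem_subladder)
      then have "card (set W \<inter> subladder L' u) \<le> length Y"
        using card_mono[of "set Y"] card_length[of Y] by (meson List.finite_set le_trans)
      then show ?thesis using Zs Z(3) u(2) t2 by simp
    next
      case True
      \<comment> \<open>A corner \<open>u\<close> whose subladder holds both entries would be weakly
        south-west of \<open>(d, c)\<close>, hence equal to it, but it lies in
        \<open>L'\<close>.\<close>
      have both: "\<not> ((a, c) \<in> subladder L' u \<and> (d, b) \<in> subladder L' u)"
        using uL corner[of u] by (auto simp: mem_subladder mem_L')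
      have one: "(a, b) \<in> subladder L' u" if "(a, c) \<in> subladder L' u \<or> (d, b) \<in> subladder L' u"
        using that ab by (auto simp: mem_subladder)
      have "(a, b) \<notin> set Y" using chain_distinct[OF Z(1)] Zs by auto
      let ?Y = "set Y \<inter> subladder L' u"
      have "card (set W \<inter> subladder L' u) \<le> card (set Z \<inter> subladder L' u)"
      proof (cases "(a, c) \<in> subladder L' u \<or> (d, b) \<in> subladder L' u")
        case True
        have "set Z \<inter> subladder L' u = insert (a, b) ?Y" using one[OF True] by (auto simp: Zs)
        then have "card (set Z \<inter> subladder L' u) = Suc (card ?Y)" using \<open>(a, b) \<notin> set Y\<close> by simp
        moreover obtain e where "set W \<inter> subladder L' u \<subseteq> insert e ?Y" using both by (auto simp: W_def)
        then have "card (set W \<inter> subladder L' u) \<le> card (insert e ?Y)" by (intro card_mono) auto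
        ultimately show ?thesis using card_insert_le_m1[of "Suc (card ?Y)" ?Y e] by simp
      next
        case False
        then show ?thesis by (intro card_mono) (auto simp: W_def Zs)
      qed
      also have "\<dots> < s" by (rule face_card[OF Z(4,1) True])
      finally show ?thesis .
    qed
  qed simp
  ultimately show False by simp
qed

lemma q_in_link: "2 \<le> t \<Longrightarrow> q \<in> block_ideal L' Ulink"
proof -
  assume t2: "2 \<le> t"
  then have "Z \<noteq> []" using Z(3) by auto
  then have h: "hd Z \<in> set Z" by simp
  then have "hd Z \<in> L" "fst (hd Z) < d" "c < snd (hd Z)" using Z(2) by (auto simp: strict_block_def)
  then have "(d - 1, c + 1) \<in> L"
    using ladder_convexD[OF convex _ yL, of "fst (hd Z)" "snd (hd Z)" "d - 1" "c + 1"] by auto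
  then have "((d - 1, c + 1), t - 1) \<in> Ulink" by (simp add: Ulink_def)
  moreover have "set Z \<subseteq> subladder L' (d - 1, c + 1)"
    using Z(2) by (fastforce simp: strict_block_def mem_subladder mem_L')
  then have "set (map fst Z) \<times> set (map snd Z) \<subseteq> subladder L' (d - 1, c + 1)"
    by (rule chain_block[OF convex' Z(1)])
  ultimately show ?thesis
    unfolding q_def by (intro minor_in_block_ideal[of _ "t - 1"]) (simp_all add: Z(3))
qed

lemma N_subset_link: "N \<subseteq> block_ideal L' Ulink"
  by (rule gen_ideal_mono) (auto simp: minor_gens_def Ulink_def)

text \<open>Modulo the link ideal \<open>q\<close> vanishes, so \<open>hom n f\<close> becomes the
  top coefficient \<open>p\<close> times a power of \<open>- r\<close>. That ideal is prime and
  omits \<open>r\<close>, so it contains \<open>p\<close>, whose monomials are faces of the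
  link.\<close>

lemma K_standard:
  assumes N_std: "\<And>f :: 'k mpol. f \<in> N \<Longrightarrow> (\<And>m. m \<in> keys f \<Longrightarrow> face L' Udel (keys m)) \<Longrightarrow> f = 0"
    and C_std: "\<And>f :: 'k mpol. 2 \<le> t \<Longrightarrow> f \<in> block_ideal L' Ulink \<Longrightarrow>
      (\<And>m. m \<in> keys f \<Longrightarrow> face L' Ulink (keys m)) \<Longrightarrow> f = 0"
    and C_prime: "2 \<le> t \<Longrightarrow> prime_set (block_ideal L' Ulink :: 'k mpol set)"
    and f: "f \<in> K" "\<And>m. m \<in> keys f \<Longrightarrow> face L U (keys m)"
  shows "f = 0"
proof (cases "degree (th f) = 0")
  case True
  then have "hom 0 f = coeff (th f) 0" by (simp add: hom_def homogenized_def)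
  moreover have "th f = [:coeff (th f) 0:]" using True by (metis degree_eq_zeroE coeff_pCons_0)
  then have "poly (th f) (var (d, c)) = coeff (th f) 0" by (metis poly_pCons poly_0 mult_zero_right add_0_right)
  then have "f = coeff (th f) 0" using poly_var_poly[of "(d, c)" f] by simp
  ultimately have "f \<in> N" using f(1) True by (simp add: K_def)
  then show ?thesis using N_std f(2) face_Udel by blast
next
  case False
  define n where "n = degree (th f)"
  define p where "p = coeff (th f) n"
  have p0: "p \<noteq> 0" unfolding p_def n_def using False by auto
  have key: "face L U (insert (d, c) (keys m))" if "m \<in> keys p" for m
  proof -
    have "m + single (d, c) n \<in> keys f" using keys_coeff_var_poly[of m "(d, c)" f n] that by (simp add: p_def)
    from f(2)[OF this] show ?thesis using False by (simp add: keys_add_nat n_def)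
  qed
  have False
  proof (cases "t = 1")
    \<comment> \<open>Here the corner alone is a forbidden chain, so no monomial of \<open>f\<close>
      involves it. The case is separate because \<open>Ulink\<close> would contain a condition of
      size 0.\<close>
    case True
    obtain m where "m \<in> keys p" using p0 by (metis keys_eq_empty ex_in_conv)
    from faceD[OF key[OF this] yt, of "[(d, c)]"] yL True show False by (auto simp: mem_subladder)
  next
    case False
    then have t2: "2 \<le> t" using t_pos by simp
    let ?C = "block_ideal L' Ulink :: 'k mpol set"
    let ?S = "\<Sum>k<n. coeff (th f) k * (- r) ^ k * q ^ (n - k)"
    have h: "hom n f \<in> ?C" using f(1) N_subset_link by (auto simp: K_def n_def)
    have eq: "hom n f = ?S + p * (- r) ^ n"
      by (simp add: hom_def homogenized_def lessThan_Suc_atMost[symmetric] p_def)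
    have S: "?S \<in> ?C"
    proof (rule gen_ideal_sum, rule gen_ideal_mult)
      fix k assume "k \<in> {..<n}"
      then obtain j where "n - k = Suc j" by (metis Suc_diff_Suc lessThan_iff)
      then show "q ^ (n - k) \<in> ?C" using q_in_link[OF t2] by (simp add: gen_ideal_mult')
    qed
    have "p * (- r) ^ n \<in> ?C"
      using gen_ideal_diff[OF h S] unfolding eq by simp
    moreover have "(- r) ^ n \<notin> ?C"
      using prime_set_power[OF C_prime[OF t2], of "- r" n] r_notin_link[OF t2] by auto
    ultimately have "p \<in> ?C" using C_prime[OF t2] unfolding prime_set_def by blast
    then have "p = 0" using C_std[OF t2] face_Ulink key by blast
    then show False using p0 by simp
  qed
  then show ?thesis ..
qed

end

text \<open>The assumption \<open>span\<close> is division by leading monomials, stated abstractly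
  so that the induction itself is free of term orders; \<open>L0\<close> is the ladder on which such
  an order is given.\<close>

theorem block_ideal_prime_standard:
  fixes L0 :: "(nat \<times> nat) set" and ty :: "'k::field itself"
  assumes span: "\<And>L U (f :: 'k mpol). good_conditions L U \<Longrightarrow> L \<subseteq> L0 \<Longrightarrow>
      \<exists>g. f - g \<in> block_ideal L U \<and> (\<forall>m\<in>keys g. face L U (keys m))"
  shows "good_conditions L U \<Longrightarrow> L \<subseteq> L0 \<Longrightarrow>
    prime_set (block_ideal L U :: 'k mpol set) \<and>
    (\<forall>f :: 'k mpol. f \<in> block_ideal L U \<longrightarrow> (\<forall>m\<in>keys f. face L U (keys m)) \<longrightarrow> f = 0)"
proof (induction "card L" arbitrary: L U rule: less_induct)
  case less
  have fin: "finite L" using less.prems(1) by (simp add: good_conditions_def)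
  show ?case
  proof (cases "U = {}")
    case True
    have "x = 0" if "x \<in> (block_ideal L U :: 'k mpol set)" for x
      using that by (induction rule: gen_ideal_induct) (simp_all add: True minor_gens_def)
    then have "block_ideal L U = ({0} :: 'k mpol set)" using gen_ideal_0 by blast
    then show ?thesis by (simp add: prime_set_def)
  next
    case False
    have "L \<noteq> {}" using False less.prems(1) by (auto simp: good_conditions_def)
    \<comment> \<open>An entry that maximises row minus column has no other entry weakly south-west
      of it.\<close>
    let ?h = "\<lambda>e. int (fst e) - int (snd e)"
    have "Max (?h ` L) \<in> ?h ` L" using fin \<open>L \<noteq> {}\<close> by (intro Max_in) auto
    then obtain y where y0: "y \<in> L" "Max (?h ` L) = ?h y" by blast
    have y: "?h e \<le> ?h y" if "e \<in> L" for e
      unfolding y0(2)[symmetric] using fin that by (intro Max_ge) auto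
    obtain d c where dc: "y = (d, c)" by (cases y)
    have corner: "e = (d, c)" if "e \<in> L" "d \<le> fst e" "snd e \<le> c" for e
      using y[OF that(1)] that(2,3) by (simp add: dc prod_eq_iff)
    have card: "card (L - {(d, c)}) < card L" using y0(1) fin dc by (metis card_Diff1_less)
    show ?thesis
    proof (cases "\<exists>s. ((d, c), s) \<in> U")
      case False
      have no: "(d, c) \<notin> subladder L u" if "(u, s) \<in> U" for u s
      proof
        assume "(d, c) \<in> subladder L u"
        moreover have "u \<in> L" using that less.prems(1) unfolding good_conditions_def by blast
        ultimately have "u = (d, c)" using corner[of u] by (simp add: mem_subladder)
        then show False using that False by blast
      qed
      then have eq: "subladder (L - {(d, c)}) u = subladder L u" if "(u, s) \<in> U" for u s
        using no[OF that] by (auto simp: subladder_def)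
      have gens: "minor_gens (L - {(d, c)}) U = (minor_gens L U :: 'k mpol set)"
        unfolding minor_gens_def by (intro Collect_cong ex_cong1 conj_cong refl) (simp add: eq)
      have faces: "face (L - {(d, c)}) U F = face L U F" for F
        unfolding face_def by (intro ball_cong refl) (auto simp: eq)
      have "good_conditions (L - {(d, c)}) U"
      proof -
        have "ladder_convex (L - {(d, c)})"
          unfolding ladder_convex_def
        proof (intro allI impI subsetI)
          fix i j i' j' e
          assume *: "(i, j) \<in> L - {(d, c)} \<and> (i', j') \<in> L - {(d, c)} \<and> i \<le> i' \<and> j' \<le> j" "e \<in> {i..i'} \<times> {j'..j}"
          have "ladder_convex L" using less.prems(1) by (simp add: good_conditions_def)
          then have "e \<in> L" using ladder_convexD[of L i j i' j' "fst e" "snd e"] * by auto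
          moreover have "e \<noteq> (d, c)" using * corner[of "(i', j')"] by auto
          ultimately show "e \<in> L - {(d, c)}" by blast
        qed
        moreover have "\<forall>(u, s)\<in>U. u \<in> L - {(d, c)} \<and> 0 < s"
          using less.prems(1) False unfolding good_conditions_def by fast
        ultimately show ?thesis using less.prems(1) unfolding good_conditions_def by (simp add: image_iff)
      qed
      then show ?thesis using less.hyps[OF card, of U] less.prems(2) by (simp add: gens faces subset_iff)
    next
      case True
      define t where "t = (LEAST s. ((d, c), s) \<in> U)"
      have t: "((d, c), t) \<in> U" "\<And>s. ((d, c), s) \<in> U \<Longrightarrow> t \<le> s"
        unfolding t_def by (rule LeastI_ex[OF True], rule Least_le)
      interpret corner_removal L U d c t
        by unfold_locales (fact less.prems(1), use y0(1) dc in simp, fact corner, fact t(1), fact t(2))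
      have L'L: "L' \<subseteq> L0" "card L' < card L" using card less.prems(2) by (auto simp: L'_def)
      note IHN = less.hyps[OF L'L(2) good_Udel L'L(1)]
      note IHC = less.hyps[OF L'L(2) good_Ulink L'L(1)]
      show ?thesis
      proof (cases "\<exists>Z. chain Z \<and> set Z \<subseteq> strict_block \<and> length Z = t - 1 \<and> face L' Udel (set Z)")
        case False
        then have "block_ideal L U = (block_ideal L' Udel :: 'k mpol set)"
          using ideal_eq_if_nonfaces by blast
        then show ?thesis using IHN face_Udel by simp
      next
        case True
        then obtain Z where Z: "chain Z" "set Z \<subseteq> strict_block" "length Z = t - 1" "face L' Udel (set Z)"
          by blast
        interpret corner_removal_face L U d c t Z "TYPE('k)"
          by unfold_locales (use Z IHN in simp_all)
        have std: "f = 0" if "f \<in> K" "\<forall>m\<in>keys f. face L U (keys m)" for f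
          by (rule K_standard) (use that IHN IHC in blast)+
        \<comment> \<open>Modulo the ideal, which is part of \<open>K\<close>, an element of
          \<open>K\<close> is a combination of faces that again lies in \<open>K\<close>, hence
          0.\<close>
        have "K \<subseteq> block_ideal L U"
        proof
          fix f assume "f \<in> K"
          obtain h where h: "f - h \<in> block_ideal L U" "\<forall>m\<in>keys h. face L U (keys m)"
            using span[OF less.prems, of f] by blast
          have "- (f - h) \<in> K" using h(1) ideal_subset_K K_mult_iff[of "- 1" "f - h"] by auto
          from K_add[OF this \<open>f \<in> K\<close>] have "h \<in> K" by simp
          then have "h = 0" using std h(2) by blast
          then show "f \<in> block_ideal L U" using h(1) by simp
        qed
        then have "block_ideal L U = K" using ideal_subset_K by blast
        then show ?thesis using K_prime std by simp
      qed
    qed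
  qed
qed

section \<open>Antidiagonal term orders and initial ideals\<close>

text \<open>Used both for the antidiagonal of a chain and, by \<open>cmono_list\<close>, for writing
  arbitrary monomials as lists in inductions.\<close>

definition cmono :: "(nat \<times> nat) list \<Rightarrow> monomial" where
  "cmono c = (\<Sum>e\<leftarrow>c. single e 1)"

lemma cmono_Nil [simp]: "cmono [] = 0" and cmono_Cons: "cmono (e # c) = single e 1 + cmono c"
  and cmono_append: "cmono (c @ c') = cmono c + cmono c'"
  by (simp_all add: cmono_def)

lemma lookup_cmono: "lookup (cmono c) e = count_list c e"
  by (induction c) (auto simp: cmono_Cons lookup_add lookup_single when_def)

lemma keys_cmono: "keys (cmono c) = set c"
  by (auto simp: in_keys_iff lookup_cmono count_list_0_iff)

lemma cmono_divides:
  assumes "distinct c" "set c \<subseteq> keys m"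
  obtains m' where "m = m' + cmono c"
proof
  show "m = (m - cmono c) + cmono c"
  proof (rule poly_mapping_eqI)
    fix e
    have "count_list c e \<le> lookup m e"
    proof (cases "e \<in> set c")
      case True
      then have "0 < lookup m e" using assms(2) by (auto simp: in_keys_iff)
      moreover have "count_list c e \<le> 1" using assms(1) by (induction c) (auto simp: count_list_0_iff)
      ultimately show ?thesis by simp
    qed (simp add: count_list_0_iff[THEN iffD2])
    then show "lookup m e = lookup (m - cmono c + cmono c) e"
      by (simp add: lookup_add lookup_minus lookup_cmono)
  qed
qed

abbreviation cminor :: "(nat \<times> nat) list \<Rightarrow> 'k::comm_ring_1 mpol" where
  "cminor c \<equiv> minor (map fst c) (map snd c)"

definition mdeg :: "monomial \<Rightarrow> nat" where
  "mdeg m = (\<Sum>e\<in>keys m. lookup m e)"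

lemma mdeg_add: "mdeg (m + n) = mdeg m + mdeg n"
  unfolding mdeg_def by (rule setsum_keys_plus_distrib) simp_all

lemma mdeg_0 [simp]: "mdeg 0 = 0" and mdeg_single [simp]: "mdeg (single e k) = k"
  by (simp_all add: mdeg_def)

lemma mdeg_sum: "finite A \<Longrightarrow> mdeg (\<Sum>a\<in>A. f a) = (\<Sum>a\<in>A. mdeg (f a))"
  by (induction A rule: finite_induct) (simp_all add: mdeg_add)

lemma mdeg_cmono: "mdeg (cmono c) = length c"
  by (induction c) (simp_all add: cmono_Cons mdeg_add)

lemma prod_var: "finite A \<Longrightarrow> (\<Prod>a\<in>A. var (f a)) = (single (\<Sum>a\<in>A. single (f a) 1) 1 :: 'k::comm_ring_1 mpol)"
  by (induction A rule: finite_induct) (simp_all add: var_def mult_single)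

lemma permutes_atLeastLessThan: "p permutes {0..<n} \<Longrightarrow> i < n \<Longrightarrow> p i < n" for n :: nat
  using permutes_in_image[of p "{0..<n}" i] by simp

text \<open>Read off from the Leibniz formula. Homogeneity is what keeps the later division inside
  one degree.\<close>

lemma keys_minor:
  assumes "m \<in> keys (minor rs cs :: 'k::comm_ring_1 mpol)" "length cs = length rs"
  shows "mdeg m = length rs \<and> keys m \<subseteq> set rs \<times> set cs"
proof -
  let ?n = "length rs"
  let ?mon = "\<lambda>p. \<Sum>i = 0..<?n. single (rs ! i, cs ! p i) 1"
  have "minor rs cs = (\<Sum>p | p permutes {0..<?n}. signof p * (\<Prod>i = 0..<?n. var (rs ! i, cs ! p i)) :: 'k mpol)"
    unfolding minor_def
    by (subst det_def'[of _ ?n]) (auto intro!: sum.cong prod.cong simp: permutes_atLeastLessThan)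
  also have "\<dots> = (\<Sum>p | p permutes {0..<?n}. signof p * single (?mon p) 1)"
    by (simp only: prod_var[OF finite_atLeastLessThan])
  finally have "m \<in> (\<Union>p\<in>{p. p permutes {0..<?n}}. keys (signof p * single (?mon p) (1::'k)))"
    using assms(1) keys_sum by fastforce
  then obtain p where p: "p permutes {0..<?n}" "m \<in> keys (signof p * single (?mon p) (1::'k))" by blast
  have "m = ?mon p" using p(2) by (auto simp: sign_def single_uminus[symmetric] split: if_splits)
  moreover have "p i < ?n" if "i < ?n" for i using p(1) that by (simp add: permutes_atLeastLessThan)
  ultimately show ?thesis using assms(2) by (auto simp: mdeg_sum keys_sum_nat)
qed

locale antidiagonal =
  fixes L :: "(nat \<times> nat) set" and ord :: "monomial rel" and ty :: "'k::field itself"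
  assumes order: "antidiagonal_order TYPE('k) L ord"
    and finL: "finite L" and convL: "ladder_convex L"
begin

abbreviation le :: "monomial \<Rightarrow> monomial \<Rightarrow> bool" (infix "\<preceq>" 50) where "m \<preceq> n \<equiv> (m, n) \<in> ord"

abbreviation R :: "'k mpol set" where "R \<equiv> {f. keys f \<subseteq> monomials L}"

lemma monomials_add: "m + n \<in> monomials L \<longleftrightarrow> m \<in> monomials L \<and> n \<in> monomials L"
  by (auto simp: monomials_def keys_add_nat)

lemma term_order: "term_order L ord"
  using order by (simp add: antidiagonal_order_def)

lemma linear: "linear_order_on (monomials L) ord"
  using term_order unfolding term_order_def by (rule conjunct1)

lemma le_refl: "m \<in> monomials L \<Longrightarrow> m \<preceq> m"
  using linear unfolding linear_order_on_def partial_order_on_def preorder_on_def refl_on_def by (elim conjE) (rule bspec)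

lemma le_mem: "m \<preceq> n \<Longrightarrow> m \<in> monomials L \<and> n \<in> monomials L"
  using linear unfolding linear_order_on_def partial_order_on_def preorder_on_def by auto

lemma le_trans: "m \<preceq> n \<Longrightarrow> n \<preceq> k \<Longrightarrow> m \<preceq> k"
  using linear unfolding linear_order_on_def partial_order_on_def preorder_on_def by (elim conjE) (rule transD)

lemma le_antisym: "m \<preceq> n \<Longrightarrow> n \<preceq> m \<Longrightarrow> m = n"
  using linear unfolding linear_order_on_def partial_order_on_def by (elim conjE) (rule antisymD)

lemma le_total: "m \<in> monomials L \<Longrightarrow> n \<in> monomials L \<Longrightarrow> m \<preceq> n \<or> n \<preceq> m"
  using linear le_refl[of m] unfolding linear_order_on_def total_on_def by (cases "m = n") auto

lemma le_add: "m \<preceq> n \<Longrightarrow> k \<in> monomials L \<Longrightarrow> m + k \<preceq> n + k"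
  using term_order unfolding term_order_def by (elim conjE) simp

lemma le_add_cancel:
  assumes "m + k \<preceq> n + k"
  shows "m \<preceq> n"
proof -
  have mem: "m \<in> monomials L" "n \<in> monomials L" "k \<in> monomials L"
    using le_mem[OF assms] by (simp_all add: monomials_add)
  show ?thesis
  proof (rule ccontr)
    assume no: "\<not> m \<preceq> n"
    then have "n \<preceq> m" using le_total mem by blast
    then have "m + k = n + k" using le_antisym[OF assms le_add] mem by blast
    then show False using no le_refl mem by simp
  qed
qed

lemma ex_max: "finite A \<Longrightarrow> A \<noteq> {} \<Longrightarrow> A \<subseteq> monomials L \<Longrightarrow> \<exists>m\<in>A. \<forall>n\<in>A. n \<preceq> m"
proof (induction A rule: finite_ne_induct)
  case (singleton x)
  then show ?case using le_refl by blast
next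
  case (insert x A)
  then obtain m where m: "m \<in> A" "\<forall>n\<in>A. n \<preceq> m" by blast
  have "x \<preceq> m \<or> m \<preceq> x" using le_total insert.prems m(1) by blast
  then show ?case
  proof
    assume "m \<preceq> x"
    then have "\<forall>n\<in>insert x A. n \<preceq> x" using m(2) le_trans le_refl insert.prems by blast
    then show ?thesis by blast
  qed (use m in blast)
qed

abbreviation lead :: "'k mpol \<Rightarrow> monomial" where "lead \<equiv> lead_monomial ord"

lemma lead_eqI: "m \<in> keys f \<Longrightarrow> (\<And>n. n \<in> keys f \<Longrightarrow> n \<preceq> m) \<Longrightarrow> lead f = m" for f :: "'k mpol"
  unfolding lead_monomial_def by (rule the_equality) (auto intro: le_antisym)

lemma lead_in_keys: "f \<in> R \<Longrightarrow> f \<noteq> 0 \<Longrightarrow> lead f \<in> keys f"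
  and lead_max: "f \<in> R \<Longrightarrow> f \<noteq> 0 \<Longrightarrow> n \<in> keys f \<Longrightarrow> n \<preceq> lead f" for f :: "'k mpol"
proof -
  assume f: "f \<in> R" "f \<noteq> 0"
  then obtain m where m: "m \<in> keys f" "\<forall>n\<in>keys f. n \<preceq> m" using ex_max[of "keys f"] by auto
  then have "lead f = m" by (intro lead_eqI) auto
  then show "lead f \<in> keys f" "n \<in> keys f \<Longrightarrow> n \<preceq> lead f" using m by auto
qed

lemma R_mult: "f \<in> R \<Longrightarrow> g \<in> R \<Longrightarrow> f * g \<in> R" for f g :: "'k mpol"
  using keys_mult[of f g] by (force simp: monomials_add)

lemma R_add: "f \<in> R \<Longrightarrow> g \<in> R \<Longrightarrow> f + g \<in> R" for f g :: "'k mpol"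
  using keys_add[of f g] by blast

lemma R_uminus: "f \<in> R \<Longrightarrow> - f \<in> R" for f :: "'k mpol"
  by (simp add: subset_iff in_keys_iff)

lemma R_1: "(1 :: 'k mpol) \<in> R"
  by (simp add: monomials_def)

lemma R_single: "m \<in> monomials L \<Longrightarrow> single m c \<in> R" for c :: 'k
  by simp

lemma R_power: "f \<in> R \<Longrightarrow> f ^ n \<in> R" for f :: "'k mpol"
  by (induction n) (use R_1 R_mult in auto)

text \<open>Only the product of the two leading terms contributes to the sum of the leading
  monomials; all other products are strictly smaller.\<close>

lemma lead_mult:
  fixes f g :: "'k mpol"
  assumes "f \<in> R" "g \<in> R" "f \<noteq> 0" "g \<noteq> 0"
  shows "lead (f * g) = lead f + lead g"
proof -
  define a b where "a = lead f" and "b = lead g"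
  have a: "a \<in> keys f" "\<And>n. n \<in> keys f \<Longrightarrow> n \<preceq> a" and b: "b \<in> keys g" "\<And>n. n \<in> keys g \<Longrightarrow> n \<preceq> b"
    using assms lead_in_keys lead_max by (auto simp: a_def b_def)
  have mem: "a \<in> monomials L" "b \<in> monomials L" using a(1) b(1) assms by auto
  define f' where "f' = f - single a (lookup f a)"
  define g' where "g' = g - single b (lookup g b)"
  have f'k: "n \<in> keys f \<and> n \<noteq> a" if "n \<in> keys f'" for n
    using that by (auto simp: f'_def in_keys_iff lookup_minus lookup_single when_def split: if_splits)
  have g'k: "n \<in> keys g \<and> n \<noteq> b" if "n \<in> keys g'" for n
    using that by (auto simp: g'_def in_keys_iff lookup_minus lookup_single when_def split: if_splits)
  have "f * g = single (a + b) (lookup f a * lookup g b) + (single a (lookup f a) * g' + f' * g)"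
    unfolding mult_single[symmetric] f'_def g'_def by (simp only: algebra_simps)
  moreover have "a + b \<notin> keys (single a (lookup f a) * g' + f' * g)"
  proof
    assume "a + b \<in> keys (single a (lookup f a) * g' + f' * g)"
    then have "a + b \<in> keys (single a (lookup f a) * g') \<or> a + b \<in> keys (f' * g)"
      using keys_add[of "single a (lookup f a) * g'" "f' * g"] by blast
    then show False
    proof
      assume "a + b \<in> keys (single a (lookup f a) * g')"
      then obtain n where n: "n \<in> keys g'" "a + b = n + a"
        using keys_mult_single[of a "lookup f a" g'] by blast
      have "n = b" using n(2) by (simp add: add.commute[of n a])
      then show False using g'k[OF n(1)] by simp
    next
      assume "a + b \<in> keys (f' * g)"
      then obtain x y where xy: "x \<in> keys f'" "y \<in> keys g" "a + b = x + y" using keys_mult[of f' g] by blast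
      have "y \<in> monomials L" using xy(2) assms(2) by auto
      have "x \<preceq> a" "y \<preceq> b" using xy a b f'k by auto
      have "a + b \<preceq> a + y"
        using le_add[OF \<open>x \<preceq> a\<close> \<open>y \<in> monomials L\<close>] xy(3) by simp
      then have "b \<preceq> y" using le_add_cancel[of b a y] by (simp add: add.commute)
      then have "y = b" using le_antisym \<open>y \<preceq> b\<close> by blast
      then show False using xy f'k by auto
    qed
  qed
  ultimately have "lookup (f * g) (a + b) = lookup f a * lookup g b"
    by (simp add: lookup_add in_keys_iff)
  then have "a + b \<in> keys (f * g)" using a(1) b(1) by (simp add: in_keys_iff)
  moreover have "n \<preceq> a + b" if n: "n \<in> keys (f * g)" for n
  proof -
    obtain x y where xy: "x \<in> keys f" "y \<in> keys g" "n = x + y" using keys_mult[of f g] n by blast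
    have "x + y \<preceq> a + y" by (rule le_add) (use a xy assms(2) in auto)
    moreover have "y + a \<preceq> b + a" by (rule le_add) (use b xy mem in auto)
    ultimately show ?thesis using xy(3) le_trans by (simp add: add.commute)
  qed
  ultimately show ?thesis unfolding a_def b_def by (rule lead_eqI)
qed

lemma lead_single: "m \<in> monomials L \<Longrightarrow> c \<noteq> 0 \<Longrightarrow> lead (single m c) = m" for c :: 'k
  by (rule lead_eqI) (auto intro: le_refl)

lemma cminor_in_R: "set (map fst c) \<times> set (map snd c) \<subseteq> L \<Longrightarrow> (cminor c :: 'k mpol) \<in> R"
  using keys_minor[of _ "map fst c" "map snd c", where 'k = 'k] by (fastforce simp: monomials_def)

lemma cminor_nonzero: "chain c \<Longrightarrow> (cminor c :: 'k mpol) \<noteq> 0"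
proof
  assume c: "chain c" "(cminor c :: 'k mpol) = 0"
  interpret comm_ring_hom "ev (set c) :: 'k mpol \<Rightarrow> 'k" by (rule ev_hom)
  have "ev (set c) (cminor c) = (1 :: 'k)" by (rule ev_minor_eq_1) (use chain_distinct[OF c(1)] in auto)
  then show False using c(2) by simp
qed

lemma chain_block_L: "chain c \<Longrightarrow> set c \<subseteq> L \<Longrightarrow> set (map fst c) \<times> set (map snd c) \<subseteq> L"
proof (cases "c = []")
  case False
  assume c: "chain c" "set c \<subseteq> L"
  \<comment> \<open>The subladder is taken only to apply \<open>chain_block\<close>: the last row of
    the chain bounds the rows, and the column bound 0 is void.\<close>
  let ?u = "(Max (fst ` set c), 0)"
  have "set c \<subseteq> subladder L ?u"
  proof
    fix e assume "e \<in> set c"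
    then show "e \<in> subladder L ?u" using c(2) Max_ge[of "fst ` set c" "fst e"] by (auto simp: mem_subladder)
  qed
  then show ?thesis using chain_block[OF convL c(1), of ?u] subladder_subset by blast
qed simp

lemma cminor_in_R': "chain c \<Longrightarrow> set c \<subseteq> L \<Longrightarrow> (cminor c :: 'k mpol) \<in> R"
  by (rule cminor_in_R[OF chain_block_L])

text \<open>\<open>antidiagonal_order\<close> lists columns increasingly, a chain lists them
  decreasingly. Reversing them changes the minor at most by a sign.\<close>

lemma lead_cminor:
  assumes c: "chain c" "set c \<subseteq> L"
  shows "lead (cminor c) = cmono c"
proof -
  let ?rs = "map fst c" and ?cs = "rev (map snd c)"
  have "minor_in L (length c) ?rs ?cs"
    using chain_rows[OF c(1)] chain_cols[OF c(1)] chain_block_L[OF c]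
    by (simp add: minor_in_def sorted_wrt_rev)
  then have "lead (minor ?rs ?cs :: 'k mpol) = (\<Sum>a<length c. single (?rs ! a, ?cs ! (length c - 1 - a)) 1)"
    using order by (simp add: antidiagonal_order_def)
  also have "\<dots> = (\<Sum>a<length c. single (c ! a) 1)"
    by (rule sum.cong) (auto simp: rev_nth)
  also have "\<dots> = cmono c"
    by (simp add: cmono_def sum_list_sum_nth atLeast0LessThan)
  finally have "lead (minor ?rs ?cs :: 'k mpol) = cmono c" .
  moreover have "cminor c = (minor ?rs ?cs :: 'k mpol) \<or> cminor c = - (minor ?rs ?cs :: 'k mpol)"
    unfolding minor_eq_gminor by (rule gminor_permute) simp_all
  moreover have "lead (- f) = lead f" for f :: "'k mpol"
  proof -
    have "keys (- f) = keys f" by (auto simp: in_keys_iff)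
    then show ?thesis by (simp add: lead_monomial_def)
  qed
  ultimately show ?thesis by auto
qed

lemma cmono_in_monomials: "set c \<subseteq> L \<Longrightarrow> cmono c \<in> monomials L"
  by (simp add: monomials_def keys_cmono)

text \<open>A monomial multiple of the minor of a forbidden chain that divides \<open>m\<close>.
  That it is homogeneous is kept for the termination of the division.\<close>

lemma nonface_element:
  assumes L': "L' \<subseteq> L" "good_conditions L' U" and m: "m \<in> monomials L" "\<not> face L' U (keys m)"
  obtains h :: "'k mpol" where "h \<in> block_ideal L' U" "h \<in> R" "h \<noteq> 0" "lead h = m" "\<And>n. n \<in> keys h \<Longrightarrow> mdeg n = mdeg m"
proof -
  obtain u c where c: "(u, length c) \<in> U" "chain c" "set c \<subseteq> keys m" "set c \<subseteq> subladder L' u"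
    using m(2) by (rule not_faceE)
  obtain m' where m': "m = m' + cmono c" using cmono_divides[of c m] chain_distinct[OF c(2)] c(3) by blast
  have cL: "set c \<subseteq> L" using c(4) L'(1) subladder_subset[of L' u] by blast
  have mm: "m' \<in> monomials L" using m(1) m' by (simp add: monomials_add)
  let ?h = "single m' 1 * cminor c :: 'k mpol"
  have "cminor c \<in> (block_ideal L' U :: 'k mpol set)"
    by (rule minor_in_block_ideal[OF c(1)]) (use chain_block[OF _ c(2,4)] L'(2) in \<open>simp_all add: good_conditions_def\<close>)
  then have "?h \<in> block_ideal L' U" by (rule gen_ideal_mult)
  moreover have "?h \<in> R" using R_mult[OF R_single[OF mm] cminor_in_R'[OF c(2) cL]] .
  moreover have "single m' (1::'k) \<noteq> 0" by (metis lookup_single_eq lookup_zero one_neq_zero)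
  then have "?h \<noteq> 0" using cminor_nonzero[OF c(2)] by simp
  moreover have "lead ?h = m"
    using lead_mult[OF R_single[OF mm] cminor_in_R'[OF c(2) cL] \<open>single m' 1 \<noteq> 0\<close> cminor_nonzero[OF c(2)]]
    by (simp add: lead_single[OF mm] lead_cminor[OF c(2) cL] m')
  moreover have "mdeg n = mdeg m" if n: "n \<in> keys ?h" for n
  proof -
    obtain x where "x \<in> keys (cminor c :: 'k mpol)" "n = x + m'"
      using keys_mult_single[of m' 1 "cminor c :: 'k mpol"] n by blast
    then show ?thesis using keys_minor[of x "map fst c" "map snd c", where 'k = 'k] by (simp add: mdeg_add m' mdeg_cmono)
  qed
  ultimately show ?thesis by (rule that)
qed

text \<open>Division by homogeneous elements stays in one degree, so finiteness of that degree takes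
  the place of a well-foundedness argument.\<close>

lemma finite_degree: "finite {n \<in> monomials L. mdeg n = D}"
proof (rule finite_imageD)
  let ?r = "\<lambda>n. restrict (lookup n) L"
  have "lookup n e \<le> mdeg n" for n e
    by (cases "e \<in> keys n") (auto simp: mdeg_def in_keys_iff intro!: member_le_sum)
  then have "?r ` {n \<in> monomials L. mdeg n = D} \<subseteq> PiE L (\<lambda>_. {..D})" by auto
  then show "finite (?r ` {n \<in> monomials L. mdeg n = D})"
    by (rule finite_subset) (auto intro: finite_PiE finL)
  show "inj_on ?r {n \<in> monomials L. mdeg n = D}"
  proof (rule inj_onI, rule poly_mapping_eqI)
    fix m n e assume *: "m \<in> {n \<in> monomials L. mdeg n = D}" "n \<in> {n \<in> monomials L. mdeg n = D}" "?r m = ?r n"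
    show "lookup m e = lookup n e"
    proof (cases "e \<in> L")
      case True
      then show ?thesis using fun_cong[OF *(3), of e] by simp
    next
      case False
      then have "e \<notin> keys m" "e \<notin> keys n" using * by (auto simp: monomials_def)
      then show ?thesis by (simp add: in_keys_iff)
    qed
  qed
qed

text \<open>Subtracting a multiple of a \<open>nonface_element\<close> with leading monomial
  \<open>m\<close> leaves smaller monomials of the same degree, to which the induction applies. The
  bound by \<open>m\<close> is recorded for \<open>lead_nonface\<close>.\<close>

lemma reduce_monomial:
  assumes L': "L' \<subseteq> L" "good_conditions L' U"
  shows "m \<in> monomials L \<Longrightarrow> \<exists>g :: 'k mpol. single m 1 - g \<in> block_ideal L' U \<and>
    (\<forall>n\<in>keys g. face L' U (keys n) \<and> n \<preceq> m)"
proof (induction "card {n \<in> monomials L. mdeg n = mdeg m \<and> n \<preceq> m \<and> n \<noteq> m}" arbitrary: m rule: less_induct)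
  case less
  show ?case
  proof (cases "face L' U (keys m)")
    case True
    then show ?thesis using le_refl[OF less.prems] gen_ideal_0 by (intro exI[of _ "single m 1"]) auto
  next
    case False
    obtain h :: "'k mpol" where h: "h \<in> block_ideal L' U" "h \<in> R" "h \<noteq> 0" "lead h = m"
      "\<And>n. n \<in> keys h \<Longrightarrow> mdeg n = mdeg m"
      using nonface_element[OF L' less.prems False] by metis
    have mk: "m \<in> keys h" using lead_in_keys[OF h(2,3)] h(4) by simp
    define a where "a = inverse (lookup h m)"
    define f where "f = single m 1 - single 0 a * h"
    have lookup_f: "lookup f n = (if n = m then 0 else - a * lookup h n)" for n
      using mk lookup_mult_single[of 0 a h n]
      by (auto simp: f_def lookup_minus lookup_single when_def a_def in_keys_iff)
    have fk: "n \<in> monomials L" "mdeg n = mdeg m" "n \<preceq> m" "n \<noteq> m" if "n \<in> keys f" for n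
    proof -
      have "n \<noteq> m" "n \<in> keys h" using that by (auto simp: in_keys_iff lookup_f split: if_splits)
      then show "n \<in> monomials L" "mdeg n = mdeg m" "n \<preceq> m" "n \<noteq> m"
        using h lead_max[OF h(2,3), of n] by auto
    qed
    have "\<exists>g :: 'k mpol. single n 1 - g \<in> block_ideal L' U \<and> (\<forall>k\<in>keys g. face L' U (keys k) \<and> k \<preceq> n)"
      if n: "n \<in> keys f" for n
    proof (rule less.hyps[OF _ fk(1)[OF n]])
      let ?A = "\<lambda>m. {n \<in> monomials L. mdeg n = mdeg m \<and> n \<preceq> m \<and> n \<noteq> m}"
      have "?A n \<subset> ?A m"
      proof
        show "?A n \<subseteq> ?A m" using fk[OF n] le_trans le_antisym by fastforce
        have "n \<in> ?A m" using fk[OF n] by simp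
        then show "?A n \<noteq> ?A m" by blast
      qed
      moreover have "finite (?A m)" by (rule finite_subset[OF _ finite_degree[of "mdeg m"]]) auto
      ultimately show "card (?A n) < card (?A m)" by (rule psubset_card_mono[rotated])
    qed
    then obtain g where g: "\<And>n. n \<in> keys f \<Longrightarrow> single n 1 - g n \<in> (block_ideal L' U :: 'k mpol set)"
      "\<And>n k. n \<in> keys f \<Longrightarrow> k \<in> keys (g n) \<Longrightarrow> face L' U (keys k) \<and> k \<preceq> n"
      by metis
    define G where "G = (\<Sum>n\<in>keys f. single 0 (lookup f n) * g n)"
    have "f = (\<Sum>n\<in>keys f. single 0 (lookup f n) * single n 1)"
      using sum_single_lookup[of f] by (simp add: mult_single)
    then have "f - G = (\<Sum>n\<in>keys f. single 0 (lookup f n) * (single n 1 - g n))"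
      by (simp add: G_def right_diff_distrib sum_subtractf)
    also have "\<dots> \<in> block_ideal L' U" by (intro gen_ideal_sum gen_ideal_mult g(1))
    finally have "(f - G) + single 0 a * h \<in> block_ideal L' U"
      by (intro gen_ideal_add gen_ideal_mult h(1))
    then have "single m 1 - G \<in> block_ideal L' U" by (simp add: f_def)
    moreover have "face L' U (keys k) \<and> k \<preceq> m" if k: "k \<in> keys G" for k
    proof -
      obtain n where n: "n \<in> keys f" "k \<in> keys (single 0 (lookup f n) * g n)"
        using k keys_sum[of "\<lambda>n. single 0 (lookup f n) * g n" ] unfolding G_def by blast
      then have "k \<in> keys (g n)" using keys_mult_single[of 0 "lookup f n" "g n"] by auto
      then show ?thesis using g(2)[OF n(1)] fk(3)[OF n(1)] le_trans by blast
    qed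
    ultimately show ?thesis by blast
  qed
qed

lemma reduce:
  fixes f :: "'k mpol"
  assumes L': "L' \<subseteq> L" "good_conditions L' U"
  shows "\<exists>g. f - g \<in> block_ideal L' U \<and> (\<forall>m\<in>keys g. face L' U (keys m))"
proof (induction f rule: mpol_induct)
  case (single m c)
  \<comment> \<open>The polynomial may involve entries outside \<open>L\<close>, where the order is
    undefined. Their part \<open>m2\<close> is carried along as a coefficient, and faces do not see
    it.\<close>
  define m1 where "m1 = (\<Sum>e\<in>keys m \<inter> L. single e (lookup m e))"
  define m2 where "m2 = (\<Sum>e\<in>keys m - L. single e (lookup m e))"
  have m: "m = m1 + m2"
    using sum_single_lookup[of m] sum.Int_Diff[of "keys m" "\<lambda>e. single e (lookup m e)" L]
    by (simp add: m1_def m2_def)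
  have m1: "m1 \<in> monomials L" by (auto simp: m1_def monomials_def keys_sum_nat)
  have m2: "keys m2 \<inter> L = {}" by (auto simp: m2_def keys_sum_nat)
  obtain g :: "'k mpol" where g: "single m1 1 - g \<in> block_ideal L' U" "\<forall>n\<in>keys g. face L' U (keys n)"
    using reduce_monomial[OF L' m1] by blast
  have "single m c - single m2 c * g = single m2 c * (single m1 1 - g)"
    by (simp add: right_diff_distrib mult_single m add.commute)
  also have "\<dots> \<in> block_ideal L' U" by (rule gen_ideal_mult[OF g(1)])
  finally have "single m c - single m2 c * g \<in> block_ideal L' U" .
  moreover have "face L' U (keys n)" if n: "n \<in> keys (single m2 c * g)" for n
  proof -
    obtain n' where n': "n' \<in> keys g" "n = n' + m2"
      using keys_mult_single[of m2 c g] n by blast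
    then have "face L' U (keys n')" using g(2) by blast
    moreover have "keys n \<inter> subladder L' u = keys n' \<inter> subladder L' u" for u
      using m2 L'(1) subladder_subset[of L' u] by (auto simp: n'(2) keys_add_nat)
    ultimately show ?thesis by (simp add: face_def)
  qed
  ultimately show ?case by blast
next
  case (add f g)
  then obtain f' g' where *: "f - f' \<in> block_ideal L' U" "\<forall>m\<in>keys f'. face L' U (keys m)"
    "g - g' \<in> block_ideal L' U" "\<forall>m\<in>keys g'. face L' U (keys m)" by blast
  have "f + g - (f' + g') \<in> block_ideal L' U"
    using gen_ideal_add[OF *(1,3)] by (simp add: algebra_simps)
  moreover have "\<forall>m\<in>keys (f' + g'). face L' U (keys m)" using * keys_add[of f' g'] by blast
  ultimately show ?case by blast
qed

end

locale antidiagonal_conditions = antidiagonal L ord ty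
  for L ord and ty :: "'k::field itself" +
  fixes U :: "((nat \<times> nat) \<times> nat) set"
  assumes goodU: "good_conditions L U"
begin

abbreviation I :: "'k mpol set" where "I \<equiv> block_ideal L U"

lemma I_prime: "prime_set I"
  and I_standard: "f \<in> I \<Longrightarrow> (\<And>m. m \<in> keys f \<Longrightarrow> face L U (keys m)) \<Longrightarrow> f = 0" for f :: "'k mpol"
  using block_ideal_prime_standard[of L, OF reduce goodU] by blast+

text \<open>Otherwise reduce all other monomials of \<open>f\<close> modulo \<open>I\<close>. What
  remains is a combination of faces in \<open>I\<close>, hence 0, but its coefficient at the leading
  monomial is still that of \<open>f\<close>.\<close>

lemma lead_nonface:
  assumes f: "f \<in> I" "f \<in> R" "f \<noteq> 0"
  shows "\<not> face L U (keys (lead f))"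
proof
  assume face: "face L U (keys (lead f))"
  define m where "m = lead f"
  have m: "m \<in> keys f" "\<And>n. n \<in> keys f \<Longrightarrow> n \<preceq> m"
    using lead_in_keys[OF f(2,3)] lead_max[OF f(2,3)] by (auto simp: m_def)
  define A where "A = keys f - {m}"
  have "\<exists>g :: 'k mpol. single n 1 - g \<in> I \<and> (\<forall>k\<in>keys g. face L U (keys k) \<and> k \<preceq> n)" if "n \<in> A" for n
    by (rule reduce_monomial) (use that f(2) goodU in \<open>auto simp: A_def\<close>)
  then obtain g where g: "\<And>n. n \<in> A \<Longrightarrow> single n 1 - g n \<in> I"
    "\<And>n k. n \<in> A \<Longrightarrow> k \<in> keys (g n) \<Longrightarrow> face L U (keys k) \<and> k \<preceq> n"
    by metis
  define G where "G = (\<Sum>n\<in>A. single 0 (lookup f n) * g n)"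
  have Gk: "face L U (keys k) \<and> k \<preceq> m \<and> k \<noteq> m" if k: "k \<in> keys G" for k
  proof -
    obtain n where n: "n \<in> A" "k \<in> keys (single 0 (lookup f n) * g n)"
      using k keys_sum[of "\<lambda>n. single 0 (lookup f n) * g n" ] unfolding G_def by blast
    then have "k \<in> keys (g n)" using keys_mult_single[of 0 "lookup f n" "g n"] by auto
    then have "face L U (keys k) \<and> k \<preceq> n" using g(2) n(1) by blast
    moreover have "n \<preceq> m" "n \<noteq> m" using n(1) m(2) by (auto simp: A_def)
    ultimately show ?thesis using le_trans le_antisym by blast
  qed
  have "f = single m (lookup f m) + (\<Sum>n\<in>A. single n (lookup f n))"
    using sum_single_lookup[of f] sum.remove[of "keys f" m "\<lambda>n. single n (lookup f n)"] m(1) by (simp add: A_def)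
  also have "(\<Sum>n\<in>A. single n (lookup f n)) = (\<Sum>n\<in>A. single 0 (lookup f n) * single n 1)"
    by (simp add: mult_single)
  finally have "f - (single m (lookup f m) + G) =
      single m (lookup f m) + (\<Sum>n\<in>A. single 0 (lookup f n) * single n 1) - (single m (lookup f m) + G)"
    by (rule arg_cong)
  also have "\<dots> = (\<Sum>n\<in>A. single 0 (lookup f n) * (single n 1 - g n))"
    by (simp add: G_def right_diff_distrib sum_subtractf)
  also have "\<dots> \<in> I" by (intro gen_ideal_sum gen_ideal_mult g(1))
  finally have "f - (f - (single m (lookup f m) + G)) \<in> I" by (rule gen_ideal_diff[OF f(1)])
  then have mem: "single m (lookup f m) + G \<in> I" by simp
  have "single m (lookup f m) + G = 0"
  proof (rule I_standard[OF mem])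
    fix k assume "k \<in> keys (single m (lookup f m) + G)"
    then have "k = m \<or> k \<in> keys G" using keys_add[of "single m (lookup f m)" G] by (auto split: if_splits)
    then show "face L U (keys k)" using Gk face by (auto simp: m_def)
  qed
  then have "lookup (single m (lookup f m) + G) m = 0" by simp
  moreover have "m \<notin> keys G" using Gk by blast
  ultimately show False using m(1) by (simp add: lookup_add in_keys_iff)
qed

end

section \<open>Taylor coefficients\<close>

lemma lookup_le_mdeg: "lookup m e \<le> mdeg m"
  by (cases "e \<in> keys m") (auto simp: mdeg_def in_keys_iff intro!: member_le_sum)

lemma cmono_list:
  obtains xs where "m = cmono xs"
proof -
  have "\<exists>xs. m = cmono xs"
  proof (induction "mdeg m" arbitrary: m)
    case 0
    have "m = 0"
    proof (rule poly_mapping_eqI)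
      fix e show "lookup m e = lookup 0 e"
        using 0 lookup_le_mdeg[of m e] by simp
    qed
    then show ?case by (intro exI[of _ "[]"]) simp
  next
    case (Suc n)
    then have "m \<noteq> 0" by auto
    then obtain e where e: "e \<in> keys m" by (metis keys_eq_empty ex_in_conv)
    then obtain m' where m': "m = m' + cmono [e]" using cmono_divides[of "[e]" m] by auto
    then have "mdeg m' = n" using Suc.hyps(2) by (simp add: mdeg_add mdeg_cmono)
    then obtain xs where "m' = cmono xs" using Suc.hyps(1) by blast
    then have "m = cmono (e # xs)" using m' by (simp add: cmono_Cons add.commute)
    then show ?case by blast
  qed
  then show ?thesis using that by blast
qed

text \<open>For a facet \<open>F\<close>, this is the order of the monomial along the prime
  generated by the entries outside \<open>F\<close>.\<close>

definition odeg :: "(nat \<times> nat) set \<Rightarrow> monomial \<Rightarrow> nat" where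
  "odeg F m = (\<Sum>e\<in>keys m. if e \<in> F then 0 else lookup m e)"

lemma odeg_add: "odeg F (m + n) = odeg F m + odeg F n"
  unfolding odeg_def by (rule setsum_keys_plus_distrib) simp_all

lemma odeg_single [simp]: "odeg F (single e k) = (if e \<in> F then 0 else k)"
  by (simp add: odeg_def)

lemma odeg_0 [simp]: "odeg F 0 = 0"
  by (simp add: odeg_def)

lemma odeg_cmono: "odeg F (cmono c) = length (filter (\<lambda>e. e \<notin> F) c)"
  by (induction c) (simp_all add: cmono_Cons odeg_add)

lemma odeg_antimono: "F \<inter> keys m \<subseteq> F' \<Longrightarrow> odeg F' m \<le> odeg F m"
  unfolding odeg_def by (rule sum_mono) auto

lemma mdeg_eq_0_iff: "mdeg m = 0 \<longleftrightarrow> m = 0"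
proof
  assume "mdeg m = 0"
  obtain xs where "m = cmono xs" by (rule cmono_list)
  then show "m = 0" using \<open>mdeg m = 0\<close> by (simp add: mdeg_cmono)
qed simp

lemma monomial_add_eq_0: "m + n = 0 \<longleftrightarrow> m = 0 \<and> n = 0" for m n :: monomial
  using mdeg_add[of m n] mdeg_eq_0_iff[of "m + n"] mdeg_eq_0_iff[of m] mdeg_eq_0_iff[of n] by auto

lemma lookup_times:
  fixes P Q :: "monomial \<Rightarrow>\<^sub>0 'a::comm_ring_1"
  shows "lookup (P * Q) a = (\<Sum>(b, c)\<in>keys P \<times> keys Q. if b + c = a then lookup P b * lookup Q c else 0)"
proof -
  have "P * Q = (\<Sum>b\<in>keys P. single b (lookup P b)) * (\<Sum>c\<in>keys Q. single c (lookup Q c))"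
    by (simp add: sum_single_lookup)
  also have "\<dots> = (\<Sum>(b, c)\<in>keys P \<times> keys Q. single (b + c) (lookup P b * lookup Q c))"
    by (simp add: sum_product sum.cartesian_product mult_single)
  finally show ?thesis
    by (auto simp: lookup_sum lookup_single when_def case_prod_unfold intro!: sum.cong)
qed

text \<open>Entries outside \<open>F\<close> are moved by new variables, which form the outer layer
  of monomials. The coefficient at \<open>a\<close> is a Hasse derivative of \<open>f\<close>, so no
  factorials are divided by and the characteristic does no harm.\<close>

definition taylor :: "(nat \<times> nat) set \<Rightarrow> 'k::comm_ring_1 mpol \<Rightarrow> (monomial \<Rightarrow>\<^sub>0 'k mpol)" where
  "taylor F = insertion (\<lambda>c. single 0 (single 0 c))
     (\<lambda>e. if e \<in> F then single 0 (var e) else single 0 (var e) + single (single e 1) 1)"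

lemma single_single_hom: "comm_ring_hom (\<lambda>c::'k::comm_ring_1. single 0 (single 0 c :: 'k mpol) :: monomial \<Rightarrow>\<^sub>0 'k mpol)"
  by (rule comp_hom[OF single_hom single_hom])

lemma taylor_hom: "comm_ring_hom (taylor F)"
  unfolding taylor_def by (rule insertion_hom[OF single_single_hom])

lemma taylor_var: "taylor F (var e) =
    (if e \<in> F then single 0 (var e) else single 0 (var e) + single (single e 1) 1)"
  unfolding taylor_def by (rule insertion_var[OF single_single_hom])

lemma taylor_const: "taylor F (single 0 c) = single 0 (single 0 c)"
  unfolding taylor_def by (simp add: insertion_single[OF single_single_hom])

text \<open>Two monomials add up to 0 only if both are 0, so only the constant terms meet.\<close>

lemma lookup_0_hom: "comm_ring_hom (\<lambda>P :: monomial \<Rightarrow>\<^sub>0 'a::comm_ring_1. lookup P 0)"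
proof
  fix P Q :: "monomial \<Rightarrow>\<^sub>0 'a"
  have "lookup (P * Q) 0 = (\<Sum>(b, c)\<in>keys P \<times> keys Q. if b + c = 0 then lookup P b * lookup Q c else 0)"
    by (rule lookup_times)
  also have "\<dots> = (\<Sum>x\<in>keys P \<times> keys Q. if x = (0, 0) then lookup P 0 * lookup Q 0 else 0)"
    by (rule sum.cong) (auto simp: monomial_add_eq_0 split: if_splits)
  also have "\<dots> = lookup P 0 * lookup Q 0" by (auto simp: in_keys_iff)
  finally show "lookup (P * Q) 0 = lookup P 0 * lookup Q 0" .
qed (simp_all add: lookup_add)

lemma taylor_coeff_0: "lookup (taylor F f) 0 = f"
proof (rule mpol_hom_eqI[OF comp_hom[OF lookup_0_hom taylor_hom] id_hom])
  fix e show "lookup (taylor F (var e)) 0 = var e"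
    using mdeg_eq_0_iff[of "single e 1"] by (auto simp: taylor_var lookup_add lookup_single when_def)
qed (simp add: taylor_const)

text \<open>The substitution trades factors of a monomial for new variables, so \<open>n\<close> and
  \<open>a\<close> together make up the original monomial.\<close>

lemma taylor_support: "n \<in> keys (lookup (taylor F f) a) \<Longrightarrow> n + a \<in> keys f"
proof -
  interpret comm_ring_hom "taylor F :: 'a mpol \<Rightarrow> _" by (rule taylor_hom)
  have mono: "n + a = m" if "n \<in> keys (lookup (taylor F (single m (1::'a))) a)" for n a m
  proof -
    obtain xs where m: "m = cmono xs" by (rule cmono_list)
    have "n + a = cmono xs" if "n \<in> keys (lookup (taylor F (single (cmono xs) (1::'a))) a)" for n a
      using that
    proof (induction xs arbitrary: n a)
      case Nil
      then have "n \<in> keys (lookup (1 :: monomial \<Rightarrow>\<^sub>0 'a mpol) a)" by simp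
      then show ?case by (auto simp: lookup_one when_def split: if_splits)
    next
      case (Cons e xs)
      let ?P = "taylor F (var e :: 'a mpol)" and ?Q = "taylor F (single (cmono xs) (1::'a))"
      have "single (cmono (e # xs)) (1::'a) = var e * single (cmono xs) 1"
        by (simp add: cmono_Cons var_def mult_single)
      then have "n \<in> keys (lookup (?P * ?Q) a)" using Cons.prems by (simp add: hom_mult)
      let ?t = "\<lambda>(b, c). if b + c = a then lookup ?P b * lookup ?Q c else 0"
      have "n \<in> keys (\<Sum>x\<in>keys ?P \<times> keys ?Q. ?t x)"
        using \<open>n \<in> keys (lookup (?P * ?Q) a)\<close> by (simp only: lookup_times)
      then obtain z where z: "n \<in> keys (?t z)" using keys_sum[of ?t "keys ?P \<times> keys ?Q"] by blast
      obtain b c where "z = (b, c)" by (cases z)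
      with z have z': "n \<in> keys (if b + c = a then lookup ?P b * lookup ?Q c else 0)" by (simp only: prod.case)
      have bc: "b + c = a" "n \<in> keys (lookup ?P b * lookup ?Q c)"
        using z' by (cases "b + c = a"; simp only: if_True if_False keys_zero empty_iff)+
      then obtain x y where xy: "x \<in> keys (lookup ?P b)" "y \<in> keys (lookup ?Q c)" "n = x + y"
        using keys_mult[of "lookup ?P b" "lookup ?Q c"] by blast
      have "x + b = single e 1"
        using xy(1) mdeg_eq_0_iff[of "single e 1"] unfolding taylor_var
        by (auto simp: lookup_add lookup_single when_def var_def split: if_splits)
      moreover have "y + c = cmono xs" by (rule Cons.IH[OF xy(2)])
      moreover have "n + a = (x + b) + (y + c)" by (simp only: xy(3) bc(1)[symmetric] ac_simps)
      ultimately show ?case by (simp only: cmono_Cons)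
    qed
    then show ?thesis using that m by blast
  qed
  assume n: "n \<in> keys (lookup (taylor F f) a)"
  have "f = (\<Sum>m\<in>keys f. single 0 (lookup f m) * single m 1)"
    using sum_single_lookup[of f] by (simp add: mult_single)
  then have "taylor F f = taylor F (\<Sum>m\<in>keys f. single 0 (lookup f m) * single m 1)" by (rule arg_cong)
  also have "\<dots> = (\<Sum>m\<in>keys f. single 0 (single 0 (lookup f m)) * taylor F (single m 1))"
    by (simp add: hom_sum hom_mult taylor_const)
  finally have "lookup (taylor F f) a = (\<Sum>m\<in>keys f. single 0 (lookup f m) * lookup (taylor F (single m 1)) a)"
    using lookup_mult_single[of 0 _ _ a, where 'k = "'a mpol", simplified] by (simp add: lookup_sum)
  then obtain m where "m \<in> keys f" "n \<in> keys (single 0 (lookup f m) * lookup (taylor F (single m 1)) a)"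
    using n keys_sum[of "\<lambda>m. single 0 (lookup f m) * lookup (taylor F (single m 1)) a" "keys f"] by fastforce
  then show "n + a \<in> keys f"
    using mono[of n m a] keys_mult_single[of 0 "lookup f m" "lookup (taylor F (single m 1)) a"] by auto
qed

section \<open>Ideals and symbolic powers in the polynomial ring\<close>

lemma taylor_face:
  assumes "keys b \<subseteq> F"
  shows "taylor F (single b 1) = single 0 (single b 1)"
  by (rule mpol_hom_eqI[OF taylor_hom single_hom]) (use assms in \<open>auto simp: taylor_const taylor_var split: if_splits\<close>)

text \<open>Expanding the product, the choice of the new variable in every factor gives the top
  part; every other choice has lower degree in the new variables.\<close>

lemma taylor_cmono:
  assumes "set xs \<inter> F = {}"
  shows "\<exists>P. taylor F (single (cmono xs) (1::'k::comm_ring_1)) = single (cmono xs) 1 + P \<and> (\<forall>a\<in>keys P. mdeg a < length xs)"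
proof -
  interpret comm_ring_hom "taylor F :: 'k mpol \<Rightarrow> _" by (rule taylor_hom)
  show ?thesis using assms
  proof (induction xs)
    case Nil
    show ?case by (intro exI[of _ 0]) simp
  next
    case (Cons e xs)
    then obtain P where P: "taylor F (single (cmono xs) (1::'k)) = single (cmono xs) 1 + P"
      "\<And>a. a \<in> keys P \<Longrightarrow> mdeg a < length xs" by auto
    let ?v = "single 0 (var e) :: monomial \<Rightarrow>\<^sub>0 'k mpol" and ?z = "single (single e 1) 1 :: monomial \<Rightarrow>\<^sub>0 'k mpol"
    let ?Q = "?v * single (cmono xs) 1 + ?v * P + ?z * P"
    have "single (cmono (e # xs)) (1::'k) = var e * single (cmono xs) 1"
      by (simp add: cmono_Cons var_def mult_single)
    then have "taylor F (single (cmono (e # xs)) (1::'k)) = (?v + ?z) * (single (cmono xs) 1 + P)"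
      using Cons.prems by (simp add: hom_mult taylor_var P(1))
    also have "\<dots> = ?z * single (cmono xs) 1 + ?Q" by (simp only: algebra_simps)
    also have "?z * single (cmono xs) 1 = single (cmono (e # xs)) 1"
      by (simp add: mult_single cmono_Cons)
    finally have "taylor F (single (cmono (e # xs)) (1::'k)) = single (cmono (e # xs)) 1 + ?Q" .
    moreover have "mdeg a < length (e # xs)" if a: "a \<in> keys ?Q" for a
    proof -
      have "a \<in> keys (?v * single (cmono xs) 1) \<or> a \<in> keys (?v * P) \<or> a \<in> keys (?z * P)"
        using a keys_add[of "?v * single (cmono xs) 1 + ?v * P" "?z * P"]
          keys_add[of "?v * single (cmono xs) 1" "?v * P"] by blast
      then show ?thesis
      proof (elim disjE)
        assume "a \<in> keys (?v * single (cmono xs) 1)"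
        then have "a = cmono xs" by (simp add: mult_single split: if_splits)
        then show ?thesis by (simp add: mdeg_cmono)
      next
        assume "a \<in> keys (?v * P)"
        then have "a \<in> keys P" using keys_mult_single[of 0 "var e" P] by auto
        then show ?thesis using P(2) by fastforce
      next
        assume "a \<in> keys (?z * P)"
        then obtain b where "b \<in> keys P" "a = b + single e 1" using keys_mult_single[of "single e 1" 1 P] by auto
        then show ?thesis using P(2)[of b] by (simp add: mdeg_add)
      qed
    qed
    ultimately show ?case by blast
  qed
qed

lemma taylor_top:
  assumes "keys b \<subseteq> F" "keys a \<inter> F = {}"
  shows "lookup (taylor F (single (b + a) 1)) a = single b 1"
proof -
  interpret comm_ring_hom "taylor F :: 'a mpol \<Rightarrow> _" by (rule taylor_hom)
  obtain xs where xs: "a = cmono xs" by (rule cmono_list)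
  have "set xs \<inter> F = {}" using assms(2) by (simp add: xs keys_cmono)
  then obtain P where P: "taylor F (single a (1::'a)) = single a 1 + P" "\<And>x. x \<in> keys P \<Longrightarrow> mdeg x < length xs"
    using taylor_cmono[of xs F] unfolding xs by metis
  have "a \<notin> keys P" using P(2)[of a] by (auto simp: xs mdeg_cmono)
  then have one: "lookup (taylor F (single a (1::'a))) a = 1"
    by (simp add: P(1) lookup_add in_keys_iff)
  have "taylor F (single (b + a) (1::'a)) = taylor F (single b 1 * single a 1)" by (simp add: mult_single)
  also have "\<dots> = single 0 (single b 1) * taylor F (single a 1)"
    by (simp only: hom_mult taylor_face[OF assms(1)])
  finally show ?thesis
    using lookup_mult_single[of 0 "single b 1" "taylor F (single a (1::'a))" a] one by simp
qed

text \<open>By \<open>taylor_support\<close> only the monomial \<open>b + a\<close> of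
  \<open>f\<close> can contribute, and it does so with binomial coefficient 1, since
  \<open>b\<close> contains no entry of \<open>a\<close>.\<close>

lemma taylor_lead:
  fixes f :: "'k::comm_ring_1 mpol"
  assumes "keys b \<subseteq> F" "keys a \<inter> F = {}"
  shows "lookup (lookup (taylor F f) a) b = lookup f (b + a)"
proof (induction f rule: mpol_induct)
  case (single m c)
  interpret comm_ring_hom "taylor F :: 'k mpol \<Rightarrow> _" by (rule taylor_hom)
  show ?case
  proof (cases "m = b + a")
    case True
    have "taylor F (single m c) = single 0 (single 0 c) * taylor F (single m 1)"
      using hom_mult[of "single 0 c" "single m 1"] by (simp add: taylor_const mult_single)
    then have "lookup (taylor F (single m c)) a = single 0 c * single b 1"
      using lookup_mult_single[of 0 "single 0 c" "taylor F (single m (1::'k))" a] taylor_top[OF assms, where 'a = 'k]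
      by (simp add: True)
    then show ?thesis by (simp add: mult_single True)
  next
    case False
    then have "b \<notin> keys (lookup (taylor F (single m c)) a)"
      using taylor_support[of b F "single m c" a] by (auto split: if_splits)
    then show ?thesis using False by (simp add: in_keys_iff lookup_single when_def)
  qed
next
  case (add f g)
  interpret comm_ring_hom "taylor F :: 'k mpol \<Rightarrow> _" by (rule taylor_hom)
  show ?case using add by (simp add: hom_add lookup_add)
qed

section \<open>Order of vanishing along an ideal\<close>

definition low_coeffs_in :: "'a::comm_ring_1 set \<Rightarrow> nat \<Rightarrow> (monomial \<Rightarrow>\<^sub>0 'a) set" where
  "low_coeffs_in I n = {P. \<forall>a. mdeg a < n \<longrightarrow> lookup P a \<in> I}"

text \<open>If \<open>b + c = a\<close> has degree at most \<open>n\<close>, then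
  \<open>c = 0\<close> or \<open>mdeg b < n\<close>.\<close>

lemma low_coeffs_in_mult:
  assumes P: "P \<in> low_coeffs_in (gen_ideal G) n" and Q: "Q \<in> low_coeffs_in (gen_ideal G) 1"
  shows "P * Q \<in> low_coeffs_in (gen_ideal G) (Suc n)"
  unfolding low_coeffs_in_def
proof clarify
  fix a assume a: "mdeg a < Suc n"
  have "(\<Sum>x\<in>keys P \<times> keys Q. case x of (b, c) \<Rightarrow> if b + c = a then lookup P b * lookup Q c else 0) \<in> gen_ideal G"
  proof (rule gen_ideal_sum)
    fix x assume "x \<in> keys P \<times> keys Q"
    obtain b c where x: "x = (b, c)" by (cases x)
    show "(case x of (b, c) \<Rightarrow> if b + c = a then lookup P b * lookup Q c else 0) \<in> gen_ideal G"
    proof (cases "b + c = a")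
      case True
      show ?thesis
      proof (cases "c = 0")
        case True
        then have "lookup Q c \<in> gen_ideal G" using Q by (simp add: low_coeffs_in_def)
        then show ?thesis by (simp add: x gen_ideal_0 gen_ideal_mult)
      next
        case False
        then have "mdeg b < n" using a True mdeg_add[of b c] mdeg_eq_0_iff[of c] by simp
        then have "lookup P b \<in> gen_ideal G" using P by (simp add: low_coeffs_in_def)
        then show ?thesis by (simp add: x gen_ideal_0 gen_ideal_mult')
      qed
    qed (simp add: x gen_ideal_0)
  qed
  then show "lookup (P * Q) a \<in> gen_ideal G" by (simp only: lookup_times)
qed

text \<open>Induction on \<open>mdeg a\<close>: in the coefficient of \<open>S * P\<close> at
  \<open>a\<close>, every term but \<open>lookup S 0 * lookup P a\<close> contains a coefficient of
  \<open>P\<close> of smaller degree, already in the ideal.\<close>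

lemma low_coeffs_in_cancel:
  assumes prime: "prime_set (gen_ideal G)" and S: "lookup S 0 \<notin> gen_ideal G"
    and SP: "S * P \<in> low_coeffs_in (gen_ideal G) n"
  shows "P \<in> low_coeffs_in (gen_ideal G) n"
proof -
  have "lookup P a \<in> gen_ideal G" if "mdeg a < n" for a
    using that
  proof (induction "mdeg a" arbitrary: a rule: less_induct)
    case less
    show ?case
    proof (cases "a \<in> keys P")
      case False
      then show ?thesis by (simp add: in_keys_iff gen_ideal_0)
    next
      case True
      let ?t = "\<lambda>(b, c). if b + c = a then lookup S b * lookup P c else 0"
      have "lookup S 0 \<noteq> 0" using S gen_ideal_0 by metis
      then have 0: "(0, a) \<in> keys S \<times> keys P" using True by (simp add: in_keys_iff)
      have eq: "lookup (S * P) a = ?t (0, a) + (\<Sum>x\<in>keys S \<times> keys P - {(0, a)}. ?t x)"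
        unfolding lookup_times by (rule sum.remove) (use 0 in auto)
      have rest: "(\<Sum>x\<in>keys S \<times> keys P - {(0, a)}. ?t x) \<in> gen_ideal G"
      proof (rule gen_ideal_sum)
        fix x assume x: "x \<in> keys S \<times> keys P - {(0, a)}"
        obtain b c where bc: "x = (b, c)" by (cases x)
        show "?t x \<in> gen_ideal G"
        proof (cases "b + c = a")
          case True
          then have "b \<noteq> 0" using x bc by auto
          then have "mdeg c < mdeg a" using mdeg_add[of b c] True mdeg_eq_0_iff[of b] by simp
          then have "lookup P c \<in> gen_ideal G" using less by simp
          then show ?thesis by (simp add: bc gen_ideal_0 gen_ideal_mult)
        qed (simp add: bc gen_ideal_0)
      qed
      have "lookup (S * P) a \<in> gen_ideal G" using SP less.prems by (simp add: low_coeffs_in_def)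
      from gen_ideal_diff[OF this rest] have "?t (0, a) \<in> gen_ideal G" by (simp only: eq add_diff_cancel_right')
      then have "lookup S 0 * lookup P a \<in> gen_ideal G" by simp
      then show ?thesis using prime S unfolding prime_set_def by blast
    qed
  qed
  then show ?thesis by (simp add: low_coeffs_in_def)
qed

section \<open>The polynomial ring of the ladder, its ideals and their powers\<close>

lemma pring_simps [simp]:
  "carrier (poly_ring_on L) = {f. keys f \<subseteq> monomials L}"
  "mult (poly_ring_on L) = (*)" "one (poly_ring_on L) = 1" "zero (poly_ring_on L) = 0" "add (poly_ring_on L) = (+)"
  by (simp_all add: poly_ring_on_def subset_ring_def)

lemma carrier_pring_closed:
  assumes "f \<in> carrier (poly_ring_on L)" "g \<in> carrier (poly_ring_on L)"
  shows "f + g \<in> carrier (poly_ring_on L)" "f * g \<in> carrier (poly_ring_on L)" "- f \<in> carrier (poly_ring_on L)"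
proof -
  show "f + g \<in> carrier (poly_ring_on L)" using assms keys_add[of f g] by auto
  show "f * g \<in> carrier (poly_ring_on L)"
  proof (simp, rule subsetI)
    fix m assume "m \<in> keys (f * g)"
    then obtain a b where "a \<in> keys f" "b \<in> keys g" "m = a + b" using keys_mult[of f g] by blast
    then show "m \<in> monomials L" using assms by (auto simp: monomials_def keys_add_nat)
  qed
  show "- f \<in> carrier (poly_ring_on L)" using assms by (auto simp: in_keys_iff)
qed

lemma cring_pring: "cring (poly_ring_on L :: 'k::comm_ring_1 mpol ring)"
proof (rule cringI)
  let ?R = "poly_ring_on L :: 'k mpol ring"
  show "abelian_group ?R"
  proof (rule abelian_groupI)
    show "x \<oplus>\<^bsub>?R\<^esub> y \<in> carrier ?R" if "x \<in> carrier ?R" "y \<in> carrier ?R" for x y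
      using carrier_pring_closed(1)[OF that] by simp
    show "\<exists>y\<in>carrier ?R. y \<oplus>\<^bsub>?R\<^esub> x = \<zero>\<^bsub>?R\<^esub>" if "x \<in> carrier ?R" for x
      using carrier_pring_closed(3)[OF that that] by (intro bexI[of _ "- x"]) simp_all
  qed (simp_all add: ac_simps)
  show "comm_monoid ?R"
  proof (rule comm_monoidI)
    show "x \<otimes>\<^bsub>?R\<^esub> y \<in> carrier ?R" if "x \<in> carrier ?R" "y \<in> carrier ?R" for x y
      using carrier_pring_closed(2)[OF that] by simp
    show "\<one>\<^bsub>?R\<^esub> \<in> carrier ?R" by (simp add: monomials_def)
    show "x \<otimes>\<^bsub>?R\<^esub> y \<otimes>\<^bsub>?R\<^esub> z = x \<otimes>\<^bsub>?R\<^esub> (y \<otimes>\<^bsub>?R\<^esub> z)" for x y z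
      by (simp only: pring_simps mult.assoc)
    show "x \<otimes>\<^bsub>?R\<^esub> y = y \<otimes>\<^bsub>?R\<^esub> x" for x y
      by (simp only: pring_simps mult.commute)
    show "\<one>\<^bsub>?R\<^esub> \<otimes>\<^bsub>?R\<^esub> x = x" for x
      by (simp only: pring_simps mult_1_left)
  qed
qed (simp only: pring_simps distrib_right)

lemma a_inv_pring:
  assumes "x \<in> carrier (poly_ring_on L)"
  shows "\<ominus>\<^bsub>poly_ring_on L\<^esub> x = - x"
proof -
  interpret cring "poly_ring_on L" by (rule cring_pring)
  show ?thesis by (rule minus_equality) (use assms carrier_pring_closed(3)[of x L] in simp_all)
qed

lemma ideal_pringI:
  assumes "J \<subseteq> carrier (poly_ring_on L)" "0 \<in> J" "\<And>a b. a \<in> J \<Longrightarrow> b \<in> J \<Longrightarrow> a + b \<in> J"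
    "\<And>r a. r \<in> carrier (poly_ring_on L) \<Longrightarrow> a \<in> J \<Longrightarrow> r * a \<in> J"
  shows "ideal J (poly_ring_on L)"
proof (rule idealI)
  interpret cring "poly_ring_on L :: 'a mpol ring" by (rule cring_pring)
  show "ring (poly_ring_on L :: 'a mpol ring)" by (rule ring_axioms)
  show "subgroup J (add_monoid (poly_ring_on L))"
  proof
    fix x assume x: "x \<in> J"
    have "- 1 \<in> carrier (poly_ring_on L :: 'a mpol ring)"
      using carrier_pring_closed(3)[of 1] by (auto simp: monomials_def)
    then have "- x \<in> J" using assms(4)[of "- 1" x] x by simp
    moreover have "inv\<^bsub>add_monoid (poly_ring_on L)\<^esub> x = - x"
      using a_inv_pring[of x L] x assms(1) by (auto simp: a_inv_def)
    ultimately show "inv\<^bsub>add_monoid (poly_ring_on L)\<^esub> x \<in> J" by simp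
  qed (use assms(1-3) in auto)
next
  fix a x :: "'a mpol" assume "a \<in> J" "x \<in> carrier (poly_ring_on L)"
  then have "x * a \<in> J" by (intro assms(4))
  then show "x \<otimes>\<^bsub>poly_ring_on L\<^esub> a \<in> J" "a \<otimes>\<^bsub>poly_ring_on L\<^esub> x \<in> J"
    by (simp_all only: pring_simps mult.commute[of a x])
qed

lemma ideal_pringD:
  assumes "ideal J (poly_ring_on L)"
  shows "J \<subseteq> carrier (poly_ring_on L)" "0 \<in> J" "a \<in> J \<Longrightarrow> b \<in> J \<Longrightarrow> a + b \<in> J"
    "r \<in> carrier (poly_ring_on L) \<Longrightarrow> a \<in> J \<Longrightarrow> r * a \<in> J"
proof -
  interpret ideal J "poly_ring_on L" by fact
  show "J \<subseteq> carrier (poly_ring_on L)" by (rule a_subset)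
  show "0 \<in> J" using additive_subgroup.zero_closed[OF is_additive_subgroup] by simp
  show "a \<in> J \<Longrightarrow> b \<in> J \<Longrightarrow> a + b \<in> J" using additive_subgroup.a_closed[OF is_additive_subgroup, of a b] by simp
  show "r \<in> carrier (poly_ring_on L) \<Longrightarrow> a \<in> J \<Longrightarrow> r * a \<in> J" using I_l_closed[of a r] by simp
qed

lemma ideal_pring_sum:
  "ideal J (poly_ring_on L) \<Longrightarrow> (\<And>a. a \<in> A \<Longrightarrow> f a \<in> J) \<Longrightarrow> (\<Sum>a\<in>A. f a) \<in> J"
  by (induction A rule: infinite_finite_induct) (simp_all add: ideal_pringD(2,3))

abbreviation ideal_power :: "(nat \<times> nat) set \<Rightarrow> 'k::comm_ring_1 mpol set \<Rightarrow> nat \<Rightarrow> 'k mpol set" where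
  "ideal_power L J n \<equiv> J [^]\<^bsub>ideals_set (poly_ring_on L)\<^esub> n"

lemma ideal_power_0: "ideal_power L J 0 = carrier (poly_ring_on L)"
  and ideal_power_Suc: "ideal_power L J (Suc n) = ideal_prod (poly_ring_on L) (ideal_power L J n) J"
  by (simp_all add: nat_pow_def ideals_set_def)

lemma ideal_ideal_power: "ideal J (poly_ring_on L) \<Longrightarrow> ideal (ideal_power L J n) (poly_ring_on L)"
proof (induction n)
  interpret cring "poly_ring_on L :: 'a mpol ring" by (rule cring_pring)
  case 0
  show ?case unfolding ideal_power_0 by (rule oneideal)
next
  interpret cring "poly_ring_on L :: 'a mpol ring" by (rule cring_pring)
  case (Suc n)
  then show ?case unfolding ideal_power_Suc by (intro ideal_prod_is_ideal)
qed

lemma ideal_power_Suc_mult: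
  "f \<in> ideal_power L J n \<Longrightarrow> g \<in> J \<Longrightarrow> f * g \<in> ideal_power L J (Suc n)"
  using ideal_prod.prod[of f "ideal_power L J n" g J "poly_ring_on L"]
  unfolding ideal_power_Suc by (simp only: pring_simps)

lemma ideal_power_prod:
  assumes J: "ideal J (poly_ring_on L)" and A: "finite A" "\<And>a. a \<in> A \<Longrightarrow> f a \<in> J"
  shows "(\<Prod>a\<in>A. f a) \<in> ideal_power L J (card A)"
  using A
proof (induction A rule: finite_induct)
  case empty
  show ?case unfolding card.empty prod.empty ideal_power_0 by (simp add: monomials_def)
next
  case (insert a A)
  have "(\<Prod>a\<in>A. f a) * f a \<in> ideal_power L J (Suc (card A))"
    by (rule ideal_power_Suc_mult) (use insert in blast)+
  then show ?case
    unfolding card_insert_disjoint[OF insert.hyps(1,2)] prod.insert[OF insert.hyps(1,2)] by (simp only: mult.commute)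
qed

lemma ideal_power_mult:
  assumes J: "ideal J (poly_ring_on L)"
  shows "f \<in> ideal_power L J m \<Longrightarrow> g \<in> ideal_power L J n \<Longrightarrow> f * g \<in> ideal_power L J (m + n)"
proof (induction n arbitrary: g)
  case 0
  then have "g * f \<in> ideal_power L J m"
    using ideal_pringD(4)[OF ideal_ideal_power[OF J], of g f m] by (simp only: ideal_power_0)
  then show ?case by (simp only: mult.commute add_0_right)
next
  case (Suc n)
  from Suc.prems(2) have "g \<in> ideal_prod (poly_ring_on L) (ideal_power L J n) J" by (simp only: ideal_power_Suc)
  then show ?case
  proof (induction g rule: ideal_prod.induct)
    case (prod i j)
    have "f * i \<in> ideal_power L J (m + n)" using Suc.IH Suc.prems(1) prod.hyps(1) by blast
    from ideal_power_Suc_mult[OF this prod.hyps(2)] show ?case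
      by (simp only: pring_simps mult.assoc add_Suc_right)
  next
    case (sum g h)
    have "f * g + f * h \<in> ideal_power L J (m + Suc n)"
      by (rule ideal_pringD(3)[OF ideal_ideal_power[OF J]]) (rule sum.IH)+
    then show ?case by (simp only: pring_simps distrib_left)
  qed
qed

lemma ideal_power_mono_exp:
  assumes J: "ideal J (poly_ring_on L)"
  shows "m \<le> n \<Longrightarrow> ideal_power L J n \<subseteq> ideal_power L J m"
proof (induction n rule: dec_induct)
  case (step n)
  interpret cring "poly_ring_on L :: 'a mpol ring" by (rule cring_pring)
  show ?case using step.IH ideal_prod_inter[OF ideal_ideal_power[OF J, of n] J] unfolding ideal_power_Suc by blast
qed simp

lemma mem_symbolic_power:
  "f \<in> symbolic_power (poly_ring_on L) J n \<longleftrightarrow> f \<in> carrier (poly_ring_on L) \<and>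
    (\<forall>P\<in>associated_primes (poly_ring_on L) J.
      \<exists>s\<in>carrier (poly_ring_on L). s \<notin> P \<and> s * f \<in> ideal_power L J n)"
  unfolding symbolic_power_def by (simp only: mem_Collect_eq bex_simps(6) Bex_def Diff_iff pring_simps(2) conj_assoc)

lemma symbolic_power_ideal:
  assumes J: "ideal J (poly_ring_on L)"
  shows "ideal (symbolic_power (poly_ring_on L) J n) (poly_ring_on L)"
proof (rule ideal_pringI)
  let ?R = "poly_ring_on L" and ?S = "symbolic_power (poly_ring_on L) J n"
  note Jn = ideal_pringD[OF ideal_ideal_power[OF J, of n]]
  have prime: "primeideal P ?R" if "P \<in> associated_primes ?R J" for P
    using that by (simp only: associated_primes_def mem_Collect_eq)
  have one: "1 \<in> carrier ?R \<and> 1 \<notin> P" if "P \<in> associated_primes ?R J" for P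
  proof -
    interpret primeideal P ?R by (rule prime[OF that])
    have "1 \<in> carrier ?R" by (simp add: monomials_def)
    then show ?thesis using one_imp_carrier I_notcarr by (metis pring_simps(3))
  qed
  show "?S \<subseteq> carrier ?R" unfolding mem_symbolic_power subset_iff by blast
  have "0 \<in> carrier ?R" by simp
  then show "0 \<in> ?S"
    unfolding mem_symbolic_power using one Jn(2) by (metis mult_zero_right)
  show "a + b \<in> ?S" if ab: "a \<in> ?S" "b \<in> ?S" for a b
    unfolding mem_symbolic_power
  proof (intro conjI ballI)
    have "a \<in> carrier ?R" "b \<in> carrier ?R" using ab unfolding mem_symbolic_power by blast+
    then show "a + b \<in> carrier ?R" by (rule carrier_pring_closed)
    fix P assume P: "P \<in> associated_primes ?R J"
    interpret primeideal P ?R by (rule prime[OF P])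
    obtain s t where st: "s \<in> carrier ?R" "s \<notin> P" "s * a \<in> ideal_power L J n"
      "t \<in> carrier ?R" "t \<notin> P" "t * b \<in> ideal_power L J n"
      using ab P unfolding mem_symbolic_power by blast
    have "s * t \<notin> P" using I_prime[of s t] st by (auto simp only: pring_simps)
    moreover have "t * (s * a) + s * (t * b) \<in> ideal_power L J n"
      by (intro Jn(3,4) st)
    then have "s * t * (a + b) \<in> ideal_power L J n" by (simp only: distrib_left mult_ac)
    ultimately show "\<exists>s\<in>carrier ?R. s \<notin> P \<and> s * (a + b) \<in> ideal_power L J n"
      using carrier_pring_closed(2)[OF st(1,4)] by blast
  qed
  show "r * a \<in> ?S" if ra: "r \<in> carrier ?R" "a \<in> ?S" for r a
    unfolding mem_symbolic_power
  proof (intro conjI ballI)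
    have "a \<in> carrier ?R" using ra(2) unfolding mem_symbolic_power by blast
    then show "r * a \<in> carrier ?R" by (rule carrier_pring_closed(2)[OF ra(1)])
    fix P assume P: "P \<in> associated_primes ?R J"
    obtain s where s: "s \<in> carrier ?R" "s \<notin> P" "s * a \<in> ideal_power L J n"
      using ra P unfolding mem_symbolic_power by blast
    have "r * (s * a) \<in> ideal_power L J n" by (rule Jn(4)[OF ra(1) s(3)])
    then have "s * (r * a) \<in> ideal_power L J n" by (simp only: mult.left_commute)
    then show "\<exists>s\<in>carrier ?R. s \<notin> P \<and> s * (r * a) \<in> ideal_power L J n" using s by blast
  qed
qed

section \<open>Symbolic powers of the ideal and of its initial ideal\<close>

text \<open>The grading by \<open>odeg F\<close>: the coefficient at \<open>k\<close> is the part of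
  the polynomial of degree \<open>k\<close> outside \<open>F\<close>.\<close>

definition split_poly :: "(nat \<times> nat) set \<Rightarrow> 'k::comm_ring_1 mpol \<Rightarrow> 'k mpol poly" where
  "split_poly F = insertion (\<lambda>c. [:single 0 c:]) (\<lambda>e. if e \<in> F then [:var e:] else [:0, var e:])"

lemma split_poly_hom: "comm_ring_hom (split_poly F)"
  unfolding split_poly_def by (rule insertion_hom[OF const_single_hom])

lemma split_poly_cmono: "split_poly F (single (cmono xs) 1) = monom (single (cmono xs) 1) (odeg F (cmono xs))"
proof -
  interpret comm_ring_hom "split_poly F :: 'a mpol \<Rightarrow> _" by (rule split_poly_hom)
  show ?thesis
  proof (induction xs)
    case Nil
    have "split_poly F (single (cmono []) 1) = (1 :: 'a mpol poly)" by simp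
    also have "\<dots> = monom (single (cmono []) 1) (odeg F (cmono []))" by (simp add: monom_0 one_pCons)
    finally show ?case .
  next
    case (Cons e xs)
    have v: "split_poly F (var e) = monom (var e :: 'a mpol) (odeg F (single e 1))"
      by (simp add: split_poly_def insertion_var[OF const_single_hom] monom_0 monom_Suc)
    have "single (cmono (e # xs)) (1::'a) = var e * single (cmono xs) 1"
      by (simp add: cmono_Cons var_def mult_single)
    then have "split_poly F (single (cmono (e # xs)) (1::'a)) = split_poly F (var e) * split_poly F (single (cmono xs) 1)"
      by (simp only: hom_mult)
    also have "\<dots> = monom (var e * single (cmono xs) 1) (odeg F (single e 1) + odeg F (cmono xs))"
      by (simp only: v Cons.IH mult_monom)
    also have "\<dots> = monom (single (cmono (e # xs)) 1) (odeg F (cmono (e # xs)))"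
      by (simp only: cmono_Cons odeg_add var_def mult_single mult_1_left)
    finally show ?case .
  qed
qed

lemma lookup_coeff_split_poly:
  "lookup (coeff (split_poly F f) k) m = (if odeg F m = k then lookup f m else 0)"
proof (induction f rule: mpol_induct)
  case (single n c)
  interpret comm_ring_hom "split_poly F :: 'a mpol \<Rightarrow> _" by (rule split_poly_hom)
  obtain xs where n: "n = cmono xs" by (rule cmono_list)
  have "single n c = single 0 c * single n 1" by (simp add: mult_single)
  then have "split_poly F (single n c) = split_poly F (single 0 c) * split_poly F (single n 1)"
    by (simp only: hom_mult)
  also have "split_poly F (single 0 c) = [:single 0 c:]"
    by (simp add: split_poly_def insertion_single[OF const_single_hom])
  finally have "coeff (split_poly F (single n c)) k = (if odeg F n = k then single n c else 0)"
    by (simp add: n split_poly_cmono mult_single)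
  then show ?case by (auto simp: lookup_single when_def)
next
  case (add f g)
  interpret comm_ring_hom "split_poly F :: 'a mpol \<Rightarrow> _" by (rule split_poly_hom)
  show ?case using add by (simp add: hom_add lookup_add)
qed

lemma coeff_split_poly_eq_0_iff:
  "coeff (split_poly F f) k = 0 \<longleftrightarrow> (\<forall>m\<in>keys f. odeg F m \<noteq> k)"
proof -
  have "coeff (split_poly F f) k = 0 \<longleftrightarrow> (\<forall>m. lookup (coeff (split_poly F f) k) m = 0)"
    by (metis lookup_zero poly_mapping_eqI)
  then show ?thesis by (auto simp: lookup_coeff_split_poly in_keys_iff)
qed

text \<open>The product of the degree 0 part of \<open>s\<close> and the lowest part of
  \<open>f\<close> is nonzero and cannot be cancelled in \<open>s * f\<close>.\<close>

lemma odeg_cancel: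
  fixes s f :: "'k::field mpol"
  assumes s: "\<exists>m\<in>keys s. odeg F m = 0" and sf: "\<forall>m\<in>keys (s * f). n \<le> odeg F m"
  shows "\<forall>m\<in>keys f. n \<le> odeg F m"
proof -
  interpret comm_ring_hom "split_poly F :: 'k mpol \<Rightarrow> _" by (rule split_poly_hom)
  let ?p = "split_poly F s" and ?q = "split_poly F f"
  have p0: "coeff ?p 0 \<noteq> 0" using s by (simp add: coeff_split_poly_eq_0_iff)
  have "coeff ?q k = 0" if "k < n" for k
    using that
  proof (induction k rule: less_induct)
    case (less k)
    have "coeff (?p * ?q) k = 0"
      using sf less.prems by (simp only: hom_mult[symmetric] coeff_split_poly_eq_0_iff) fastforce
    moreover have "coeff (?p * ?q) k = (\<Sum>i\<le>k. coeff ?p i * coeff ?q (k - i))" by (rule coeff_mult)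
    also have "\<dots> = coeff ?p 0 * coeff ?q k + (\<Sum>i\<in>{..k} - {0}. coeff ?p i * coeff ?q (k - i))"
      by (subst sum.remove[of _ 0]) simp_all
    also have "(\<Sum>i\<in>{..k} - {0}. coeff ?p i * coeff ?q (k - i)) = 0"
      by (rule sum.neutral) (use less in auto)
    ultimately have "coeff ?p 0 * coeff ?q k = 0" by simp
    then show ?case using p0 by simp
  qed
  then have "odeg F m \<noteq> k" if "k < n" "m \<in> keys f" for k m
    using that unfolding coeff_split_poly_eq_0_iff by blast
  then show ?thesis using not_less by blast
qed

lemma odeg_eq_0_iff: "odeg F m = 0 \<longleftrightarrow> keys m \<subseteq> F"
  by (auto simp: odeg_def in_keys_iff)

lemma keys_shift: "m + n \<in> keys (single n 1 * f) \<longleftrightarrow> m \<in> keys f" for f :: "'k::comm_ring_1 mpol"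
  using lookup_mult_single[of n 1 f m] by (simp add: in_keys_iff)

context antidiagonal_conditions
begin

abbreviation RR :: "'k mpol ring" where "RR \<equiv> poly_ring_on L"

text \<open>The contraction of \<open>I\<close> to the polynomial ring of the ladder;
  \<open>mixed_ideal_eq_IR\<close> identifies it with the mixed ladder determinantal ideal.\<close>

definition IR :: "'k mpol set" where "IR = I \<inter> R"

lemma IR_ideal: "ideal IR RR"
proof (rule ideal_pringI)
  show "a + b \<in> IR" if "a \<in> IR" "b \<in> IR" for a b
    using that R_add[of a b] gen_ideal_add[of a _ b] unfolding IR_def by blast
  show "r * a \<in> IR" if "r \<in> carrier RR" "a \<in> IR" for r a
    using that R_mult[of r a] gen_ideal_mult[of a _ r] unfolding IR_def pring_simps(1) by blast
qed (simp_all add: IR_def gen_ideal_0 subset_iff)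

lemma IR_prime: "primeideal IR RR"
proof (rule primeidealI[OF IR_ideal cring_pring])
  have "1 \<notin> IR" using I_prime by (simp add: IR_def prime_set_def)
  then show "carrier RR \<noteq> IR" using R_1 by auto
  fix a b assume "a \<in> carrier RR" "b \<in> carrier RR" "a \<otimes>\<^bsub>RR\<^esub> b \<in> IR"
  then show "a \<in> IR \<or> b \<in> IR" using I_prime by (auto simp: IR_def prime_set_def)
qed

text \<open>For a prime ideal, the colon ideal of \<open>x\<close> is everything if \<open>x\<close>
  lies in the ideal and the ideal itself otherwise. So membership in a symbolic power is tested by a
  single multiplier \<open>s\<close>.\<close>

lemma associated_primes_IR: "associated_primes RR IR = {IR}"
proof (intro equalityI subsetI)
  fix P assume "P \<in> associated_primes RR IR"
  then obtain x where P: "primeideal P RR" and x: "x \<in> R" "P = {a \<in> R. a * x \<in> IR}"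
    by (auto simp: associated_primes_def)
  have "x \<notin> I"
  proof
    assume "x \<in> I"
    then have "P = carrier RR" using x R_mult by (auto simp: IR_def intro: gen_ideal_mult)
    then show False using primeideal.I_notcarr[OF P] by simp
  qed
  then have "P = IR" using x I_prime R_mult unfolding IR_def prime_set_def by (auto intro: gen_ideal_mult')
  then show "P \<in> {IR}" by simp
next
  fix P assume "P \<in> {IR}"
  moreover have "IR = {a \<in> carrier RR. a \<otimes>\<^bsub>RR\<^esub> 1 \<in> IR}" by (auto simp: IR_def)
  ultimately show "P \<in> associated_primes RR IR"
    using IR_prime R_1 unfolding associated_primes_def pring_simps(1) by blast
qed

lemma mem_symbolic_IR:
  "f \<in> symbolic_power RR IR n \<longleftrightarrow> f \<in> R \<and> (\<exists>s\<in>R. s \<notin> I \<and> s * f \<in> ideal_power L IR n)"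
  unfolding mem_symbolic_power associated_primes_IR pring_simps(1) by (auto simp: IR_def)

lemma taylor_ideal_power:
  "f \<in> ideal_power L IR n \<Longrightarrow> taylor F f \<in> low_coeffs_in I n"
proof (induction n arbitrary: f)
  case 0
  show ?case by (simp add: low_coeffs_in_def)
next
  case (Suc n)
  interpret comm_ring_hom "taylor F :: 'k mpol \<Rightarrow> _" by (rule taylor_hom)
  from Suc.prems have "f \<in> ideal_prod RR (ideal_power L IR n) IR" by (simp only: ideal_power_Suc)
  then show ?case
  proof (induction f rule: ideal_prod.induct)
    case (prod i j)
    have "j \<in> I" using prod.hyps(2) by (simp add: IR_def)
    then have "taylor F j \<in> low_coeffs_in I 1"
      by (simp add: low_coeffs_in_def mdeg_eq_0_iff taylor_coeff_0)
    from low_coeffs_in_mult[OF Suc.IH[OF prod.hyps(1)] this] show ?case by (simp only: pring_simps hom_mult)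
  next
    case (sum s1 s2)
    then show ?case by (simp add: low_coeffs_in_def hom_add lookup_add gen_ideal_add)
  qed
qed

lemma split_monomial:
  obtains a b where "m = b + a" "keys b \<subseteq> F" "keys a \<inter> F = {}" "mdeg a = odeg F m"
proof -
  obtain xs where m: "m = cmono xs" by (rule cmono_list)
  let ?a = "cmono (filter (\<lambda>e. e \<notin> F) xs)" and ?b = "cmono (filter (\<lambda>e. e \<in> F) xs)"
  have "m = ?b + ?a" unfolding m
    by (rule poly_mapping_eqI) (simp add: lookup_add lookup_cmono, induct_tac xs, auto)
  moreover have "mdeg ?a = odeg F m" by (simp add: m mdeg_cmono odeg_cmono)
  ultimately show ?thesis by (intro that[of ?b ?a]) (auto simp: keys_cmono)
qed

lemma lead_symbolic_odeg:
  assumes f: "f \<in> symbolic_power RR IR n" "f \<noteq> 0" and F: "face L U F"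
  shows "n \<le> odeg F (lead f)"
proof (rule ccontr)
  assume less: "\<not> n \<le> odeg F (lead f)"
  obtain s where s: "f \<in> R" "s \<notin> I" "s * f \<in> ideal_power L IR n" using f(1) by (auto simp: mem_symbolic_IR)
  obtain a b where ab: "lead f = b + a" "keys b \<subseteq> F" "keys a \<inter> F = {}" "mdeg a = odeg F (lead f)"
    by (rule split_monomial)
  interpret comm_ring_hom "taylor F :: 'k mpol \<Rightarrow> _" by (rule taylor_hom)
  have "taylor F s * taylor F f \<in> low_coeffs_in I n"
    using taylor_ideal_power[OF s(3), of F] by (simp only: hom_mult)
  then have "taylor F f \<in> low_coeffs_in I n"
    by (rule low_coeffs_in_cancel[OF I_prime, rotated]) (use s(2) in \<open>simp add: taylor_coeff_0\<close>)
  then have D: "lookup (taylor F f) a \<in> I" using less ab(4) by (simp add: low_coeffs_in_def)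
  let ?D = "lookup (taylor F f) a"
  have lf: "lead f \<in> keys f" "\<And>k. k \<in> keys f \<Longrightarrow> k \<preceq> lead f"
    using lead_in_keys[OF s(1) f(2)] lead_max[OF s(1) f(2)] by auto
  have sup: "k + a \<in> keys f" if "k \<in> keys ?D" for k by (rule taylor_support[OF that])
  have b: "b \<in> keys ?D" using taylor_lead[OF ab(2,3), of f] lf(1) ab(1) by (simp add: in_keys_iff)
  have DR: "?D \<in> R" using sup s(1) monomials_add by blast
  \<comment> \<open>Removing the common factor \<open>a\<close> preserves the order, so
    \<open>b\<close> leads the Taylor coefficient just as \<open>b + a\<close> leads
    \<open>f\<close>.\<close>
  have "lead ?D = b"
  proof (rule lead_eqI[OF b])
    fix k assume "k \<in> keys ?D"
    then have "k + a \<preceq> b + a" using sup lf(2) ab(1) by metis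
    then show "k \<preceq> b" by (rule le_add_cancel)
  qed
  moreover have "?D \<noteq> 0" using b by auto
  ultimately have "\<not> face L U (keys b)" using lead_nonface[OF D DR] by simp
  then show False using face_mono[OF F ab(2)] by simp
qed

text \<open>The Stanley-Reisner ideal of the complex of faces.\<close>

definition JJ :: "'k mpol set" where "JJ = {f \<in> R. \<forall>m\<in>keys f. \<not> face L U (keys m)}"

lemma nonface_add: "\<not> face L U (keys m) \<Longrightarrow> \<not> face L U (keys (m + n))" for m n :: monomial
  using face_mono[of L U "keys (m + n)" "keys m"] unfolding keys_add_nat by blast

lemma JJ_ideal: "ideal JJ RR"
proof (rule ideal_pringI)
  show "a + b \<in> JJ" if "a \<in> JJ" "b \<in> JJ" for a b
    using that R_add[of a b] keys_add[of a b] by (auto simp: JJ_def)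
  show "r * a \<in> JJ" if ra: "r \<in> carrier RR" "a \<in> JJ" for r a
  proof -
    have "\<not> face L U (keys m)" if m: "m \<in> keys (r * a)" for m
    proof -
      obtain x y where "y \<in> keys a" "m = x + y" using keys_mult[of r a] m by blast
      then show ?thesis using nonface_add[of y x] ra(2) by (auto simp: JJ_def add.commute)
    qed
    then show ?thesis using ra R_mult[of r a] by (simp add: JJ_def)
  qed
qed (auto simp: JJ_def)

lemma initial_ideal_eqI:
  assumes "ideal H RR" "\<And>f. f \<in> A \<Longrightarrow> f \<noteq> 0 \<Longrightarrow> single (lead f) 1 \<in> H"
    and "A \<subseteq> R" "\<And>f m. f \<in> H \<Longrightarrow> m \<in> keys f \<Longrightarrow> \<exists>g\<in>A. g \<noteq> 0 \<and> lead g = m"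
  shows "initial_ideal L ord A = H"
proof
  interpret cring RR by (rule cring_pring)
  let ?G = "{single (lead f) 1 | f. f \<in> A \<and> f \<noteq> 0}"
  show "initial_ideal L ord A \<subseteq> H"
    unfolding initial_ideal_def by (rule genideal_minimal[OF assms(1)]) (use assms(2) in auto)
  have G: "?G \<subseteq> carrier RR"
    using lead_in_keys assms(3) by fastforce
  have id: "ideal (Idl\<^bsub>RR\<^esub> ?G) RR" by (rule genideal_ideal[OF G])
  show "H \<subseteq> initial_ideal L ord A"
    unfolding initial_ideal_def
  proof
    fix f assume f: "f \<in> H"
    have "single 0 (lookup f m) * single m 1 \<in> Idl\<^bsub>RR\<^esub> ?G" if m: "m \<in> keys f" for m
    proof (rule ideal_pringD(4)[OF id])
      show "single 0 (lookup f m) \<in> carrier RR" by (simp add: monomials_def)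
      have "single m 1 \<in> ?G" using assms(4)[OF f m] by auto
      then show "single m 1 \<in> Idl\<^bsub>RR\<^esub> ?G" using genideal_self[OF G] by blast
    qed
    then have "(\<Sum>m\<in>keys f. single 0 (lookup f m) * single m 1) \<in> Idl\<^bsub>RR\<^esub> ?G"
      by (rule ideal_pring_sum[OF id])
    then show "f \<in> Idl\<^bsub>RR\<^esub> ?G" using sum_single_lookup[of f] by (simp add: mult_single)
  qed
qed

lemma initial_IR: "initial_ideal L ord IR = JJ"
proof (rule initial_ideal_eqI[OF JJ_ideal])
  fix f :: "'k mpol" assume f: "f \<in> IR" "f \<noteq> 0"
  then have "\<not> face L U (keys (lead f))" "lead f \<in> keys f" "f \<in> R"
    using lead_nonface[of f] lead_in_keys[of f] by (auto simp: IR_def)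
  then show "single (lead f) 1 \<in> JJ" by (auto simp: JJ_def)
next
  fix f m assume "f \<in> JJ" "m \<in> keys f"
  then have m: "m \<in> monomials L" "\<not> face L U (keys m)" by (auto simp: JJ_def)
  obtain h :: "'k mpol" where "h \<in> I" "h \<in> R" "h \<noteq> 0" "lead h = m"
    using nonface_element[OF subset_refl goodU m] by metis
  then show "\<exists>g\<in>IR. g \<noteq> 0 \<and> lead g = m" by (auto simp: IR_def)
qed (auto simp: IR_def)

text \<open>Enlarge \<open>F\<close> within \<open>L\<close> to a facet \<open>F'\<close>. The
  entries outside \<open>F'\<close> generate an associated prime, the colon ideal of the product of
  the entries of \<open>F'\<close>. Elements of the \<open>n\<close>-th power have degree at least
  \<open>n\<close> outside \<open>F'\<close>, and a multiplier outside this prime is cancelled by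
  \<open>odeg_cancel\<close>.\<close>

lemma odeg_symbolic_JJ:
  assumes f: "f \<in> symbolic_power RR JJ n" "m \<in> keys f" and F: "face L U F"
  shows "n \<le> odeg F m"
proof -
  have fR: "f \<in> R" using f(1) unfolding mem_symbolic_power by simp
  let ?\<F> = "{F'. F' \<subseteq> L \<and> face L U F' \<and> F \<inter> L \<subseteq> F'}"
  have fin: "finite ?\<F>" by (rule finite_subset[of _ "Pow L"]) (use finL in auto)
  have "F \<inter> L \<in> ?\<F>" using face_mono[OF F] by auto
  then obtain F' where F': "F' \<in> ?\<F>" "\<And>H. H \<in> ?\<F> \<Longrightarrow> F' \<subseteq> H \<Longrightarrow> F' = H"
    using finite_has_maximal[OF fin] by (metis (no_types, lifting) empty_iff)
  define P where "P = {a \<in> R. \<forall>b\<in>keys a. \<not> keys b \<subseteq> F'}"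
  have notP: "a \<notin> P \<longleftrightarrow> coeff (split_poly F' a) 0 \<noteq> 0" if "a \<in> R" for a
    using that by (simp add: P_def coeff_split_poly_eq_0_iff odeg_eq_0_iff)
  interpret sp: comm_ring_hom "split_poly F' :: 'k mpol \<Rightarrow> _" by (rule split_poly_hom)
  have "primeideal P RR"
  proof (rule primeidealI[OF _ cring_pring])
    show "ideal P RR"
    proof (rule ideal_pringI)
      show "a + b \<in> P" if "a \<in> P" "b \<in> P" for a b
        using that R_add[of a b] keys_add[of a b] by (auto simp: P_def)
      show "r * a \<in> P" if ra: "r \<in> carrier RR" "a \<in> P" for r a
      proof -
        have "r * a \<in> R" "r \<in> R" "a \<in> R" using ra R_mult[of r a] by (auto simp: P_def)
        then show ?thesis using notP[of "r * a"] notP[of a] ra(2) by (auto simp: sp.hom_mult coeff_mult)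
      qed
    qed (auto simp: P_def)
    have "1 \<notin> P" using notP[OF R_1] by simp
    then show "carrier RR \<noteq> P" using R_1 by auto
    fix a b assume "a \<in> carrier RR" "b \<in> carrier RR" "a \<otimes>\<^bsub>RR\<^esub> b \<in> P"
    then have ab: "a \<in> R" "b \<in> R" "a * b \<in> P" by auto
    then have "coeff (split_poly F' (a * b)) 0 = 0" using notP[OF R_mult[OF ab(1,2)]] by blast
    then have "coeff (split_poly F' a) 0 * coeff (split_poly F' b) 0 = 0" by (simp add: sp.hom_mult coeff_mult)
    then show "a \<in> P \<or> b \<in> P" using notP ab by auto
  qed
  moreover have "P = {a \<in> carrier RR. a \<otimes>\<^bsub>RR\<^esub> single (\<Sum>e\<in>F'. single e 1) 1 \<in> JJ}"
  proof -
    let ?w = "\<Sum>e\<in>F'. single e (1::nat)"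
    have finF': "finite F'" using F'(1) finL finite_subset by blast
    then have w: "keys ?w = F'" by (simp add: keys_sum_nat)
    \<comment> \<open>By maximality of the facet, a monomial that leaves \<open>F'\<close> becomes a
      nonface when multiplied by all entries of \<open>F'\<close>.\<close>
    have key: "\<not> keys b \<subseteq> F' \<longleftrightarrow> \<not> face L U (keys (b + ?w))" if b: "b \<in> monomials L" for b
    proof
      assume "\<not> keys b \<subseteq> F'"
      then have "F' \<noteq> keys b \<union> F'" by blast
      moreover have "keys b \<union> F' \<subseteq> L" "F \<inter> L \<subseteq> keys b \<union> F'" using F'(1) b by (auto simp: monomials_def)
      ultimately have "\<not> face L U (keys b \<union> F')" using F'(2)[of "keys b \<union> F'"] by blast
      then show "\<not> face L U (keys (b + ?w))" unfolding keys_add_nat w .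
    next
      assume nf: "\<not> face L U (keys (b + ?w))"
      show "\<not> keys b \<subseteq> F'"
      proof
        assume "keys b \<subseteq> F'"
        then have "keys (b + ?w) = F'" unfolding keys_add_nat w by (rule Un_absorb1)
        then show False using nf F'(1) by simp
      qed
    qed
    have wm: "?w \<in> monomials L" using F'(1) unfolding monomials_def mem_Collect_eq w by blast
    have "a \<in> P \<longleftrightarrow> a * single ?w 1 \<in> JJ" if a: "a \<in> R" for a
    proof -
      have "a * single ?w 1 \<in> R" by (rule R_mult[OF a R_single[OF wm]])
      moreover have "keys (single ?w 1 * a) = (\<lambda>b. b + ?w) ` keys a"
        using keys_mult_single[of ?w 1 a] keys_shift[of _ ?w a] by auto
      ultimately show ?thesis using key a by (auto simp: P_def JJ_def mult.commute subset_iff)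
    qed
    then show ?thesis by (auto simp: P_def)
  qed
  moreover have "single (\<Sum>e\<in>F'. single e 1) 1 \<in> carrier RR"
  proof -
    have "finite F'" using F'(1) finL finite_subset by blast
    then show ?thesis using F'(1) by (simp add: monomials_def keys_sum_nat)
  qed
  ultimately have "P \<in> associated_primes RR JJ" unfolding associated_primes_def by blast
  then obtain s where s: "s \<in> R" "s \<notin> P" "s * f \<in> ideal_power L JJ n"
    using f(1) unfolding mem_symbolic_power by auto
  have power: "\<forall>m\<in>keys g. n \<le> odeg F' m" if "g \<in> ideal_power L JJ n" for g n
    using that
  proof (induction n arbitrary: g)
    case (Suc n)
    from Suc.prems have "g \<in> ideal_prod RR (ideal_power L JJ n) JJ" by (simp only: ideal_power_Suc)
    then show ?case
    proof (induction g rule: ideal_prod.induct)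
      case (prod i j)
      show ?case
      proof
        fix m assume "m \<in> keys (i \<otimes>\<^bsub>RR\<^esub> j)"
        then obtain a b where ab: "a \<in> keys i" "b \<in> keys j" "m = a + b" using keys_mult[of i j] by auto
        have "\<not> keys b \<subseteq> F'" using prod.hyps(2) ab(2) face_mono[of L U F' "keys b"] F'(1) by (auto simp: JJ_def)
        then have "0 < odeg F' b" using odeg_eq_0_iff[of F' b] by simp
        moreover have "n \<le> odeg F' a" using Suc.IH[OF prod.hyps(1)] ab(1) by blast
        ultimately show "Suc n \<le> odeg F' m" by (simp add: ab(3) odeg_add)
      qed
    next
      case (sum g h)
      then show ?case using keys_add[of g h] by auto
    qed
  qed simp
  have "\<exists>m\<in>keys s. odeg F' m = 0" using s(1,2) by (auto simp: P_def odeg_eq_0_iff)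
  then have "\<forall>m\<in>keys f. n \<le> odeg F' m" by (rule odeg_cancel) (rule power[OF s(3)])
  then have "n \<le> odeg F' m" using f(2) by blast
  also have "\<dots> \<le> odeg F m"
    by (rule odeg_antimono) (use F'(1) f(2) fR in \<open>auto simp: monomials_def\<close>)
  finally show ?thesis .
qed

text \<open>An associated prime \<open>P\<close> is the colon ideal of some \<open>x\<close>, which
  has a face monomial \<open>w\<close>. An entry in \<open>P\<close> times \<open>w\<close> is a
  nonface. Hence a power of \<open>w\<close> is the required multiplier: each factor of
  \<open>m\<close> in \<open>P\<close> absorbs one \<open>w\<close> and yields an element of
  \<open>JJ\<close>.\<close>

lemma monomial_symbolic_JJ:
  assumes m: "m \<in> monomials L" and F: "\<And>F. face L U F \<Longrightarrow> n \<le> odeg F m"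
  shows "single m 1 \<in> symbolic_power RR JJ n"
  unfolding mem_symbolic_power
proof (intro conjI ballI)
  show "single m 1 \<in> carrier RR" using m by simp
  fix P assume P: "P \<in> associated_primes RR JJ"
  obtain x where prime: "primeideal P RR" and x: "x \<in> R" "P = {a \<in> R. a * x \<in> JJ}"
    using P by (auto simp: associated_primes_def)
  interpret P: primeideal P RR by (rule prime)
  have P1: "1 \<notin> P" using P.one_imp_carrier P.I_notcarr by auto
  have Pprime: "a \<in> P \<or> b \<in> P" if "a \<in> R" "b \<in> R" "a * b \<in> P" for a b
    using P.I_prime[of a b] that by auto
  have mono_prime: "\<exists>e\<in>set xs. var e \<in> P" if "set xs \<subseteq> L" "single (cmono xs) 1 \<in> P" for xs
    using that
  proof (induction xs)
    case Nil
    then show ?case using P1 by simp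
  next
    case (Cons e xs)
    have "single (cmono (e # xs)) 1 = var e * single (cmono xs) 1"
      by (simp only: cmono_Cons var_def mult_single mult_1_left)
    moreover have "var e \<in> R" "single (cmono xs) 1 \<in> R"
      using Cons.prems(1) by (auto simp: var_def monomials_def keys_cmono)
    ultimately have "var e \<in> P \<or> single (cmono xs) 1 \<in> P" using Pprime Cons.prems(2) by metis
    then show ?case using Cons by auto
  qed
  have "x \<notin> JJ" using P1 x R_1 by auto
  then obtain w where w: "w \<in> keys x" "face L U (keys w)" using x(1) by (auto simp: JJ_def)
  have wm: "w \<in> monomials L" using w(1) x(1) by auto
  \<comment> \<open>These entries form a face: the monomial of a forbidden chain multiplies
    \<open>x\<close> into \<open>JJ\<close>, so it lies in \<open>P\<close>, and then so does one of
    its entries.\<close>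
  define F' where "F' = {e \<in> L. var e \<notin> P}"
  have nf: "\<not> face L U (keys (w + single e 1))" if "e \<in> L" "e \<notin> F'" for e
  proof -
    have "var e * x \<in> JJ" using that x(2) by (auto simp: F'_def)
    moreover have "w + single e 1 \<in> keys (var e * x)" using keys_shift[of w "single e 1" x] w(1) by (simp add: var_def)
    ultimately show ?thesis by (auto simp: JJ_def)
  qed
  have wF: "keys w \<subseteq> F'"
  proof
    fix e assume e: "e \<in> keys w"
    then have "keys (w + single e 1) = keys w" by (auto simp: keys_add_nat)
    moreover have "e \<in> L" using e wm by (auto simp: monomials_def)
    ultimately show "e \<in> F'" using nf[of e] w(2) by auto
  qed
  have face: "face L U F'"
  proof (rule ccontr)
    assume "\<not> face L U F'"
    then obtain u c where c: "(u, length c) \<in> U" "chain c" "set c \<subseteq> F'" "set c \<subseteq> subladder L u"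
      by (rule not_faceE)
    have cL: "set c \<subseteq> L" using c(4) subladder_subset by blast
    have "\<not> face L U (keys (cmono c))"
      using faceD[of L U "set c" u "length c" c] c by (auto simp: keys_cmono)
    then have "single (cmono c) 1 \<in> JJ" using cL by (auto simp: JJ_def cmono_in_monomials)
    then have "x * single (cmono c) 1 \<in> JJ" using ideal_pringD(4)[OF JJ_ideal, of x] x(1) by simp
    then have "single (cmono c) 1 \<in> P" using x(2) cL by (simp add: mult.commute cmono_in_monomials)
    then obtain e where "e \<in> set c" "var e \<in> P" using mono_prime cL by blast
    then show False using c(3) by (auto simp: F'_def)
  qed
  define k where "k = odeg F' m"
  have "single w 1 ^ j \<notin> P" for j
  proof (induction j)
    case 0
    then show ?case using P1 by simp
  next
    case (Suc j)
    obtain ws where ws: "w = cmono ws" by (rule cmono_list)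
    have "set ws \<subseteq> L" using wm by (simp add: ws monomials_def keys_cmono)
    then have "single w 1 \<notin> P"
      using mono_prime[of ws] wF by (auto simp: ws keys_cmono F'_def)
    then show ?case
      using Suc Pprime[OF R_single[OF wm] R_power[OF R_single[OF wm]], of 1 1 j] by auto
  qed
  moreover have "single w 1 ^ k * single m 1 \<in> ideal_power L JJ n"
  proof -
    obtain xs where xs: "m = cmono xs" by (rule cmono_list)
    have "set xs \<subseteq> L" using m by (simp add: xs monomials_def keys_cmono)
    then have "single w 1 ^ odeg F' (cmono xs) * single (cmono xs) 1 \<in> ideal_power L JJ (odeg F' (cmono xs))"
    proof (induction xs)
      case Nil
      have "single w 1 ^ odeg F' (cmono []) * single (cmono []) 1 = (1 :: 'k mpol)" by simp
      moreover have "ideal_power L JJ (odeg F' (cmono [])) = carrier RR" by (simp only: cmono_Nil odeg_0 ideal_power_0)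
      ultimately show ?case using R_1 by (simp only: pring_simps)
    next
      case (Cons e xs)
      let ?y = "single w 1 ^ odeg F' (cmono xs) * single (cmono xs) 1 :: 'k mpol"
      have IH: "?y \<in> ideal_power L JJ (odeg F' (cmono xs))" using Cons by simp
      have eq: "single (cmono (e # xs)) (1::'k) = var e * single (cmono xs) 1"
        by (simp only: cmono_Cons var_def mult_single mult_1_left)
      have eL: "e \<in> L" using Cons.prems by simp
      show ?case
      proof (cases "e \<in> F'")
        case True
        have "var e * ?y \<in> ideal_power L JJ (odeg F' (cmono xs))"
          by (rule ideal_pringD(4)[OF ideal_ideal_power[OF JJ_ideal] _ IH]) (use eL in \<open>simp add: var_def monomials_def\<close>)
        moreover have "odeg F' (cmono (e # xs)) = odeg F' (cmono xs)" using True by (simp add: cmono_Cons odeg_add)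
        ultimately show ?thesis by (simp only: eq mult.left_commute)
      next
        case False
        have "single (w + single e 1) 1 \<in> JJ"
          using nf[OF eL False] wm eL by (auto simp: JJ_def monomials_add) (simp add: monomials_def)
        then have "single w 1 * var e \<in> JJ" by (simp only: var_def mult_single mult_1_left)
        from ideal_power_Suc_mult[OF IH this]
        have "?y * (single w 1 * var e) \<in> ideal_power L JJ (Suc (odeg F' (cmono xs)))" .
        moreover have od: "odeg F' (cmono (e # xs)) = Suc (odeg F' (cmono xs))"
          using False by (simp add: cmono_Cons odeg_add)
        ultimately show ?thesis unfolding od eq power_Suc by (simp only: mult_ac)
      qed
    qed
    then have "single w 1 ^ k * single m 1 \<in> ideal_power L JJ k" by (simp only: k_def xs)
    moreover have "n \<le> k" using F[OF face] by (simp add: k_def)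
    ultimately show ?thesis using ideal_power_mono_exp[OF JJ_ideal] by blast
  qed
  moreover have "single w 1 ^ k \<in> carrier RR" using R_power[OF R_single[OF wm]] by simp
  ultimately show "\<exists>s\<in>carrier RR. s \<notin> P \<and> s * single m 1 \<in> ideal_power L JJ n" by blast
qed

end

section \<open>Chain packings\<close>

fun path_weight :: "('a \<Rightarrow> 'a \<Rightarrow> int) \<Rightarrow> 'a list \<Rightarrow> int" where
  "path_weight l (x # y # zs) = l x y + path_weight l (y # zs)"
| "path_weight l _ = 0"

lemma path_weight_snoc: "p \<noteq> [] \<Longrightarrow> path_weight l (p @ [y]) = path_weight l p + l (last p) y"
proof (induction p)
  case (Cons x p)
  then show ?case by (cases p) simp_all
qed simp

lemma path_weight_append: "path_weight l (p @ y # q) = path_weight l (p @ [y]) + path_weight l (y # q)"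
proof (induction p)
  case (Cons x p)
  show ?case
  proof (cases p)
    case (Cons z p')
    then show ?thesis using Cons.IH by simp
  qed simp
qed simp

text \<open>The potential of \<open>y\<close> is the largest weight of a simple path ending in
  \<open>y\<close>. Extending a path to a vertex already on it closes a cycle, which can be cut off
  because its weight is at most 0.\<close>

lemma potentials_exist:
  fixes l :: "'a \<Rightarrow> 'a \<Rightarrow> int"
  assumes fin: "finite P"
    and cyc: "\<And>y zs. distinct (y # zs) \<Longrightarrow> set (y # zs) \<subseteq> P \<Longrightarrow> path_weight l (y # zs) + l (last (y # zs)) y \<le> 0"
  shows "\<exists>\<pi>. \<forall>x\<in>P. \<forall>y\<in>P. \<pi> x + l x y \<le> \<pi> y"
proof -
  define paths where "paths y = {p. distinct p \<and> set p \<subseteq> P \<and> p \<noteq> [] \<and> last p = y}" for y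
  have fin_paths: "finite (paths y)" for y
  proof (rule finite_subset[OF _ finite_lists_length_le[OF fin, of "card P"]])
    show "paths y \<subseteq> {p. set p \<subseteq> P \<and> length p \<le> card P}"
    proof
      fix p assume "p \<in> paths y"
      then have "distinct p" "set p \<subseteq> P" by (simp_all add: paths_def)
      then show "p \<in> {p. set p \<subseteq> P \<and> length p \<le> card P}"
        using distinct_card[of p] card_mono[OF fin, of "set p"] by simp
    qed
  qed
  define \<pi> where "\<pi> y = Max (path_weight l ` paths y)" for y
  have upper: "path_weight l p \<le> \<pi> y" if "p \<in> paths y" for p y
    unfolding \<pi>_def using fin_paths that by (intro Max_ge) auto
  show ?thesis
  proof (intro exI ballI)
    fix x y assume xy: "x \<in> P" "y \<in> P"
    have "[x] \<in> paths x" using xy by (simp add: paths_def)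
    then have "path_weight l ` paths x \<noteq> {}" by blast
    then have "\<pi> x \<in> path_weight l ` paths x" unfolding \<pi>_def using fin_paths by (intro Max_in) auto
    then obtain p where p: "p \<in> paths x" "\<pi> x = path_weight l p" by blast
    have pw: "\<pi> x + l x y = path_weight l (p @ [y])"
      using p path_weight_snoc[of p l y] by (simp add: paths_def)
    show "\<pi> x + l x y \<le> \<pi> y"
    proof (cases "y \<in> set p")
      case False
      then have "p @ [y] \<in> paths y" using p(1) xy by (simp add: paths_def)
      then show ?thesis using upper pw by simp
    next
      case True
      then obtain p1 p2 where p12: "p = p1 @ y # p2" by (auto dest: split_list)
      have "path_weight l (p @ [y]) = path_weight l (p1 @ [y]) + path_weight l ((y # p2) @ [y])"
        unfolding p12 using path_weight_append[of l p1 y "p2 @ [y]"] by simp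
      also have "path_weight l ((y # p2) @ [y]) = path_weight l (y # p2) + l (last (y # p2)) y"
        by (rule path_weight_snoc) simp
      also have "\<dots> \<le> 0"
        by (rule cyc) (use p(1) in \<open>auto simp: paths_def p12\<close>)
      also have "path_weight l (p1 @ [y]) \<le> \<pi> y"
        by (rule upper) (use p(1) in \<open>auto simp: paths_def p12\<close>)
      finally show ?thesis using pw by simp
    qed
  qed
qed

lemma path_weight_rotate:
  "sum_list (map2 l (y # zs) (zs @ [w])) = path_weight l (y # zs) + l (last (y # zs)) w"
  by (induction zs arbitrary: y) auto

text \<open>Take an optimal permutation. A cycle of positive exchange weight \<open>l\<close> could
  be composed with it to improve it, so potentials for \<open>l\<close> exist; they give a dual
  solution that is tight along the permutation.\<close>

lemma max_weight_duality:
  fixes w :: "'a \<Rightarrow> 'a \<Rightarrow> int"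
  assumes fin: "finite P"
  obtains \<sigma> u v where "\<sigma> permutes P" "\<And>x y. x \<in> P \<Longrightarrow> y \<in> P \<Longrightarrow> w x y \<le> u x + v y"
    "(\<Sum>x\<in>P. w x (\<sigma> x)) = (\<Sum>x\<in>P. u x + v x)"
proof -
  let ?W = "\<lambda>\<sigma>. \<Sum>x\<in>P. w x (\<sigma> x)"
  have finp: "finite {\<sigma>. \<sigma> permutes P}" by (rule finite_permutations[OF fin])
  have nonempty: "{\<sigma>. \<sigma> permutes P} \<noteq> {}" using permutes_id by blast
  have "Max (?W ` {\<sigma>. \<sigma> permutes P}) \<in> ?W ` {\<sigma>. \<sigma> permutes P}"
    using finp nonempty by (intro Max_in) auto
  then obtain \<sigma> where \<sigma>: "\<sigma> permutes P" "Max (?W ` {\<sigma>. \<sigma> permutes P}) = ?W \<sigma>" by auto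
  have opt: "?W \<tau> \<le> ?W \<sigma>" if "\<tau> permutes P" for \<tau>
    unfolding \<sigma>(2)[symmetric] using finp that by (intro Max_ge) auto
  \<comment> \<open>The gain when \<open>x\<close> takes over the partner of
    \<open>y\<close>.\<close>
  define l where "l x y = w x (\<sigma> y) - w y (\<sigma> y)" for x y
  have perm: "(\<Sum>x\<in>P. l x (\<tau> x)) \<le> 0" if \<tau>: "\<tau> permutes P" for \<tau>
  proof -
    have "(\<Sum>x\<in>P. w (\<tau> x) (\<sigma> (\<tau> x))) = ?W \<sigma>"
      using sum.permute[OF \<tau>, of "\<lambda>x. w x (\<sigma> x)"] by (simp add: comp_def)
    moreover have "?W (\<sigma> \<circ> \<tau>) \<le> ?W \<sigma>" by (rule opt[OF permutes_compose[OF \<tau> \<sigma>(1)]])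
    ultimately show ?thesis by (simp add: l_def sum_subtractf)
  qed
  have "\<exists>\<pi>. \<forall>x\<in>P. \<forall>y\<in>P. \<pi> x + l x y \<le> \<pi> y"
  proof (rule potentials_exist[OF fin])
    fix y zs assume d: "distinct (y # zs)" "set (y # zs) \<subseteq> P"
    let ?c = "y # zs" and ?\<tau> = "cycle_of_list (y # zs)"
    have \<tau>: "?\<tau> permutes set ?c" by (rule cycle_permutes)
    have rot: "map ?\<tau> ?c = rotate1 ?c"
      using cyclic_rotation[of ?c 1] d(1) by simp
    have "(\<Sum>x\<in>P. l x (?\<tau> x)) = (\<Sum>x\<in>set ?c. l x (?\<tau> x))"
      by (rule sum.mono_neutral_right[OF fin d(2)]) (use permutes_not_in[OF \<tau>] in \<open>simp add: l_def\<close>)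
    also have "\<dots> = sum_list (map (\<lambda>x. l x (?\<tau> x)) ?c)" by (rule sum_list_distinct_conv_sum_set[OF d(1), symmetric])
    also have "map (\<lambda>x. l x (?\<tau> x)) ?c = map2 l ?c (map ?\<tau> ?c)"
      by (simp only: zip_map2 zip_same_conv_map map_map comp_def prod.case fst_conv snd_conv id_apply map_prod_simp)
    also have "sum_list (map2 l ?c (map ?\<tau> ?c)) = path_weight l ?c + l (last ?c) y"
      unfolding rot using path_weight_rotate[of l y zs y] by simp
    finally show "path_weight l ?c + l (last ?c) y \<le> 0"
      using perm[OF permutes_subset[OF \<tau> d(2)]] by simp
  qed
  then obtain \<pi> where \<pi>: "\<And>x y. x \<in> P \<Longrightarrow> y \<in> P \<Longrightarrow> \<pi> x + l x y \<le> \<pi> y" by blast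
  define u where "u x = - \<pi> x" for x
  let ?inv = "inv_into UNIV \<sigma>"
  define v where "v z = w (?inv z) z + \<pi> (?inv z)" for z
  have v\<sigma>: "v (\<sigma> y) = w y (\<sigma> y) + \<pi> y" for y
    by (simp add: v_def permutes_inverses(2)[OF \<sigma>(1)])
  show ?thesis
  proof (rule that[OF \<sigma>(1)])
    fix x z assume xz: "x \<in> P" "z \<in> P"
    let ?y = "?inv z"
    have y: "?y \<in> P" "\<sigma> ?y = z"
      using xz(2) permutes_in_image[OF permutes_inv[OF \<sigma>(1)]] permutes_inverses(1)[OF \<sigma>(1)] by auto
    show "w x z \<le> u x + v z"
      using \<pi>[OF xz(1) y(1)] v\<sigma>[of ?y] by (simp add: l_def u_def y(2))
  next
    have "(\<Sum>x\<in>P. v x) = (\<Sum>x\<in>P. v (\<sigma> x))" using sum.permute[OF \<sigma>(1), of v] by (simp add: comp_def)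
    then have "(\<Sum>x\<in>P. u x + v x) = (\<Sum>x\<in>P. u x + v (\<sigma> x))" by (simp add: sum.distrib)
    then show "?W \<sigma> = (\<Sum>x\<in>P. u x + v x)" by (simp add: v\<sigma> u_def)
  qed
qed

text \<open>Follow \<open>f\<close> along \<open>D\<close>. The induction removes a maximal element
  \<open>x\<close>; if \<open>x = f z\<close>, then \<open>z\<close> ends its list among the
  remaining elements, and \<open>x\<close> is appended there.\<close>

lemma chain_partition:
  fixes lt :: "'a \<Rightarrow> 'a \<Rightarrow> bool"
  assumes "finite P" "\<And>x. \<not> lt x x" "\<And>x y z. lt x y \<Longrightarrow> lt y z \<Longrightarrow> lt x z"
    "D \<subseteq> P" "inj_on f D" "f ` D \<subseteq> P" "\<And>x. x \<in> D \<Longrightarrow> lt x (f x)"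
  shows "\<exists>cs. distinct (concat cs) \<and> set (concat cs) = P \<and>
    (\<forall>c\<in>set cs. c \<noteq> [] \<and> successively (\<lambda>a b. a \<in> D \<and> b = f a) c \<and> last c \<notin> D)"
  using assms(1,4-7)
proof (induction "card P" arbitrary: P D)
  case 0
  then have "P = {}" by simp
  then show ?case by (intro exI[of _ "[]"]) simp
next
  case (Suc n)
  note irr = assms(2) and tr = assms(3)
  have "\<exists>x\<in>P. \<forall>y\<in>P. \<not> lt x y"
  proof -
    have "P \<noteq> {}" using Suc.hyps(2) by auto
    with Suc.prems(1) show ?thesis
    proof (induction P rule: finite_ne_induct)
      case (singleton x)
      then show ?case using irr by blast
    next
      case (insert a A)
      then obtain x where x: "x \<in> A" "\<forall>y\<in>A. \<not> lt x y" by blast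
      show ?case
      proof (cases "lt x a")
        case True
        then have "\<forall>y\<in>insert a A. \<not> lt a y" using x tr irr by blast
        then show ?thesis by blast
      qed (use x in blast)
    qed
  qed
  then obtain x where x: "x \<in> P" "\<forall>y\<in>P. \<not> lt x y" by blast
  have xD: "x \<notin> D" using x(2) Suc.prems(4,5) by blast
  let ?P = "P - {x}"
  have card: "n = card ?P" using Suc.hyps(2) x(1) Suc.prems(1) by simp
  show ?case
  proof (cases "x \<in> f ` D")
    case False
    have "\<exists>cs. distinct (concat cs) \<and> set (concat cs) = ?P \<and>
      (\<forall>c\<in>set cs. c \<noteq> [] \<and> successively (\<lambda>a b. a \<in> D \<and> b = f a) c \<and> last c \<notin> D)"
      by (rule Suc.hyps(1)[OF card]) (use Suc.prems xD False in auto)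
    then obtain cs where cs: "distinct (concat cs)" "set (concat cs) = ?P"
      "\<forall>c\<in>set cs. c \<noteq> [] \<and> successively (\<lambda>a b. a \<in> D \<and> b = f a) c \<and> last c \<notin> D" by blast
    have "distinct (concat ([x] # cs))" "set (concat ([x] # cs)) = P" using cs(1,2) x(1) by auto
    moreover have "\<forall>c\<in>set ([x] # cs). c \<noteq> [] \<and> successively (\<lambda>a b. a \<in> D \<and> b = f a) c \<and> last c \<notin> D"
      using cs(3) xD by simp
    ultimately show ?thesis by blast
  next
    case True
    then obtain z where z: "z \<in> D" "x = f z" by blast
    let ?D = "D - {z}"
    have zP: "z \<in> ?P" using z Suc.prems(2) xD by auto
    have "\<exists>cs. distinct (concat cs) \<and> set (concat cs) = ?P \<and>
      (\<forall>c\<in>set cs. c \<noteq> [] \<and> successively (\<lambda>a b. a \<in> ?D \<and> b = f a) c \<and> last c \<notin> ?D)"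
    proof (rule Suc.hyps(1)[OF card])
      show "f ` ?D \<subseteq> ?P"
        using Suc.prems(3,4) z by (auto dest: inj_onD)
      show "inj_on f ?D" by (rule inj_on_subset[OF Suc.prems(3)]) blast
    qed (use Suc.prems xD in auto)
    then obtain cs where cs: "distinct (concat cs)" "set (concat cs) = ?P"
      and good: "\<And>c. c \<in> set cs \<Longrightarrow> c \<noteq> [] \<and> successively (\<lambda>a b. a \<in> ?D \<and> b = f a) c \<and> last c \<notin> ?D" by blast
    obtain c where c: "c \<in> set cs" "z \<in> set c" using zP cs(2) by auto
    obtain cs1 cs2 where split: "cs = cs1 @ c # cs2" using c(1) by (meson split_list)
    have lastc: "last c = z"
    proof -
      obtain c1 c2 where c12: "c = c1 @ z # c2" using c(2) by (meson split_list)
      have "c2 = []"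
      proof (cases c2)
        case (Cons b c3)
        then have "z \<in> ?D" using good[OF c(1)] by (simp add: c12 successively_append_iff)
        then show ?thesis by simp
      qed
      then show ?thesis by (simp add: c12)
    qed
    let ?cs = "cs1 @ (c @ [x]) # cs2"
    have "distinct (concat ?cs)" "set (concat ?cs) = P" using cs x(1) unfolding split by auto
    moreover have "c' \<noteq> [] \<and> successively (\<lambda>a b. a \<in> D \<and> b = f a) c' \<and> last c' \<notin> D" if c': "c' \<in> set ?cs" for c'
    proof (cases "c' = c @ [x]")
      case True
      have "successively (\<lambda>a b. a \<in> D \<and> b = f a) c"
        using good[OF c(1)] by (auto elim: successively_mono)
      then show ?thesis using True lastc z xD good[OF c(1)] by (simp add: successively_append_iff)
    next
      case False
      then have mem: "c' \<in> set cs1 \<union> set cs2" using c' by auto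
      then have "c' \<in> set cs" by (auto simp: split)
      note g = good[OF this]
      have "z \<notin> set c'" using mem c(2) cs(1) unfolding split by auto
      then have "last c' \<notin> D" using g last_in_set by fastforce
      moreover have "successively (\<lambda>a b. a \<in> D \<and> b = f a) c'" using g by (auto elim: successively_mono)
      ultimately show ?thesis using g by blast
    qed
    ultimately show ?thesis by blast
  qed
qed

text \<open>A chain cut out of a permutation has weight equal to its excess over
  \<open>\<kappa>\<close> at its end. The set \<open>F\<close> consists of the points where the dual
  solution \<open>u + v\<close> vanishes, and duality compares the size of its complement with the
  total excess.\<close>

lemma weighted_chain_packing:
  fixes lt :: "'a \<Rightarrow> 'a \<Rightarrow> bool" and \<kappa> :: "'a \<Rightarrow> nat"
  assumes fin: "finite P" and irr: "\<And>x. \<not> lt x x" and tr: "\<And>x y z. lt x y \<Longrightarrow> lt y z \<Longrightarrow> lt x z"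
  obtains F cs where "F \<subseteq> P" "distinct (concat cs)" "set (concat cs) = P"
    "\<And>c. c \<in> set cs \<Longrightarrow> c \<noteq> [] \<and> sorted_wrt lt c"
    "\<And>c. c \<noteq> [] \<Longrightarrow> sorted_wrt lt c \<Longrightarrow> set c \<subseteq> F \<Longrightarrow> length c \<le> \<kappa> (last c)"
    "card (P - F) \<le> (\<Sum>c\<leftarrow>cs. length c - \<kappa> (last c))"
proof (cases "P = {}")
  case True
  show ?thesis by (rule that[of "{}" "[]"]) (simp_all add: True)
next
  case False
  \<comment> \<open>A permutation is cut into chains at the steps that do not ascend; ending a chain at \<open>x\<close>
    costs \<open>\<kappa> x\<close>.\<close>
  define w :: "'a \<Rightarrow> 'a \<Rightarrow> int" where
    "w x y = (if lt x y then 1 else if x = y then max 0 (1 - int (\<kappa> x)) else 1 - int (\<kappa> x))" for x y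
  obtain \<sigma> u0 v0 where \<sigma>: "\<sigma> permutes P" and dual0: "\<And>x y. x \<in> P \<Longrightarrow> y \<in> P \<Longrightarrow> w x y \<le> u0 x + v0 y"
    and val0: "(\<Sum>x\<in>P. w x (\<sigma> x)) = (\<Sum>x\<in>P. u0 x + v0 x)"
    using max_weight_duality[OF fin, of w] by blast
  \<comment> \<open>A constant may be shifted from \<open>v0\<close> to \<open>u0\<close>.
    Normalising the minimum of \<open>v\<close> to 0 bounds \<open>u\<close> from below, by the dual
    inequality at a point with \<open>v = 0\<close>.\<close>
  define k where "k = Min (v0 ` P)"
  define u where "u x = u0 x + k" for x
  define v where "v x = v0 x - k" for x
  have dual: "w x y \<le> u x + v y" if "x \<in> P" "y \<in> P" for x y
    using dual0[OF that] by (simp add: u_def v_def)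
  have val: "(\<Sum>x\<in>P. w x (\<sigma> x)) = (\<Sum>x\<in>P. u x + v x)" by (simp add: val0 u_def v_def)
  have v_pos: "0 \<le> v x" if "x \<in> P" for x using fin that by (simp add: v_def k_def)
  have "k \<in> v0 ` P" unfolding k_def using fin False by (intro Min_in) auto
  then obtain z0 where z0: "z0 \<in> P" "v z0 = 0" by (auto simp: v_def)
  have u_ge: "1 - int (\<kappa> x) \<le> u x" if "x \<in> P" for x
    using dual[OF that z0(1)] z0(2) by (auto simp: w_def split: if_splits)
  \<comment> \<open>This is what the maximum with 0 on the diagonal of \<open>w\<close> is
    for.\<close>
  have nonneg: "0 \<le> u x + v x" if "x \<in> P" for x
    using dual[OF that that] irr by (auto simp: w_def)
  define F where "F = {x \<in> P. u x + v x = 0}"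
  define D where "D = {x \<in> P. lt x (\<sigma> x)}"
  have "\<exists>cs. distinct (concat cs) \<and> set (concat cs) = P \<and>
    (\<forall>c\<in>set cs. c \<noteq> [] \<and> successively (\<lambda>a b. a \<in> D \<and> b = \<sigma> a) c \<and> last c \<notin> D)"
  proof (rule chain_partition[of P lt])
    show "D \<subseteq> P" "\<sigma> ` D \<subseteq> P" "\<And>x. x \<in> D \<Longrightarrow> lt x (\<sigma> x)"
      using permutes_in_image[OF \<sigma>] by (auto simp: D_def)
    show "inj_on \<sigma> D" by (rule permutes_inj_on[OF \<sigma>])
    show "lt x z" if "lt x y" "lt y z" for x y z using tr that by blast
  qed (use fin irr in auto)
  then obtain cs where cs: "distinct (concat cs)" "set (concat cs) = P"
    and good: "\<And>c. c \<in> set cs \<Longrightarrow> c \<noteq> [] \<and> successively (\<lambda>a b. a \<in> D \<and> b = \<sigma> a) c \<and> last c \<notin> D"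
    by blast
  show ?thesis
  proof (rule that[OF _ cs])
    show "F \<subseteq> P" by (auto simp: F_def)
    fix c assume c: "c \<in> set cs"
    have "successively lt c" by (rule successively_mono[of "\<lambda>a b. a \<in> D \<and> b = \<sigma> a"]) (use good[OF c] in \<open>auto simp: D_def\<close>)
    moreover have "transp lt" using tr by (auto intro: transpI)
    ultimately show "c \<noteq> [] \<and> sorted_wrt lt c" using good[OF c] successively_conv_sorted_wrt by blast
  next
    fix c assume c: "c \<noteq> []" "sorted_wrt lt c" "set c \<subseteq> F"
    \<comment> \<open>On \<open>F\<close> one has \<open>u = - v\<close>, so the dual inequality for
      an ascending pair, of weight 1, makes \<open>v\<close> grow by at least 1 at each
      step.\<close>
    have "int (length c) - 1 \<le> v (last c)"
      using c
    proof (induction c rule: rev_induct)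
      case (snoc y c)
      show ?case
      proof (cases "c = []")
        case True
        then show ?thesis using snoc.prems v_pos by (simp add: F_def)
      next
        case False
        then have IH: "int (length c) - 1 \<le> v (last c)" using snoc by (simp add: sorted_wrt_append)
        have l: "last c \<in> F" "y \<in> F" "lt (last c) y" using snoc.prems False by (auto simp: sorted_wrt_append)
        then have "1 \<le> u (last c) + v y" using dual[of "last c" y] by (simp add: w_def F_def)
        then show ?thesis using IH l by (simp add: F_def)
      qed
    qed simp
    moreover have "last c \<in> F" using c by auto
    then have "v (last c) \<le> int (\<kappa> (last c)) - 1" using u_ge[of "last c"] by (simp add: F_def)
    ultimately show "length c \<le> \<kappa> (last c)" by simp
  next
    \<comment> \<open>Outside \<open>F\<close> the nonnegative integer \<open>u + v\<close> is at
      least 1.\<close>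
    have "int (card (P - F)) = (\<Sum>x\<in>P - F. 1)" by simp
    also have "\<dots> \<le> (\<Sum>x\<in>P - F. u x + v x)"
      by (rule sum_mono) (use nonneg in \<open>force simp: F_def\<close>)
    also have "\<dots> \<le> (\<Sum>x\<in>P. u x + v x)" by (rule sum_mono2) (use fin nonneg in auto)
    also have "\<dots> = (\<Sum>x\<in>set (concat cs). w x (\<sigma> x))" by (simp only: val cs(2))
    also have "\<dots> = sum_list (map (\<lambda>x. w x (\<sigma> x)) (concat cs))"
      by (rule sum_list_distinct_conv_sum_set[OF cs(1), symmetric])
    also have "\<dots> = (\<Sum>c\<leftarrow>cs. sum_list (map (\<lambda>x. w x (\<sigma> x)) c))"
      by (induction cs) simp_all
    also have "\<dots> \<le> (\<Sum>c\<leftarrow>cs. int (length c - \<kappa> (last c)))"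
    proof (rule sum_list_mono)
      fix c assume c: "c \<in> set cs"
      obtain b y where cb: "c = b @ [y]" using good[OF c] by (metis append_butlast_last_id)
      have bD: "x \<in> D" if x: "x \<in> set b" for x
      proof -
        obtain b1 b2 where "b = b1 @ x # b2" using x by (meson split_list)
        then show ?thesis using good[OF c] by (cases b2) (auto simp: cb successively_append_iff)
      qed
      have "sum_list (map (\<lambda>x. w x (\<sigma> x)) b) = sum_list (map (\<lambda>x. 1) b)"
        by (rule arg_cong[of _ _ sum_list], rule map_cong) (use bD in \<open>auto simp: w_def D_def\<close>)
      then have eq: "sum_list (map (\<lambda>x. w x (\<sigma> x)) c) = int (length b) + w y (\<sigma> y)"
        by (simp add: cb sum_list_triv)
      have yD: "y \<notin> D" "y \<in> P" using good[OF c] c cs(2) by (auto simp: cb)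
      show "sum_list (map (\<lambda>x. w x (\<sigma> x)) c) \<le> int (length c - \<kappa> (last c))"
      proof (cases "\<sigma> y = y")
        case False
        then have "w y (\<sigma> y) = 1 - int (\<kappa> y)" using yD by (simp add: w_def D_def)
        then show ?thesis unfolding eq by (simp add: cb)
      next
        case True
        \<comment> \<open>By injectivity a fixed point of the permutation is not the image of
          another point, so it forms a chain by itself.\<close>
        have "b = []"
        proof (rule ccontr)
          assume "b \<noteq> []"
          then have "last b \<in> D" "y = \<sigma> (last b)" using good[OF c] by (auto simp: cb successively_append_iff)
          then have "\<sigma> (last b) = \<sigma> y" "lt (last b) y" using True by (auto simp: D_def)
          then show False using irr permutes_inj[OF \<sigma>] by (auto dest: injD)
        qed
        then show ?thesis unfolding eq using True irr by (simp add: cb w_def)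
      qed
    qed
    also have "\<dots> = int (\<Sum>c\<leftarrow>cs. length c - \<kappa> (last c))" by (induction cs) simp_all
    finally show "card (P - F) \<le> (\<Sum>c\<leftarrow>cs. length c - \<kappa> (last c))" by simp
  qed
qed

section \<open>Minors in symbolic powers\<close>

text \<open>Row operations turn the rows outside \<open>rb\<close> into rows of minors bordering \<open>gminor X rb cb\<close>.\<close>

lemma gminor_bordered_rows:
  assumes len: "length cb = length rb" "length ca = length ra"
  obtains M where "M \<in> carrier_mat (length (ra @ rb)) (length (ra @ rb))"
    "gminor X rb cb ^ length ra * gminor X (ra @ rb) (ca @ cb) = det M"
    "\<And>i j. i < length ra \<Longrightarrow> j < length (ra @ rb) \<Longrightarrow>
      M $$ (i, j) = gminor X (rb @ [ra ! i]) (cb @ [(ca @ cb) ! j])"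
    "\<And>i j. length ra \<le> i \<Longrightarrow> i < length (ra @ rb) \<Longrightarrow> j < length (ra @ rb) \<Longrightarrow>
      M $$ (i, j) = X ((ra @ rb) ! i) ((ca @ cb) ! j)"
proof -
  let ?p = "length ra" and ?s = "length rb" and ?q = "gminor X rb cb"
  let ?n = "length (ra @ rb)"
  define cof where "cof i a = (-1) ^ (length cb + a) * gminor X (del_nth a (rb @ [i])) cb" for i a
  have cof_last: "cof i ?s = ?q" for i
    using len del_nth_last[of rb i] by (simp add: cof_def power_add[symmetric] mult_2[symmetric])
  have expand: "gminor X (rb @ [i]) (cb @ [j]) = (\<Sum>a<?s. cof i a * X (rb ! a) j) + ?q * X i j" for i j
  proof -
    have "gminor X (rb @ [i]) (cb @ [j]) = (\<Sum>a<length (rb @ [i]). X ((rb @ [i]) ! a) j * cof i a)"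
      unfolding cof_def by (rule gminor_expand_last_col) (use len in simp)
    also have "\<dots> = (\<Sum>a<?s. X ((rb @ [i]) ! a) j * cof i a) + X i j * ?q"
      by (simp add: cof_last)
    also have "(\<Sum>a<?s. X ((rb @ [i]) ! a) j * cof i a) = (\<Sum>a<?s. cof i a * X (rb ! a) j)"
      by (rule sum.cong) (simp_all add: nth_append mult.commute)
    finally show ?thesis by (simp add: mult.commute)
  qed
  \<comment> \<open>The row operations as an upper triangular matrix. By \<open>expand\<close>, its
    first rows produce the bordered minors, and its determinant is a power of
    \<open>?q\<close>.\<close>
  define E where "E = mat ?n ?n (\<lambda>(i, j). if i < ?p then (if j = i then ?q else if j < ?p then 0 else cof (ra ! i) (j - ?p))
    else (if j = i then 1 else 0))"
  define A where "A = mat ?n ?n (\<lambda>(i, j). X ((ra @ rb) ! i) ((ca @ cb) ! j))"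
  have EA: "E \<in> carrier_mat ?n ?n" "A \<in> carrier_mat ?n ?n" by (simp_all add: E_def A_def)
  have n: "?n = ?p + ?s" by simp
  have "det E = prod_list (diag_mat E)"
    by (rule det_upper_triangular[OF _ EA(1)]) (auto simp: upper_triangular_def E_def)
  also have "\<dots> = (\<Prod>i = 0..<?n. E $$ (i, i))"
    using EA(1) by (simp add: prod_list_diag_prod)
  also have "\<dots> = (\<Prod>i = 0..<?n. if i < ?p then ?q else 1)"
    by (rule prod.cong) (auto simp: E_def)
  also have "\<dots> = (\<Prod>i\<in>{0..<?n} \<inter> {i. i < ?p}. ?q)"
    by (subst prod.If_cases) (simp_all add: Int_def)
  also have "{0..<?n} \<inter> {i. i < ?p} = {0..<?p}" by auto
  finally have detE: "det E = ?q ^ ?p" by simp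
  have entry: "(E * A) $$ (i, j) = (\<Sum>k = 0..<?n. E $$ (i, k) * A $$ (k, j))" if "i < ?n" "j < ?n" for i j
    using that EA by (simp add: scalar_prod_def)
  show ?thesis
  proof (rule that[of "E * A"])
    show "E * A \<in> carrier_mat ?n ?n" using EA by simp
    have "gminor X (ra @ rb) (ca @ cb) = det A" by (simp add: gminor_def A_def)
    then show "?q ^ ?p * gminor X (ra @ rb) (ca @ cb) = det (E * A)"
      using det_mult[OF EA] detE by simp
  next
    fix i j assume ij: "i < ?p" "j < ?n"
    have "(E * A) $$ (i, j) = (\<Sum>k = 0..<?p + ?s. E $$ (i, k) * A $$ (k, j))"
      using entry[of i j] ij by simp
    also have "\<dots> = (\<Sum>k = 0..<?p. E $$ (i, k) * A $$ (k, j)) + (\<Sum>k = ?p..<?p + ?s. E $$ (i, k) * A $$ (k, j))"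
      by (rule sum.atLeastLessThan_concat[symmetric]) simp_all
    also have "(\<Sum>k = 0..<?p. E $$ (i, k) * A $$ (k, j)) = (\<Sum>k = 0..<?p. if k = i then ?q * X (ra ! i) ((ca @ cb) ! j) else 0)"
      by (rule sum.cong) (use ij in \<open>auto simp: E_def A_def nth_append\<close>)
    also have "\<dots> = ?q * X (ra ! i) ((ca @ cb) ! j)" using ij by simp
    also have "(\<Sum>k = ?p..<?p + ?s. E $$ (i, k) * A $$ (k, j)) = (\<Sum>a = 0..<?s. E $$ (i, a + ?p) * A $$ (a + ?p, j))"
      using sum.shift_bounds_nat_ivl[of "\<lambda>k. E $$ (i, k) * A $$ (k, j)" 0 ?p ?s] by (simp add: add.commute)
    also have "\<dots> = (\<Sum>a<?s. cof (ra ! i) a * X (rb ! a) ((ca @ cb) ! j))"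
      unfolding atLeast0LessThan by (rule sum.cong) (use ij in \<open>auto simp: E_def A_def nth_append\<close>)
    finally show "(E * A) $$ (i, j) = gminor X (rb @ [ra ! i]) (cb @ [(ca @ cb) ! j])"
      by (simp add: expand add.commute)
  next
    fix i j assume ij: "?p \<le> i" "i < ?n" "j < ?n"
    have "(E * A) $$ (i, j) = (\<Sum>k = 0..<?n. if k = i then A $$ (i, j) else 0)"
      unfolding entry[OF ij(2,3)] by (rule sum.cong) (use ij in \<open>auto simp: E_def\<close>)
    also have "\<dots> = A $$ (i, j)" using ij by simp
    finally show "(E * A) $$ (i, j) = X ((ra @ rb) ! i) ((ca @ cb) ! j)"
      using ij by (simp add: A_def)
  qed
qed

context antidiagonal_conditions
begin

text \<open>Every Leibniz term has one factor from each of the first \<open>p\<close> rows.\<close>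

lemma det_in_ideal_power:
  assumes M: "M \<in> carrier_mat n n" and p: "p \<le> n"
    and top: "\<And>i j. i < p \<Longrightarrow> j < n \<Longrightarrow> M $$ (i, j) \<in> IR"
    and rest: "\<And>i j. p \<le> i \<Longrightarrow> i < n \<Longrightarrow> j < n \<Longrightarrow> M $$ (i, j) \<in> R"
  shows "det M \<in> ideal_power L IR p"
proof -
  note Ip = ideal_pringD[OF ideal_ideal_power[OF IR_ideal, of p]]
  have "signof \<pi> * (\<Prod>i = 0..<n. M $$ (i, \<pi> i)) \<in> ideal_power L IR p" if \<pi>: "\<pi> permutes {0..<n}" for \<pi>
  proof -
    have lt: "\<pi> i < n" if "i < n" for i by (rule permutes_atLeastLessThan[OF \<pi> that])
    have "(\<Prod>i\<in>{0..<p}. M $$ (i, \<pi> i)) \<in> ideal_power L IR (card {0..<p})"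
      by (rule ideal_power_prod[OF IR_ideal]) (use top lt p in auto)
    then have a: "(\<Prod>i\<in>{0..<p}. M $$ (i, \<pi> i)) \<in> ideal_power L IR p" by (simp only: card_atLeastLessThan diff_zero)
    have "(\<Prod>i\<in>A. M $$ (i, \<pi> i)) \<in> R" if "finite A" "A \<subseteq> {p..<n}" for A
      using that
    proof (induction A rule: finite_induct)
      case empty
      then show ?case using R_1 by simp
    next
      case (insert i A)
      have "M $$ (i, \<pi> i) \<in> R" using insert.prems by (intro rest lt) auto
      from R_mult[OF this insert.IH] show ?case using insert by simp
    qed
    then have b: "(\<Prod>i\<in>{p..<n}. M $$ (i, \<pi> i)) \<in> R" by blast
    have s: "signof \<pi> \<in> R" using R_1 R_uminus[OF R_1] by (simp add: sign_def)
    have "(\<Prod>i = 0..<n. M $$ (i, \<pi> i)) = (\<Prod>i = 0..<p. M $$ (i, \<pi> i)) * (\<Prod>i = p..<n. M $$ (i, \<pi> i))"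
      by (rule prod.atLeastLessThan_concat[symmetric]) (use p in simp_all)
    then have "signof \<pi> * (\<Prod>i = 0..<n. M $$ (i, \<pi> i)) =
        (signof \<pi> * (\<Prod>i\<in>{p..<n}. M $$ (i, \<pi> i))) * (\<Prod>i\<in>{0..<p}. M $$ (i, \<pi> i))"
      by (simp only: mult_ac)
    also have "\<dots> \<in> ideal_power L IR p"
      by (rule Ip(4)[OF _ a]) (use R_mult[OF s b] in simp)
    finally show ?thesis .
  qed
  then show ?thesis
    unfolding det_def'[OF M] by (intro ideal_pring_sum[OF ideal_ideal_power[OF IR_ideal]]) blast
qed

lemma symbolic_IR_mult:
  assumes f: "f \<in> symbolic_power RR IR m" and g: "g \<in> symbolic_power RR IR n"
  shows "f * g \<in> symbolic_power RR IR (m + n)"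
proof -
  obtain s t where st: "f \<in> R" "s \<in> R" "s \<notin> I" "s * f \<in> ideal_power L IR m"
    "g \<in> R" "t \<in> R" "t \<notin> I" "t * g \<in> ideal_power L IR n"
    using f g unfolding mem_symbolic_IR by blast
  have "(s * f) * (t * g) \<in> ideal_power L IR (m + n)" by (rule ideal_power_mult[OF IR_ideal st(4,8)])
  then have "(s * t) * (f * g) \<in> ideal_power L IR (m + n)" by (simp only: mult_ac)
  moreover have "s * t \<notin> I" using I_prime st(3,7) unfolding prime_set_def by blast
  ultimately show ?thesis
    unfolding mem_symbolic_IR using R_mult[OF st(1,5)] R_mult[OF st(2,6)] by blast
qed

lemma symbolic_IR_0:
  assumes "f \<in> R"
  shows "f \<in> symbolic_power RR IR 0"
proof -
  have "1 \<notin> I" using I_prime by (simp add: prime_set_def)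
  moreover have "1 * f \<in> ideal_power L IR 0" using assms by (simp only: ideal_power_0 pring_simps(1) mult_1_left)
  ultimately show ?thesis using assms R_1 unfolding mem_symbolic_IR by blast
qed

lemma symbolic_IR_antimono:
  assumes "m \<le> n" "f \<in> symbolic_power RR IR n"
  shows "f \<in> symbolic_power RR IR m"
  using assms(2) ideal_power_mono_exp[OF IR_ideal assms(1)] unfolding mem_symbolic_IR by blast

text \<open>The multiplier is a power of the minor of \<open>b\<close>, which is not in
  \<open>I\<close> because its leading monomial is a face. By \<open>gminor_bordered_rows\<close>
  the product is a determinant with \<open>length a\<close> rows of minors of size
  \<open>length b + 1\<close>, and these lie in \<open>I\<close>.\<close>

lemma cminor_symbolic:
  assumes ch: "chain (a @ b)" and sub: "set (a @ b) \<subseteq> subladder L u" and u: "(u, Suc (length b)) \<in> U"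
    and face: "face L U (set b)"
  shows "cminor (a @ b) \<in> symbolic_power RR IR (length a)"
proof -
  have subL: "set (a @ b) \<subseteq> L" using sub subladder_subset by blast
  have chb: "chain b" and bL: "set b \<subseteq> L" using ch subL by (auto simp: sorted_wrt_append)
  let ?X = "\<lambda>i j. var (i, j) :: 'k mpol"
  let ?ra = "map fst a" and ?rb = "map fst b" and ?ca = "map snd a" and ?cb = "map snd b"
  have blk: "set (?ra @ ?rb) \<times> set (?ca @ ?cb) \<subseteq> subladder L u"
    using chain_block[OF convL ch sub] by (simp only: map_append)
  have blkL: "set (?ra @ ?rb) \<times> set (?ca @ ?cb) \<subseteq> L" using blk subladder_subset by blast
  obtain M where M: "M \<in> carrier_mat (length (?ra @ ?rb)) (length (?ra @ ?rb))"
    "gminor ?X ?rb ?cb ^ length ?ra * gminor ?X (?ra @ ?rb) (?ca @ ?cb) = det M"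
    "\<And>i j. i < length ?ra \<Longrightarrow> j < length (?ra @ ?rb) \<Longrightarrow>
      M $$ (i, j) = gminor ?X (?rb @ [?ra ! i]) (?cb @ [(?ca @ ?cb) ! j])"
    "\<And>i j. length ?ra \<le> i \<Longrightarrow> i < length (?ra @ ?rb) \<Longrightarrow> j < length (?ra @ ?rb) \<Longrightarrow>
      M $$ (i, j) = ?X ((?ra @ ?rb) ! i) ((?ca @ ?cb) ! j)"
    by (rule gminor_bordered_rows[of ?cb ?rb ?ca ?ra ?X]) simp_all
  have "det M \<in> ideal_power L IR (length a)"
  proof (rule det_in_ideal_power[OF M(1)])
    fix i j assume ij: "i < length a" "j < length (?ra @ ?rb)"
    have mem: "?ra ! i \<in> set (?ra @ ?rb)" "(?ca @ ?cb) ! j \<in> set (?ca @ ?cb)"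
      using ij nth_mem[of i ?ra] nth_mem[of j "?ca @ ?cb"] by simp_all
    have blk': "set (?rb @ [?ra ! i]) \<times> set (?cb @ [(?ca @ ?cb) ! j]) \<subseteq> set (?ra @ ?rb) \<times> set (?ca @ ?cb)"
      using mem by auto
    have eq: "M $$ (i, j) = minor (?rb @ [?ra ! i]) (?cb @ [(?ca @ ?cb) ! j])"
      using M(3)[of i j] ij by (simp only: minor_eq_gminor length_map)
    have "M $$ (i, j) \<in> I"
      unfolding eq by (rule minor_in_block_ideal[OF u _ _ subset_trans[OF blk' blk]]) simp_all
    moreover have "M $$ (i, j) \<in> R"
    proof -
      have "keys m \<subseteq> L" if "m \<in> keys (M $$ (i, j))" for m
        using keys_minor[of m "?rb @ [?ra ! i]" "?cb @ [(?ca @ ?cb) ! j]", where 'k = 'k] that blk' blkL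
        unfolding eq by (simp only: length_append length_map list.size) blast
      then show ?thesis by (auto simp: monomials_def)
    qed
    ultimately show "M $$ (i, j) \<in> IR" by (simp add: IR_def)
  next
    fix i j assume ij: "length a \<le> i" "i < length (?ra @ ?rb)" "j < length (?ra @ ?rb)"
    have "(?ra @ ?rb) ! i \<in> set (?ra @ ?rb)" "(?ca @ ?cb) ! j \<in> set (?ca @ ?cb)"
      using ij nth_mem[of i "?ra @ ?rb"] nth_mem[of j "?ca @ ?cb"] by simp_all
    then have "((?ra @ ?rb) ! i, (?ca @ ?cb) ! j) \<in> L" using blkL by blast
    then show "M $$ (i, j) \<in> R" using M(4)[of i j] ij by (simp add: var_def monomials_def)
  qed simp
  then have "cminor b ^ length a * cminor (a @ b) \<in> ideal_power L IR (length a)"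
    unfolding minor_eq_gminor map_append using M(2) by (simp only: length_map)
  moreover have "(cminor b :: 'k mpol) \<notin> I"
  proof
    assume "(cminor b :: 'k mpol) \<in> I"
    then have "\<not> face L U (keys (lead (cminor b)))"
      by (rule lead_nonface[OF _ cminor_in_R'[OF chb bL] cminor_nonzero[OF chb]])
    then show False using face by (simp add: lead_cminor[OF chb bL] keys_cmono)
  qed
  then have "cminor b ^ length a \<notin> I" using prime_set_power[OF I_prime] by blast
  ultimately show ?thesis
    unfolding mem_symbolic_IR using R_power[OF cminor_in_R'[OF chb bL]] cminor_in_R'[OF ch subL] by blast
qed

text \<open>A chain in a face ending in \<open>e\<close> has at most \<open>kappa e\<close> entries.\<close>

definition kappa :: "nat \<times> nat \<Rightarrow> nat" where
  "kappa e = (LEAST k. \<exists>(u, t)\<in>U. e \<in> subladder L u \<and> k = t - 1)"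

lemma kappa_le: "(u, t) \<in> U \<Longrightarrow> e \<in> subladder L u \<Longrightarrow> kappa e \<le> t - 1"
  unfolding kappa_def by (rule Least_le) blast

lemma kappaE:
  assumes "\<exists>(u, t)\<in>U. e \<in> subladder L u"
  obtains u t where "(u, t) \<in> U" "e \<in> subladder L u" "kappa e = t - 1"
proof -
  have "\<exists>k. \<exists>(u, t)\<in>U. e \<in> subladder L u \<and> k = t - 1" using assms by blast
  from LeastI_ex[OF this] show ?thesis unfolding kappa_def[symmetric] using that by blast
qed

text \<open>The condition \<open>(u, t)\<close> maximising \<open>card (c \<inter> subladder L u) - t\<close> is chosen so that the last
  \<open>t - 1\<close> entries of \<open>c\<close> in \<open>subladder L u\<close> form a face.\<close>

lemma chain_symbolic:
  assumes c: "chain c" "c \<noteq> []" "set c \<subseteq> L" and cov: "\<exists>(u, t)\<in>U. last c \<in> subladder L u"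
  shows "\<exists>f\<in>symbolic_power RR IR (length c - kappa (last c)). f \<noteq> 0 \<and> lead f = cmono c"
proof (cases "length c \<le> kappa (last c)")
  case True
  have "single (cmono c) (1::'k) \<noteq> 0" by (metis lookup_single_eq lookup_zero one_neq_zero)
  then show ?thesis
    using True symbolic_IR_0[OF R_single[OF cmono_in_monomials[OF c(3)]]] lead_single[OF cmono_in_monomials[OF c(3)]]
    by (intro bexI[of _ "single (cmono c) 1"]) simp_all
next
  case False
  define r where "r u = length (filter (\<lambda>e. e \<in> subladder L u) c)" for u
  obtain u0 t0 where u0: "(u0, t0) \<in> U" "last c \<in> subladder L u0" "kappa (last c) = t0 - 1"
    using kappaE[OF cov] by blast
  have r_le: "r u \<le> length c" for u by (simp add: r_def)
  \<comment> \<open>Adding \<open>length c\<close> keeps the truncated subtraction exact, so the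
    least value maximises the difference of \<open>r u\<close> and \<open>t\<close>.\<close>
  obtain z where z: "z \<in> U" "\<And>y. y \<in> U \<Longrightarrow> length c + snd z - r (fst z) \<le> length c + snd y - r (fst y)"
    using ex_has_least_nat[of "\<lambda>z. z \<in> U" "(u0, t0)" "\<lambda>z. length c + snd z - r (fst z)"] u0(1) by blast
  obtain u t where ut: "z = (u, t)" by (cases z)
  have max: "r v + t \<le> r u + t'" if "(v, t') \<in> U" for v t'
    using z(2)[OF that] r_le[of u] r_le[of v] by (simp add: ut)
  have t_pos: "0 < t'" if "(v, t') \<in> U" for v t' using goodU that by (auto simp: good_conditions_def)
  have utU: "(u, t) \<in> U" using z(1) ut by simp
  have "set c \<subseteq> subladder L u0"
  proof
    fix e assume e: "e \<in> set c"
    obtain b where b: "c = b @ [last c]" using c(2) by (metis append_butlast_last_id)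
    have "e = last c \<or> ne e (last c)"
      using e c(1) by (subst (asm) (1 2) b) (auto simp: sorted_wrt_append)
    then show "e \<in> subladder L u0"
      using subladder_ne_closed[of e L "last c" u0] u0(2) c(3) e by (auto simp: ne_def)
  qed
  then have "filter (\<lambda>e. e \<in> subladder L u0) c = c" unfolding filter_id_conv by blast
  then have "r u0 = length c" by (simp only: r_def)
  \<comment> \<open>Comparison of the chosen condition with \<open>(u0, t0)\<close>, whose subladder
    contains all of \<open>c\<close>.\<close>
  then have gain: "length c - kappa (last c) \<le> r u - (t - 1)" "t - 1 \<le> r u"
    using max[OF u0(1)] u0(3) t_pos[OF u0(1)] t_pos[OF utU] False by linarith+
  define c1 where "c1 = filter (\<lambda>e. e \<in> subladder L u) c"
  define c2 where "c2 = filter (\<lambda>e. e \<notin> subladder L u) c"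
  have c1: "chain c1" "set c1 \<subseteq> subladder L u" "length c1 = r u"
    using c(1) by (auto simp: c1_def r_def sorted_wrt_filter)
  have c1L: "set c1 \<subseteq> L" and c2L: "set c2 \<subseteq> L" using c(3) by (auto simp: c1_def c2_def)
  have cm: "cmono c = cmono c1 + cmono c2"
    unfolding c1_def c2_def by (rule poly_mapping_eqI) (simp add: lookup_add lookup_cmono, induct_tac c, auto)
  define a where "a = take (r u - (t - 1)) c1"
  define b where "b = drop (r u - (t - 1)) c1"
  have ab: "c1 = a @ b" "length a = r u - (t - 1)" "length b = t - 1"
    using c1(3) gain(2) by (simp_all add: a_def b_def)
  have face: "face L U (set b)"
  proof (rule faceI)
    fix v t' y assume y: "(v, t') \<in> U" "chain y" "set y \<subseteq> set b" "set y \<subseteq> subladder L v" "length y = t'"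
    let ?P = "\<lambda>e. e \<in> subladder L v"
    have "y \<noteq> []" using t_pos[OF y(1)] y(5) by auto
    then obtain e where e: "e \<in> set b" "?P e" using y(3,4) by (meson hd_in_set subsetD)
    \<comment> \<open>All of \<open>a\<close> is north-east of \<open>e\<close>, hence in the same
      subladder. Together with \<open>y\<close> it makes \<open>(v, t')\<close> beat the maximal
      choice \<open>(u, t)\<close>.\<close>
    have "filter ?P a = a"
    proof (rule filter_True, rule ballI)
      fix x assume x: "x \<in> set a"
      then have "ne x e" using c1(1) e(1) unfolding ab(1) by (auto simp: sorted_wrt_append)
      then show "?P x" using subladder_ne_closed[of x L e v] e(2) x c1L unfolding ab(1) by (auto simp: ne_def)
    qed
    then have "length a + length (filter ?P b) = length (filter ?P c1)" unfolding ab(1) by simp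
    also have "\<dots> \<le> r v"
      unfolding c1_def r_def filter_filter by (induction c) auto
    finally have 1: "length a + length (filter ?P b) \<le> r v" .
    have "set y \<subseteq> set (filter ?P b)" using y(3,4) by auto
    then have "card (set y) \<le> length (filter ?P b)"
      using card_mono[of "set (filter ?P b)" "set y"] card_length[of "filter ?P b"] by simp
    then have "t' \<le> length (filter ?P b)" using chain_distinct[OF y(2)] distinct_card[of y] y(5) by simp
    then show False using 1 max[OF y(1)] ab(2) gain(2) t_pos[OF utU] by linarith
  qed
  have "Suc (length b) = t" using ab(3) t_pos[OF utU] by simp
  then have "(u, Suc (length b)) \<in> U" using utU by simp
  then have "cminor (a @ b) \<in> symbolic_power RR IR (length a)"
    by (intro cminor_symbolic[OF _ _ _ face]) (use c1 ab(1) in simp_all)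
  then have "cminor c1 \<in> symbolic_power RR IR (r u - (t - 1))" by (simp only: ab)
  then have s1: "cminor c1 \<in> symbolic_power RR IR (length c - kappa (last c))"
    by (rule symbolic_IR_antimono[OF gain(1)])
  have m2: "single (cmono c2) (1::'k) \<in> R" "single (cmono c2) (1::'k) \<noteq> 0"
    using cmono_in_monomials[OF c2L] by (simp, metis lookup_single_eq lookup_zero one_neq_zero)
  \<comment> \<open>Entries of \<open>c\<close> outside the chosen subladder enter only as a
    monomial factor.\<close>
  let ?f = "cminor c1 * single (cmono c2) 1 :: 'k mpol"
  have "?f \<in> symbolic_power RR IR (length c - kappa (last c))"
    using symbolic_IR_mult[OF s1 symbolic_IR_0[OF m2(1)]] by simp
  moreover have "?f \<noteq> 0" using cminor_nonzero[OF c1(1)] m2(2) by simp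
  moreover have "lead ?f = cmono c"
    using lead_mult[OF cminor_in_R'[OF c1(1) c1L] m2(1) cminor_nonzero[OF c1(1)] m2(2)]
    by (simp add: lead_cminor[OF c1(1) c1L] lead_single[OF cmono_in_monomials[OF c2L]] cm)
  ultimately show ?thesis by blast
qed

lemma chains_symbolic:
  assumes cov: "\<And>e. e \<in> L \<Longrightarrow> \<exists>(u, t)\<in>U. e \<in> subladder L u"
    and cs: "\<And>c. c \<in> set cs \<Longrightarrow> chain c \<and> c \<noteq> [] \<and> set c \<subseteq> L"
  shows "\<exists>f\<in>symbolic_power RR IR (\<Sum>c\<leftarrow>cs. length c - kappa (last c)). f \<noteq> 0 \<and> lead f = cmono (concat cs)"
  using cs
proof (induction cs)
  case Nil
  have "lead (1 :: 'k mpol) = 0" using lead_single[of 0 "1::'k"] by (simp add: monomials_def)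
  then show ?case using symbolic_IR_0[OF R_1] by (intro bexI[of _ 1]) simp_all
next
  case (Cons c cs)
  then obtain g where g: "g \<in> symbolic_power RR IR (\<Sum>c\<leftarrow>cs. length c - kappa (last c))" "g \<noteq> 0" "lead g = cmono (concat cs)"
    by auto
  have c: "chain c" "c \<noteq> []" "set c \<subseteq> L" using Cons.prems[of c] by auto
  then have "last c \<in> L" by auto
  then obtain f where f: "f \<in> symbolic_power RR IR (length c - kappa (last c))" "f \<noteq> 0" "lead f = cmono c"
    using chain_symbolic[OF c cov] by blast
  have "f \<in> R" "g \<in> R" using f(1) g(1) unfolding mem_symbolic_IR by blast+
  then have "lead (f * g) = cmono (concat (c # cs))" using lead_mult[of f g] f g by (simp add: cmono_append)
  moreover have "f * g \<in> symbolic_power RR IR (\<Sum>c\<leftarrow>c # cs. length c - kappa (last c))"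
    using symbolic_IR_mult[OF f(1) g(1)] by simp
  moreover have "f * g \<noteq> 0" using f(2) g(2) by simp
  ultimately show ?case by blast
qed

text \<open>The packing runs over the positions in a list for \<open>m\<close>, so that entries
  count with multiplicity; positions of equal entries are incomparable. A chain in \<open>F\<close>
  lifts to positions in \<open>F'\<close>, which shows that \<open>F\<close> is a face.\<close>

lemma monomial_symbolic_IR:
  assumes cov: "\<And>e. e \<in> L \<Longrightarrow> \<exists>(u, t)\<in>U. e \<in> subladder L u"
    and m: "m \<in> monomials L" and deg: "\<And>F. face L U F \<Longrightarrow> n \<le> odeg F m"
  shows "\<exists>f\<in>symbolic_power RR IR n. f \<noteq> 0 \<and> lead f = m"
proof -
  obtain xs where xs: "m = cmono xs" by (rule cmono_list)
  have xsL: "set xs \<subseteq> L" using m by (simp add: xs monomials_def keys_cmono)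
  let ?lt = "\<lambda>i j. ne (xs ! i) (xs ! j)"
  obtain F' cs where F': "F' \<subseteq> {..<length xs}" and cs: "distinct (concat cs)" "set (concat cs) = {..<length xs}"
    and chains: "\<And>c. c \<in> set cs \<Longrightarrow> c \<noteq> [] \<and> sorted_wrt ?lt c"
    and short: "\<And>c. c \<noteq> [] \<Longrightarrow> sorted_wrt ?lt c \<Longrightarrow> set c \<subseteq> F' \<Longrightarrow> length c \<le> kappa (xs ! last c)"
    and card: "card ({..<length xs} - F') \<le> (\<Sum>c\<leftarrow>cs. length c - kappa (xs ! last c))"
  proof (rule weighted_chain_packing[of "{..<length xs}" ?lt "\<lambda>i. kappa (xs ! i)"])
    show "\<not> ne (xs ! x) (xs ! x)" for x by (simp add: ne_def)
    show "ne (xs ! x) (xs ! z)" if "ne (xs ! x) (xs ! y)" "ne (xs ! y) (xs ! z)" for x y z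
      using that by (rule ne_trans)
  qed (use that in auto)
  define F where "F = (!) xs ` F'"
  have "face L U F"
  proof (rule faceI)
    fix u t c assume c: "(u, t) \<in> U" "chain c" "set c \<subseteq> F" "set c \<subseteq> subladder L u" "length c = t"
    define pick where "pick e = (SOME i. i \<in> F' \<and> xs ! i = e)" for e
    have pick: "pick e \<in> F' \<and> xs ! pick e = e" if "e \<in> set c" for e
      unfolding pick_def by (rule someI_ex) (use that c(3) F_def in blast)
    have "0 < t" using goodU c(1) by (auto simp: good_conditions_def)
    then have "c \<noteq> []" using c(5) by auto
    have "length (map pick c) \<le> kappa (xs ! last (map pick c))"
    proof (rule short)
      show "sorted_wrt ?lt (map pick c)"
        unfolding sorted_wrt_map by (rule sorted_wrt_mono_rel[OF _ c(2)]) (simp add: pick)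
    qed (use \<open>c \<noteq> []\<close> pick in auto)
    moreover have "xs ! last (map pick c) = last c" using \<open>c \<noteq> []\<close> pick[of "last c"] by (simp add: last_map)
    moreover have "kappa (last c) \<le> t - 1" using kappa_le[OF c(1), of "last c"] c(4) last_in_set[OF \<open>c \<noteq> []\<close>] by blast
    ultimately show False using c(5) \<open>0 < t\<close> by simp
  qed
  then have "n \<le> odeg F m" by (rule deg)
  also have "odeg F m = card {i. i < length xs \<and> xs ! i \<notin> F}"
    by (simp add: xs odeg_cmono length_filter_conv_card)
  also have "\<dots> \<le> card ({..<length xs} - F')" by (rule card_mono) (auto simp: F_def)
  also note card
  finally have n: "n \<le> (\<Sum>c\<leftarrow>map (map ((!) xs)) cs. length c - kappa (last c))"
  proof -
    assume "n \<le> (\<Sum>c\<leftarrow>cs. length c - kappa (xs ! last c))"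
    moreover have "(\<Sum>c\<leftarrow>cs. length c - kappa (xs ! last c)) = (\<Sum>c\<leftarrow>map (map ((!) xs)) cs. length c - kappa (last c))"
      unfolding map_map comp_def
      by (rule arg_cong[of _ _ sum_list], rule map_cong) (use chains in \<open>auto simp: last_map\<close>)
    ultimately show ?thesis by simp
  qed
  have "\<exists>f\<in>symbolic_power RR IR (\<Sum>c\<leftarrow>map (map ((!) xs)) cs. length c - kappa (last c)).
      f \<noteq> 0 \<and> lead f = cmono (concat (map (map ((!) xs)) cs))" (is "\<exists>f\<in>_. ?Q f")
  proof (rule chains_symbolic[OF cov])
    fix c assume "c \<in> set (map (map ((!) xs)) cs)"
    then obtain c' where c': "c' \<in> set cs" "c = map ((!) xs) c'" by auto
    have "set c' \<subseteq> {..<length xs}" using c'(1) cs(2) by auto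
    then have "set c \<subseteq> L" using xsL by (force simp: c'(2))
    then show "chain c \<and> c \<noteq> [] \<and> set c \<subseteq> L" using chains[OF c'(1)] by (simp add: c'(2) sorted_wrt_map)
  qed
  then obtain f where f: "f \<in> symbolic_power RR IR n" "?Q f" using symbolic_IR_antimono[OF n] by blast
  have "cmono (concat (map (map ((!) xs)) cs)) = m"
  proof -
    have "concat (map (map ((!) xs)) cs) = map ((!) xs) (concat cs)" by (simp add: map_concat)
    then have "cmono (concat (map (map ((!) xs)) cs)) = (\<Sum>i\<leftarrow>concat cs. single (xs ! i) 1)"
      by (simp add: cmono_def comp_def)
    also have "\<dots> = (\<Sum>i\<in>set (concat cs). single (xs ! i) 1)" by (rule sum_list_distinct_conv_sum_set[OF cs(1)])
    also have "\<dots> = (\<Sum>i<length xs. single (xs ! i) 1)" by (simp only: cs(2))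
    also have "\<dots> = cmono xs" by (simp add: cmono_def sum_list_sum_nth atLeast0LessThan)
    finally show ?thesis by (simp add: xs)
  qed
  with f(2) have "f \<noteq> 0 \<and> lead f = m" by simp
  then show ?thesis using f(1) by blast
qed

text \<open>Both sides are spanned by the monomials whose degree outside every face is at least
  \<open>n\<close>.\<close>

theorem initial_symbolic_power:
  assumes cov: "\<And>e. e \<in> L \<Longrightarrow> \<exists>(u, t)\<in>U. e \<in> subladder L u"
  shows "initial_ideal L ord (symbolic_power RR IR n) = symbolic_power RR (initial_ideal L ord IR) n"
  unfolding initial_IR
proof (rule initial_ideal_eqI)
  show "ideal (symbolic_power RR JJ n) RR" by (rule symbolic_power_ideal[OF JJ_ideal])
  show sub: "symbolic_power RR IR n \<subseteq> R" using mem_symbolic_IR by blast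
  fix f :: "'k mpol" assume f: "f \<in> symbolic_power RR IR n" "f \<noteq> 0"
  then have "lead f \<in> monomials L" using sub lead_in_keys[of f] by auto
  then show "single (lead f) 1 \<in> symbolic_power RR JJ n"
    by (rule monomial_symbolic_JJ) (rule lead_symbolic_odeg[OF f])
next
  fix f m assume f: "f \<in> symbolic_power RR JJ n" "m \<in> keys f"
  have "f \<in> R" using f(1) unfolding mem_symbolic_power by simp
  then have "m \<in> monomials L" using f(2) by auto
  then show "\<exists>g\<in>symbolic_power RR IR n. g \<noteq> 0 \<and> lead g = m"
    by (rule monomial_symbolic_IR[OF cov, rotated]) (rule odeg_symbolic_JJ[OF f])
qed

end

section \<open>Mixed ladder determinantal ideals\<close>

lemma ladder_convexI: "ladder k l L \<Longrightarrow> ladder_convex L"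
  by (simp add: ladder_def ladder_convex_def)

lemma ladder_finite: "ladder k l L \<Longrightarrow> finite L"
  by (rule finite_subset[of L "{1..k} \<times> {1..l}"]) (simp_all add: ladder_def)

definition corner_conditions :: "(nat \<times> nat) list \<Rightarrow> nat list \<Rightarrow> ((nat \<times> nat) \<times> nat) set" where
  "corner_conditions ds ts = {(ds ! h, ts ! h) | h. h < length ds}"

text \<open>Lower corners run weakly downwards and to the right, so none lies strictly north-east of
  another.\<close>

lemma good_corner_conditions:
  assumes ladder: "ladder k l L" and lower: "lower_outside_corners k L ds"
    and ts: "length ts = length ds" "\<forall>t \<in> set ts. t > 0"
  shows "good_conditions L (corner_conditions ds ts)"
proof -
  have sorted: "sorted_wrt (\<lambda>(d, c) (d', c'). d \<le> d' \<and> c \<le> c') ds" and ds: "set ds \<subseteq> L"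
    using lower by (simp_all add: lower_outside_corners_def)
  have incomp: "\<not> ne (ds ! h) (ds ! h')" if "h < length ds" "h' < length ds" for h h'
    using sorted_wrt_nth_less[OF sorted, of h h'] sorted_wrt_nth_less[OF sorted, of h' h] that
    by (cases h h' rule: linorder_cases) (auto simp: ne_def case_prod_beta)
  have "0 \<notin> fst ` L" using ladder by (auto simp: ladder_def)
  moreover have "u \<in> L \<and> 0 < t" if "(u, t) \<in> corner_conditions ds ts" for u t
    using that ds ts by (auto simp: corner_conditions_def)
  moreover have "\<not> ne u u'" if "(u, t) \<in> corner_conditions ds ts" "(u', t') \<in> corner_conditions ds ts" for u t u' t'
    using that incomp by (auto simp: corner_conditions_def)
  ultimately show ?thesis
    using ladder_convexI[OF ladder] ladder_finite[OF ladder] unfolding good_conditions_def by fast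
qed

text \<open>The retraction onto the polynomial ring of the ladder. It turns a combination of
  generators with coefficients in all variables into one with coefficients in that ring.\<close>

definition restrict_vars :: "(nat \<times> nat) set \<Rightarrow> 'k::comm_ring_1 mpol \<Rightarrow> 'k mpol" where
  "restrict_vars L = insertion (single 0) (\<lambda>e. if e \<in> L then var e else 0)"

lemma restrict_vars_hom: "comm_ring_hom (restrict_vars L)"
  unfolding restrict_vars_def by (rule insertion_hom[OF single_hom])

lemma restrict_vars_id: "f \<in> carrier (poly_ring_on L) \<Longrightarrow> restrict_vars L f = f"
  by (rule mpol_hom_eqI[OF restrict_vars_hom id_hom])
    (auto simp: restrict_vars_def insertion_single[OF single_hom] insertion_var[OF single_hom] monomials_def)

lemma restrict_vars_carrier: "restrict_vars L f \<in> carrier (poly_ring_on L)"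
proof (induction f rule: mpol_induct)
  case (single m c)
  obtain xs where m: "m = cmono xs" by (rule cmono_list)
  interpret comm_ring_hom "restrict_vars L :: 'a mpol \<Rightarrow> _" by (rule restrict_vars_hom)
  have "restrict_vars L (single (cmono xs) c) \<in> carrier (poly_ring_on L)"
  proof (induction xs)
    case Nil
    show ?case by (simp add: restrict_vars_def insertion_single[OF single_hom] monomials_def)
  next
    case (Cons e xs)
    have "single (cmono (e # xs)) c = var e * single (cmono xs) c"
      by (simp only: cmono_Cons var_def mult_single mult_1_left)
    then have "restrict_vars L (single (cmono (e # xs)) c) = restrict_vars L (var e) * restrict_vars L (single (cmono xs) c)"
      by (simp only: hom_mult)
    moreover have "restrict_vars L (var e) \<in> carrier (poly_ring_on L :: 'a mpol ring)"
      unfolding restrict_vars_def insertion_var[OF single_hom] by (simp add: var_def monomials_def)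
    ultimately show ?case using carrier_pring_closed(2) Cons.IH by metis
  qed
  then show ?case by (simp only: m)
next
  case (add f g)
  interpret comm_ring_hom "restrict_vars L :: 'a mpol \<Rightarrow> _" by (rule restrict_vars_hom)
  show ?case unfolding hom_add by (rule carrier_pring_closed(1)[OF add])
qed

context antidiagonal_conditions
begin

lemma minor_ideal_subset_IR:
  assumes "(u, t) \<in> U"
  shows "minor_ideal L t (subladder L u) \<subseteq> IR"
proof -
  interpret cring RR by (rule cring_pring)
  show ?thesis
    unfolding minor_ideal_def
  proof (rule genideal_minimal[OF IR_ideal], rule subsetI)
    fix g :: "'k mpol" assume "g \<in> {minor rs cs | rs cs. minor_in (subladder L u) t rs cs}"
    then obtain rs cs where g: "g = minor rs cs" "length rs = t" "length cs = t" "set rs \<times> set cs \<subseteq> subladder L u"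
      by (auto simp: minor_in_def)
    have "g \<in> I" unfolding g(1) by (rule minor_in_block_ideal[OF assms g(2-4)])
    moreover have "g \<in> R"
    proof -
      have "keys m \<subseteq> L" if "m \<in> keys g" for m
        using keys_minor[of m rs cs, where 'k = 'k] that g subladder_subset[of L u] by auto
      then show ?thesis by (auto simp: monomials_def)
    qed
    ultimately show "g \<in> IR" by (simp add: IR_def)
  qed
qed

text \<open>\<open>minor_ideal\<close> is generated by minors with increasing index lists,
  \<open>minor_gens\<close> admits all lists; sorting costs at most a sign.\<close>

lemma ideal_minor_ideal: "L' \<subseteq> L \<Longrightarrow> ideal (minor_ideal L t L' :: 'k mpol set) RR"
  and minor_in_minor_ideal: "L' \<subseteq> L \<Longrightarrow> length rs = t \<Longrightarrow> length cs = t \<Longrightarrow> set rs \<times> set cs \<subseteq> L' \<Longrightarrow>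
    (minor rs cs :: 'k mpol) \<in> minor_ideal L t L'"
proof -
  interpret cring RR by (rule cring_pring)
  let ?G = "{minor rs cs | rs cs. minor_in L' t rs cs} :: 'k mpol set"
  assume L': "L' \<subseteq> L"
  have G: "?G \<subseteq> carrier RR"
  proof
    fix g assume "g \<in> ?G"
    then obtain rs cs where g: "g = minor rs cs" "length cs = length rs" "set rs \<times> set cs \<subseteq> L'"
      by (auto simp: minor_in_def)
    have "keys m \<subseteq> L" if "m \<in> keys g" for m
      using keys_minor[of m rs cs, where 'k = 'k] that g L' by auto
    then show "g \<in> carrier RR" by (auto simp: monomials_def)
  qed
  show id: "ideal (minor_ideal L t L' :: 'k mpol set) RR"
    unfolding minor_ideal_def by (rule genideal_ideal[OF G])
  note idD = ideal_pringD[OF id]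
  assume rc: "length rs = t" "length cs = t" "set rs \<times> set cs \<subseteq> L'"
  show "(minor rs cs :: 'k mpol) \<in> minor_ideal L t L'"
  proof (cases "distinct rs \<and> distinct cs")
    case False
    then have "minor rs cs = (0 :: 'k mpol)"
      using rc by (auto simp: minor_eq_gminor gminor_not_distinct_rows gminor_not_distinct_cols)
    then show ?thesis using idD(2) by simp
  next
    case True
    have "minor_in L' t (sort rs) (sort cs)" using True rc by (simp add: minor_in_def strict_sorted_iff)
    then have "(minor (sort rs) (sort cs) :: 'k mpol) \<in> ?G" by blast
    then have s: "(minor (sort rs) (sort cs) :: 'k mpol) \<in> minor_ideal L t L'"
      unfolding minor_ideal_def using genideal_self[OF G] by blast
    have "- minor (sort rs) (sort cs) \<in> (minor_ideal L t L' :: 'k mpol set)"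
      using idD(4)[OF _ s, of "- 1"] carrier_pring_closed(3)[of 1 L] R_1 by simp
    moreover have "minor rs cs = (minor (sort rs) (sort cs) :: 'k mpol) \<or> minor rs cs = - (minor (sort rs) (sort cs) :: 'k mpol)"
      unfolding minor_eq_gminor by (rule gminor_permute) (use rc in simp_all)
    ultimately show ?thesis using s by auto
  qed
qed

lemma mixed_ideal_eq_IR:
  assumes U: "U = corner_conditions ds ts"
  shows "mixed_ideal L ds ts = IR"
proof
  let ?J = "\<lambda>h. minor_ideal L (ts ! h) (subladder L (ds ! h)) :: 'k mpol set"
  have id: "ideal (?J h) RR" for h by (rule ideal_minor_ideal[OF subladder_subset])
  show "mixed_ideal L ds ts \<subseteq> IR"
  proof
    fix x :: "'k mpol" assume "x \<in> mixed_ideal L ds ts"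
    then obtain f where f: "x = (\<Sum>h<length ds. f h)" "\<And>h. h < length ds \<Longrightarrow> f h \<in> ?J h"
      by (auto simp: mixed_ideal_def)
    have "f h \<in> IR" if "h < length ds" for h
      using f(2)[OF that] minor_ideal_subset_IR[of "ds ! h" "ts ! h"] that by (auto simp: U corner_conditions_def)
    then show "x \<in> IR" unfolding f(1) by (intro ideal_pring_sum[OF IR_ideal]) simp
  qed
  have add: "x + y \<in> mixed_ideal L ds ts" if xy: "x \<in> mixed_ideal L ds ts" "y \<in> mixed_ideal L ds ts" for x y :: "'k mpol"
  proof -
    obtain f g where f: "x = (\<Sum>h<length ds. f h)" "\<And>h. h < length ds \<Longrightarrow> f h \<in> ?J h"
      and g: "y = (\<Sum>h<length ds. g h)" "\<And>h. h < length ds \<Longrightarrow> g h \<in> ?J h"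
      using xy by (auto simp: mixed_ideal_def)
    have "f h + g h \<in> ?J h" if "h < length ds" for h by (rule ideal_pringD(3)[OF id f(2)[OF that] g(2)[OF that]])
    then show ?thesis unfolding mixed_ideal_def
      by (intro CollectI exI[of _ "\<lambda>h. f h + g h"]) (simp add: f(1) g(1) sum.distrib)
  qed
  have zero: "0 \<in> (mixed_ideal L ds ts :: 'k mpol set)"
    unfolding mixed_ideal_def using ideal_pringD(2)[OF id] by (intro CollectI exI[of _ "\<lambda>_. 0"]) simp
  have one: "x \<in> mixed_ideal L ds ts" if h: "h < length ds" "x \<in> ?J h" for x h
    unfolding mixed_ideal_def using h ideal_pringD(2)[OF id]
    by (intro CollectI exI[of _ "\<lambda>i. if i = h then x else 0"]) simp
  interpret comm_ring_hom "restrict_vars L :: 'k mpol \<Rightarrow> _" by (rule restrict_vars_hom)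
  have "restrict_vars L x \<in> mixed_ideal L ds ts" if "x \<in> I" for x :: "'k mpol"
    using that
  proof (induction rule: gen_ideal_induct)
    case zero
    then show ?case using \<open>0 \<in> mixed_ideal L ds ts\<close> by simp
  next
    case (step r g x)
    obtain rs cs h where g: "g = minor rs cs" "h < length ds" "length rs = ts ! h" "length cs = ts ! h"
      "set rs \<times> set cs \<subseteq> subladder L (ds ! h)"
      using step.hyps(1) by (auto simp: minor_gens_def U corner_conditions_def)
    have gJ: "g \<in> ?J h" unfolding g(1) by (rule minor_in_minor_ideal[OF subladder_subset g(3-5)])
    then have "restrict_vars L g = g" using ideal_pringD(1)[OF id] by (blast intro: restrict_vars_id)
    moreover have "restrict_vars L r * g \<in> ?J h" by (rule ideal_pringD(4)[OF id restrict_vars_carrier gJ])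
    ultimately show ?case using add[OF one[OF g(2)] step.IH] by (simp only: hom_add hom_mult)
  qed
  moreover have "restrict_vars L x = x" if "x \<in> IR" for x :: "'k mpol"
    using that by (intro restrict_vars_id) (simp add: IR_def)
  ultimately show "IR \<subseteq> mixed_ideal L ds ts" by (fastforce simp: IR_def)
qed

end

theorem corollary4p5:
  fixes p k l :: nat
    and L :: "(nat \<times> nat) set"
    and us ds :: "(nat \<times> nat) list"
    and ts :: "nat list"
    and ord :: "monomial rel"
    and I :: "'k::field mpol set"
  assumes char: "CHAR('k) = p" "p > 0"
    and perfect: "perfect_field TYPE('k)"
    and ladder: "ladder k l L"
    and upper: "upper_outside_corners l L us"
    and lower: "lower_outside_corners k L ds"
    and corners_distinct: "distinct (us @ ds)"
    and ts: "length ts = length ds" "\<forall>t \<in> set ts. t > 0"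
    and I: "I = mixed_ideal L ds ts"
    and entries_involved: "\<forall>x \<in> L. \<exists>h < length ds. \<exists>rs cs.
          minor_in (subladder L (ds ! h)) (ts ! h) rs cs \<and> x \<in> set rs \<times> set cs"
    and irredundant: "\<forall>i < length ds. \<forall>j < length ds. i \<noteq> j \<longrightarrow>
          \<not> (minor_ideal L (ts ! i) (subladder L (ds ! i)) :: 'k mpol set)
              \<subseteq> minor_ideal L (ts ! j) (subladder L (ds ! j))"
    and no_proper_submatrix: "\<forall>A B. A \<subseteq> {1..k} \<and> B \<subseteq> {1..l} \<and> L \<subseteq> A \<times> B \<longrightarrow>
          A = {1..k} \<and> B = {1..l}"
    and order: "antidiagonal_order TYPE('k) L ord"
  shows "(noetherian_ring (initial_symbolic_rees L ord I) \<longrightarrow>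
            (\<forall>m g b. homogeneous_generators L ord I m g b \<and> p > Lcm (b ` {..<m}) \<longrightarrow>
              (\<forall>n. initial_ideal L ord (symbolic_power (poly_ring_on L) I n) =
                   symbolic_power (poly_ring_on L) (initial_ideal L ord I) n)))
       \<and> (\<forall>t > 0. I = minor_ideal L t L \<and> p > fact (min k l - t + 1) \<longrightarrow>
            (\<forall>n. initial_ideal L ord (symbolic_power (poly_ring_on L) I n) =
                 symbolic_power (poly_ring_on L) (initial_ideal L ord I) n))"
proof -
  define U where "U = corner_conditions ds ts"
  interpret antidiagonal_conditions L ord "TYPE('k)" U
    by unfold_locales
      (use order ladder_finite[OF ladder] ladder_convexI[OF ladder] good_corner_conditions[OF ladder lower ts]
        in \<open>simp_all add: U_def\<close>)
  have IR: "IR = I" using mixed_ideal_eq_IR[OF U_def] I by simp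
  \<comment> \<open>This makes the least value in \<open>kappa\<close> exist at every entry of
    \<open>L\<close>.\<close>
  have "\<exists>(u, t)\<in>U. e \<in> subladder L u" if "e \<in> L" for e
  proof -
    obtain h rs cs where h: "h < length ds" "minor_in (subladder L (ds ! h)) (ts ! h) rs cs" "e \<in> set rs \<times> set cs"
      using bspec[OF entries_involved \<open>e \<in> L\<close>] by (elim exE conjE)
    then have "(ds ! h, ts ! h) \<in> U" "e \<in> subladder L (ds ! h)"
      by (auto simp: U_def corner_conditions_def minor_in_def)
    then show ?thesis by blast
  qed
  then have "initial_ideal L ord (symbolic_power (poly_ring_on L) I n) =
      symbolic_power (poly_ring_on L) (initial_ideal L ord I) n" for n
    using initial_symbolic_power unfolding IR by blast
  then show ?thesis by blast
qed

end
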